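(* The Identity Problem and the Subgroup Problem are uniformly decidable in the class of finitely generated nilpotent groups. That is, each of the following two decision problems is decidable. Uniform Identity Problem. Input: a finite presentation $\langle X\mid R\rangle$ of a nilpotent group $G$ and a finite set $S\subset (X\cup X^{-1})^*$. Output: YES or NO to the question "Is the identity element $e_G$ in $S^+$?". Uniform Subgroup Problem. Input: a finite presentation $\langle X\mid R\rangle$ of a nilpotent group $G$ and a finite set $S\subset (X\cup X^{-1})^*$. Output: YES or NO to the question "Is the subsemigroup $S^+$ a subgroup of $G$?".
   Context: $(X\cup X^{-1})^*$ denotes the set of words over $X\cup X^{-1}$; each word represents an element of $G=\langle X\mid R\rangle$. $S^+$ denotes the subsemigroup of $G$ generated by the elements of $G$ represented by the words in $S$, i.e. the set of all products of $\ell\ge1$ such elements (empty if $S=\emptyset$). The presentation is part of the input, and a single algorithm must give the correct answer for every input whose presentation defines a nilpotent group (the input is promised to be of this form). *)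

theory Defs
  imports "HOL-Algebra.Generated_Groups" "HOL-Library.Nat_Bijection"
begin

section \<open>Partial recursive functions\<close>

datatype recf =
    Zero_fn
  | Succ_fn
  | Proj_fn nat
  | Comp_fn recf "recf list"
  | Prec_fn recf recf
  | Mu_fn recf

text \<open>
  \<open>None\<close> means that the computation does not terminate (or that the program is applied to an
  argument list of the wrong length). Composition is strict, and unbounded search requires the
  searched function to be defined at all arguments below the zero that is found.
\<close>

fun eval_recf :: "recf \<Rightarrow> nat list \<Rightarrow> nat option" where
  "eval_recf Zero_fn xs = Some 0"
| "eval_recf Succ_fn xs = (case xs of [x] \<Rightarrow> Some (Suc x) | _ \<Rightarrow> None)"
| "eval_recf (Proj_fn i) xs = (if i < length xs then Some (xs ! i) else None)"
| "eval_recf (Comp_fn f gs) xs =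
     (let ys = map (\<lambda>g. eval_recf g xs) gs
      in if None \<in> set ys then None else eval_recf f (map the ys))"
| "eval_recf (Prec_fn f g) xs =
     (case xs of
        [] \<Rightarrow> None
      | n # zs \<Rightarrow>
          rec_nat (eval_recf f zs)
            (\<lambda>k r. case r of None \<Rightarrow> None | Some v \<Rightarrow> eval_recf g (k # v # zs)) n)"
| "eval_recf (Mu_fn f) xs =
     (if \<exists>z. eval_recf f (z # xs) = Some 0 \<and> (\<forall>y<z. eval_recf f (y # xs) \<noteq> None)
      then Some (LEAST z. eval_recf f (z # xs) = Some 0)
      else None)"

text \<open>
  Decidability of a promise problem: one algorithm answers correctly (1 for YES, 0 for NO) on
  every instance in \<open>D\<close>; its behaviour outside \<open>D\<close>, including termination, is unconstrained.
\<close>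

definition decidable_on :: "('i \<Rightarrow> nat) \<Rightarrow> 'i set \<Rightarrow> ('i \<Rightarrow> bool) \<Rightarrow> bool" where
  "decidable_on enc D P \<longleftrightarrow>
     (\<exists>f. \<forall>i\<in>D. eval_recf f [enc i] = Some (if P i then 1 else 0))"


section \<open>Group presentations\<close>

text \<open>The letter \<open>(x, False)\<close> stands for \<open>x\<close> and \<open>(x, True)\<close> for its formal inverse.\<close>

type_synonym 'a gword = "('a \<times> bool) list"

definition words_over :: "'a set \<Rightarrow> 'a gword set" where
  "words_over X = lists (X \<times> UNIV)"

text \<open>The congruence on words generated by free cancellation and by the relators in \<open>R\<close>.\<close>

inductive_set pres_rel :: "'a set \<Rightarrow> 'a gword set \<Rightarrow> ('a gword \<times> 'a gword) set"
  for X :: "'a set" and R :: "'a gword set" where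
  refl: "w \<in> words_over X \<Longrightarrow> (w, w) \<in> pres_rel X R"
| sym: "(v, w) \<in> pres_rel X R \<Longrightarrow> (w, v) \<in> pres_rel X R"
| trans: "(u, v) \<in> pres_rel X R \<Longrightarrow> (v, w) \<in> pres_rel X R \<Longrightarrow> (u, w) \<in> pres_rel X R"
| cancel: "u \<in> words_over X \<Longrightarrow> v \<in> words_over X \<Longrightarrow> x \<in> X \<Longrightarrow>
    (u @ [(x, b), (x, \<not> b)] @ v, u @ v) \<in> pres_rel X R"
| relator: "u \<in> words_over X \<Longrightarrow> v \<in> words_over X \<Longrightarrow> r \<in> R \<Longrightarrow> r \<in> words_over X \<Longrightarrow>
    (u @ r @ v, u @ v) \<in> pres_rel X R"

definition word_elt :: "'a set \<Rightarrow> 'a gword set \<Rightarrow> 'a gword \<Rightarrow> 'a gword set" where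
  "word_elt X R w = pres_rel X R `` {w}"

definition pres_group :: "'a set \<Rightarrow> 'a gword set \<Rightarrow> 'a gword set monoid" where
  "pres_group X R =
     \<lparr>carrier = words_over X // pres_rel X R,
      mult = (\<lambda>A B. \<Union>u\<in>A. \<Union>v\<in>B. word_elt X R (u @ v)),
      one = word_elt X R []\<rparr>"

lemma words_over_simps [simp]:
  "[] \<in> words_over X"
  "(p # w) \<in> words_over X \<longleftrightarrow> fst p \<in> X \<and> w \<in> words_over X"
  "(v @ w) \<in> words_over X \<longleftrightarrow> v \<in> words_over X \<and> w \<in> words_over X"
  by (auto simp: words_over_def mem_Times_iff)

lemma pres_rel_words:
  "(v, w) \<in> pres_rel X R \<Longrightarrow> v \<in> words_over X \<and> w \<in> words_over X"
  by (induction rule: pres_rel.induct) auto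

lemma equiv_pres_rel: "equiv (words_over X) (pres_rel X R)"
proof (rule equivI)
  show "pres_rel X R \<subseteq> words_over X \<times> words_over X"
    using pres_rel_words by fast
  show "refl_on (words_over X) (pres_rel X R)"
    by (rule refl_onI) (rule pres_rel.refl)
  show "sym (pres_rel X R)"
    by (rule symI) (rule pres_rel.sym)
  show "trans (pres_rel X R)"
    by (rule transI) (rule pres_rel.trans)
qed

lemma pres_rel_context:
  assumes "(v, w) \<in> pres_rel X R" "a \<in> words_over X" "b \<in> words_over X"
  shows "(a @ v @ b, a @ w @ b) \<in> pres_rel X R"
  using assms(1)
proof (induction rule: pres_rel.induct)
  case (refl w)
  then show ?case using assms by (intro pres_rel.refl) auto
next
  case (sym v w)
  then show ?case by (blast intro: pres_rel.sym)
next
  case (trans u v w)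
  then show ?case by (blast intro: pres_rel.trans)
next
  case (cancel u v x c)
  then show ?case using assms pres_rel.cancel[of "a @ u" X "v @ b" x c R] by simp
next
  case (relator u v r)
  then show ?case using assms pres_rel.relator[of "a @ u" X "v @ b" r R] by simp
qed

lemma pres_rel_append:
  assumes "(v, v') \<in> pres_rel X R" "(w, w') \<in> pres_rel X R"
  shows "(v @ w, v' @ w') \<in> pres_rel X R"
proof (rule pres_rel.trans)
  show "(v @ w, v' @ w) \<in> pres_rel X R"
    using pres_rel_context[OF assms(1), of "[]" w] pres_rel_words[OF assms(2)] by simp
  show "(v' @ w, v' @ w') \<in> pres_rel X R"
    using pres_rel_context[OF assms(2), of v' "[]"] pres_rel_words[OF assms(1)] by simp
qed

lemma word_elt_eq_iff:
  "v \<in> words_over X \<Longrightarrow> w \<in> words_over X \<Longrightarrow>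
    word_elt X R v = word_elt X R w \<longleftrightarrow> (v, w) \<in> pres_rel X R"
  unfolding word_elt_def using eq_equiv_class_iff[OF equiv_pres_rel] by metis

lemma carrier_pres_group: "carrier (pres_group X R) = word_elt X R ` words_over X"
  by (auto simp: pres_group_def quotient_def word_elt_def)

lemma one_pres_group: "\<one>\<^bsub>pres_group X R\<^esub> = word_elt X R []"
  by (simp add: pres_group_def)

lemma mult_pres_group:
  assumes "v \<in> words_over X" "w \<in> words_over X"
  shows "word_elt X R v \<otimes>\<^bsub>pres_group X R\<^esub> word_elt X R w = word_elt X R (v @ w)"
proof -
  have eq: "word_elt X R (v' @ w') = word_elt X R (v @ w)"
    if "v' \<in> word_elt X R v" "w' \<in> word_elt X R w" for v' w'
  proof -
    have *: "(v, v') \<in> pres_rel X R" "(w, w') \<in> pres_rel X R"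
      using that by (auto simp: word_elt_def)
    show ?thesis
      using pres_rel_append[OF *] assms pres_rel_words[OF *(1)] pres_rel_words[OF *(2)]
      by (subst word_elt_eq_iff) (auto intro: pres_rel.sym)
  qed
  have "v \<in> word_elt X R v" "w \<in> word_elt X R w"
    using assms by (auto simp: word_elt_def intro: pres_rel.refl)
  then have "(\<Union>v'\<in>word_elt X R v. \<Union>w'\<in>word_elt X R w. word_elt X R (v' @ w')) = word_elt X R (v @ w)"
    using eq by blast
  then show ?thesis by (simp add: pres_group_def)
qed

lemma pres_rel_left_inverse:
  "w \<in> words_over X \<Longrightarrow>
    (rev (map (\<lambda>(x, b). (x, \<not> b)) w) @ w, []) \<in> pres_rel X R \<and>
    rev (map (\<lambda>(x, b). (x, \<not> b)) w) \<in> words_over X"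
proof (induction w)
  case Nil
  then show ?case by (auto intro: pres_rel.refl)
next
  case (Cons p w)
  obtain x b where p: "p = (x, b)" by force
  let ?i = "rev (map (\<lambda>(x, b). (x, \<not> b)) w)"
  have *: "(?i @ w, []) \<in> pres_rel X R" "?i \<in> words_over X" "w \<in> words_over X" "x \<in> X"
    using Cons p by auto
  have "(?i @ [(x, \<not> b), (x, \<not> \<not> b)] @ w, ?i @ w) \<in> pres_rel X R"
    using * by (intro pres_rel.cancel) auto
  from pres_rel.trans[OF this *(1)] show ?case using * p by simp
qed

lemma group_pres_group: "group (pres_group X R)"
proof (rule groupI)
  fix a assume "a \<in> carrier (pres_group X R)"
  then obtain w where w: "w \<in> words_over X" "a = word_elt X R w"
    by (auto simp: carrier_pres_group)
  then show "\<exists>b\<in>carrier (pres_group X R). b \<otimes>\<^bsub>pres_group X R\<^esub> a = \<one>\<^bsub>pres_group X R\<^esub>"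
    using pres_rel_left_inverse[of w X R]
    by (intro bexI[of _ "word_elt X R (rev (map (\<lambda>(x, b). (x, \<not> b)) w))"])
      (auto simp: carrier_pres_group one_pres_group mult_pres_group word_elt_eq_iff)
qed (auto simp: carrier_pres_group one_pres_group mult_pres_group)


section \<open>Nilpotent groups and generated subsemigroups\<close>

primrec lower_central :: "('a, 'b) monoid_scheme \<Rightarrow> nat \<Rightarrow> 'a set" where
  "lower_central G 0 = carrier G"
| "lower_central G (Suc n) =
     generate G {g \<otimes>\<^bsub>G\<^esub> h \<otimes>\<^bsub>G\<^esub> inv\<^bsub>G\<^esub> g \<otimes>\<^bsub>G\<^esub> inv\<^bsub>G\<^esub> h | g h.
       g \<in> lower_central G n \<and> h \<in> carrier G}"

definition nilpotent_group :: "('a, 'b) monoid_scheme \<Rightarrow> bool" where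
  "nilpotent_group G \<longleftrightarrow> group G \<and> (\<exists>c. lower_central G c = {\<one>\<^bsub>G\<^esub>})"

inductive_set semigroup_span :: "('a, 'b) monoid_scheme \<Rightarrow> 'a set \<Rightarrow> 'a set"
  for G and A where
  incl: "a \<in> A \<Longrightarrow> a \<in> semigroup_span G A"
| mult: "a \<in> semigroup_span G A \<Longrightarrow> b \<in> semigroup_span G A \<Longrightarrow>
    a \<otimes>\<^bsub>G\<^esub> b \<in> semigroup_span G A"


section \<open>The two decision problems\<close>

text \<open>
  An instance \<open>(n, rs, ss)\<close> consists of the presentation with generators \<open>0, \<dots>, n - 1\<close> and list of
  relators \<open>rs\<close>, together with a list \<open>ss\<close> of words enumerating the finite set \<open>S\<close>.
\<close>

type_synonym problem_instance = "nat \<times> nat gword list \<times> nat gword list"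

definition encode_word :: "nat gword \<Rightarrow> nat" where
  "encode_word w = list_encode (map (\<lambda>(x, b). prod_encode (x, of_bool b)) w)"

fun encode_instance :: "problem_instance \<Rightarrow> nat" where
  "encode_instance (n, rs, ss) =
     prod_encode (n, prod_encode (list_encode (map encode_word rs), list_encode (map encode_word ss)))"

fun instance_group :: "problem_instance \<Rightarrow> nat gword set monoid" where
  "instance_group (n, rs, ss) = pres_group {..<n} (set rs)"

fun instance_semigroup :: "problem_instance \<Rightarrow> nat gword set set" where
  "instance_semigroup (n, rs, ss) =
     semigroup_span (pres_group {..<n} (set rs)) (word_elt {..<n} (set rs) ` set ss)"

definition nilpotent_instances :: "problem_instance set" where
  "nilpotent_instances =
     {(n, rs, ss). set rs \<subseteq> words_over {..<n} \<and> set ss \<subseteq> words_over {..<n} \<and>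
        nilpotent_group (pres_group {..<n} (set rs))}"

definition identity_problem :: "problem_instance \<Rightarrow> bool" where
  "identity_problem i \<longleftrightarrow> \<one>\<^bsub>instance_group i\<^esub> \<in> instance_semigroup i"

definition subgroup_problem :: "problem_instance \<Rightarrow> bool" where
  "subgroup_problem i \<longleftrightarrow> subgroup (instance_semigroup i) (instance_group i)"

end

theory Submission
  imports Defs
begin

text \<open>
  Say that a finite set \<open>T\<close> of words is \<^emph>\<open>full\<close> if some product using every element of \<open>T\<close> is trivial in \<open>G\<close>.
  Then the identity lies in \<open>S\<^sup>+\<close> iff some nonempty subset of \<open>S\<close> is full, and \<open>S\<^sup>+\<close> is a subgroup iff
  \<open>S\<close> is nonempty and full. Fullness is semidecidable; for nilpotent \<open>G\<close> so is its negation, because \<open>T\<close> fails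
  to be full exactly if there is a polynomial function \<open>f\<close> from \<open>G\<close> to the integers with
  \<open>f (g t) = f g + c t\<close>, all \<open>c t \<ge> 0\<close> and not all \<open>c t = 0\<close>. Such a function is determined by a finite
  table of coefficients, and being well defined on \<open>G\<close> amounts to finitely many linear equations.

  To find \<open>f\<close>, call a subsemigroup \<open>M\<close> saturated if every element has a positive power in \<open>M\<close>. If \<open>M\<close> is
  saturated modulo the commutator subgroup then it is saturated, since commutators of \<open>n\<close>-th powers grow
  quadratically. So, by Stiemke's lemma in the abelianization, either \<open>T\<close> is full or there is a nonzero
  homomorphism \<open>\<phi>\<close> to the integers that is nonnegative on \<open>T\<close>. Either \<open>\<phi>\<close> is positive somewhere on \<open>T\<close>
  and \<open>f = \<phi>\<close>, or \<open>T\<close> lies in the kernel \<open>K\<close>, which has smaller Hirsch length. In the latter case a polynomial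
  \<open>f\<close> on \<open>K\<close> extends to \<open>G\<close>, the product of \<open>K\<close> with a cyclic group generated by \<open>t\<close>, by
  \<open>f (t\<^sup>i k) = f k\<close>; this is polynomial because \<open>t\<close> acts unipotently on \<open>K\<close>.
\<close>

section \<open>Computability\<close>

subsection \<open>Recursive functions on numbers\<close>

text \<open>Homomorphisms to the integers alone cannot refute fullness: a generator of the centre of
  the Heisenberg group has infinite order, yet every homomorphism to the integers kills it. Hence
  polynomials of higher degree. Their degree is measured by left differences, while the law
  \<open>f (g t) = f g + c t\<close> concerns right multiplication; the two actions commute, so an
  extension from the kernel keeps both the law and its constants. The degree bound also makes
  \<open>f\<close> a finite object. The iterated differences of \<open>f\<close> at the empty word
  are its Magnus coefficients: they vanish on long words and determine \<open>f\<close> on all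
  words. A table of them is checked against the relators alone, without deciding equality in the
  group and without knowing its class. Nilpotency is what guarantees that a table exists, so a
  parallel search for a trivial product or a table is uniform in the presentation. For a negative
  answer to the identity problem each nonempty subset of \<open>S\<close> gets its own table,
  because the constants of one function may all vanish on a smaller subset.\<close>

definition rec_fun :: "(nat \<Rightarrow> nat) \<Rightarrow> bool" where
  "rec_fun F \<longleftrightarrow> (\<exists>r. \<forall>x. eval_recf r [x] = Some (F x))"

definition rec_fun2 :: "(nat \<Rightarrow> nat \<Rightarrow> nat) \<Rightarrow> bool" where
  "rec_fun2 F \<longleftrightarrow> (\<exists>r. \<forall>x y. eval_recf r [x, y] = Some (F x y))"

lemma rec_fun_id: "rec_fun (\<lambda>x. x)"
  unfolding rec_fun_def by (rule exI[of _ "Proj_fn 0"]) simp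

lemma rec_fun_Suc: "rec_fun F \<Longrightarrow> rec_fun (\<lambda>x. Suc (F x))"
  unfolding rec_fun_def
proof (elim exE)
  fix r assume "\<forall>x. eval_recf r [x] = Some (F x)"
  then show "\<exists>r. \<forall>x. eval_recf r [x] = Some (Suc (F x))"
    by (intro exI[of _ "Comp_fn Succ_fn [r]"]) simp
qed

lemma rec_fun_const: "rec_fun (\<lambda>x. c)"
proof (induction c)
  case 0
  show ?case unfolding rec_fun_def by (rule exI[of _ Zero_fn]) simp
qed (rule rec_fun_Suc)

lemma rec_fun_comp: "rec_fun F \<Longrightarrow> rec_fun G \<Longrightarrow> rec_fun (\<lambda>x. F (G x))"
  unfolding rec_fun_def
proof (elim exE)
  fix r s assume "\<forall>x. eval_recf r [x] = Some (F x)" "\<forall>x. eval_recf s [x] = Some (G x)"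
  then show "\<exists>r. \<forall>x. eval_recf r [x] = Some (F (G x))"
    by (intro exI[of _ "Comp_fn r [s]"]) simp
qed

lemma rec_fun2_comp: "rec_fun2 F \<Longrightarrow> rec_fun G \<Longrightarrow> rec_fun H \<Longrightarrow> rec_fun (\<lambda>x. F (G x) (H x))"
  unfolding rec_fun_def rec_fun2_def
proof (elim exE)
  fix r s t assume "\<forall>x y. eval_recf r [x, y] = Some (F x y)"
    "\<forall>x. eval_recf s [x] = Some (G x)" "\<forall>x. eval_recf t [x] = Some (H x)"
  then show "\<exists>r. \<forall>x. eval_recf r [x] = Some (F (G x) (H x))"
    by (intro exI[of _ "Comp_fn r [s, t]"]) simp
qed

lemma rec_fun_iter2:
  assumes "rec_fun F" shows "rec_fun2 (\<lambda>n y. (F ^^ n) y)"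
proof -
  obtain r where r: "\<And>x. eval_recf r [x] = Some (F x)" using assms by (auto simp: rec_fun_def)
  have "eval_recf (Prec_fn (Proj_fn 0) (Comp_fn r [Proj_fn 1])) [n, y] = Some ((F ^^ n) y)" for n y
    by (induction n) (simp_all add: r)
  then show ?thesis unfolding rec_fun2_def by blast
qed

lemma rec_fun_iter:
  "rec_fun F \<Longrightarrow> rec_fun N \<Longrightarrow> rec_fun Y \<Longrightarrow> rec_fun (\<lambda>x. (F ^^ N x) (Y x))"
  using rec_fun2_comp[OF rec_fun_iter2] .

lemma rec_fun2_add: "rec_fun2 (\<lambda>x y. x + y)"
proof -
  have "(Suc ^^ n) y = n + y" for n y by (induction n) auto
  then show ?thesis using rec_fun_iter2[OF rec_fun_Suc[OF rec_fun_id]] by simp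
qed

lemmas rec_fun_add = rec_fun2_comp[OF rec_fun2_add]

lemma rec_fun_pred: "rec_fun F \<Longrightarrow> rec_fun (\<lambda>x. F x - 1)"
proof (erule rec_fun_comp[rotated])
  \<comment> \<open>The step program sees the counter first and returns it, so after
    \<open>n\<close> steps the value is \<open>n - 1\<close>; \<open>y\<close> is a dummy
    argument.\<close>
  have "eval_recf (Prec_fn Zero_fn (Proj_fn 0)) [n, y] = Some (n - 1)" for n y
    by (induction n) auto
  then have "rec_fun2 (\<lambda>n y. n - 1)" unfolding rec_fun2_def by blast
  from rec_fun2_comp[OF this rec_fun_id rec_fun_id] show "rec_fun (\<lambda>x. x - 1)" .
qed

text \<open>Subtraction is the iterated predecessor, and \<open>Prec_fn\<close> recurses on the head
  of its argument list; hence the swapped arguments.\<close>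

lemma rec_fun2_diff: "rec_fun2 (\<lambda>x y. y - x)"
proof -
  have "((\<lambda>x. x - 1) ^^ n) y = y - n" for n y :: nat by (induction n) auto
  then show ?thesis using rec_fun_iter2[OF rec_fun_pred[OF rec_fun_id]] by simp
qed

lemma rec_fun_diff: "rec_fun F \<Longrightarrow> rec_fun G \<Longrightarrow> rec_fun (\<lambda>x. F x - G x)"
  using rec_fun2_comp[OF rec_fun2_diff] by fast

lemma rec_fun_triangle: "rec_fun F \<Longrightarrow> rec_fun (\<lambda>x. triangle (F x))"
proof (erule rec_fun_comp[rotated])
  obtain r where r: "\<And>x y. eval_recf r [x, y] = Some (x + y)"
    using rec_fun2_add by (auto simp: rec_fun2_def)
  have "eval_recf (Prec_fn Zero_fn (Comp_fn r [Proj_fn 1, Comp_fn Succ_fn [Proj_fn 0]])) [n, y] =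
     Some (triangle n)" for n y
    by (induction n) (simp_all add: r)
  then have "rec_fun2 (\<lambda>n y. triangle n)" unfolding rec_fun2_def by blast
  from rec_fun2_comp[OF this rec_fun_id rec_fun_id] show "rec_fun triangle" .
qed

lemma rec_fun_Least:
  assumes F: "rec_fun2 F" and ex: "\<And>x. \<exists>z. F z x = 0"
  shows "rec_fun (\<lambda>x. LEAST z. F z x = 0)"
proof -
  obtain r where r: "\<And>x y. eval_recf r [x, y] = Some (F x y)" using F by (auto simp: rec_fun2_def)
  have "eval_recf (Mu_fn r) [x] = Some (LEAST z. F z x = 0)" for x
    using ex[of x] by (simp add: r)
  then show ?thesis unfolding rec_fun_def by blast
qed

section \<open>Cantor pairing and its inverses\<close>

definition pair_nat :: "nat \<Rightarrow> nat \<Rightarrow> nat" where "pair_nat x y = prod_encode (x, y)"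
definition fst_nat :: "nat \<Rightarrow> nat" where "fst_nat x = fst (prod_decode x)"
definition snd_nat :: "nat \<Rightarrow> nat" where "snd_nat x = snd (prod_decode x)"

lemma fst_snd_pair_nat [simp]: "fst_nat (pair_nat x y) = x" "snd_nat (pair_nat x y) = y"
  by (simp_all add: pair_nat_def fst_nat_def snd_nat_def)

lemma rec_fun_pair_nat: "rec_fun F \<Longrightarrow> rec_fun G \<Longrightarrow> rec_fun (\<lambda>x. pair_nat (F x) (G x))"
  unfolding pair_nat_def prod_encode_def by (simp add: rec_fun_add rec_fun_triangle)

lemma triangle_mono: "m \<le> n \<Longrightarrow> triangle m \<le> triangle n"
  by (induction n) (auto simp: le_Suc_eq)

text \<open>Pairs are numbered diagonal by diagonal, the diagonal of sum \<open>s\<close> starting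
  at \<open>triangle s\<close>. With truncated subtraction the equation says that the code lies
  below \<open>triangle (Suc k)\<close>, so the least \<open>k\<close> is the diagonal; both
  components then follow by subtraction.\<close>

lemma pair_nat_row: "(LEAST k. Suc (pair_nat m n) - triangle (Suc k) = 0) = m + n"
proof (rule Least_equality)
  fix y assume "Suc (pair_nat m n) - triangle (Suc y) = 0"
  then have "triangle (m + n) < triangle (Suc y)" by (simp add: pair_nat_def prod_encode_def)
  then show "m + n \<le> y" using triangle_mono[of "Suc y" "m + n"] by linarith
qed (simp add: pair_nat_def prod_encode_def)

text \<open>\<open>Mu_fn\<close> searches over the first argument of a binary program, whereas the
  calculus of encoded types produces unary functions on codes; this bridges the two.\<close>

lemma rec_fun2I:
  assumes "rec_fun F" shows "rec_fun2 (\<lambda>x y. F (pair_nat x y))"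
proof -
  obtain r where r: "\<And>x. eval_recf r [x] = Some (F x)" using assms by (auto simp: rec_fun_def)
  obtain a where a: "\<And>x y. eval_recf a [x, y] = Some (x + y)"
    using rec_fun2_add by (auto simp: rec_fun2_def)
  obtain t where t: "\<And>x. eval_recf t [x] = Some (triangle x)"
    using rec_fun_triangle[OF rec_fun_id] by (auto simp: rec_fun_def)
  have "eval_recf (Comp_fn r [Comp_fn a [Comp_fn t [a], Proj_fn 0]]) [x, y] = Some (F (pair_nat x y))" for x y
    by (simp add: r a t pair_nat_def prod_encode_def)
  then show ?thesis unfolding rec_fun2_def by blast
qed

lemma rec_fun_row: "rec_fun (\<lambda>x. fst_nat x + snd_nat x)"
proof -
  obtain d where d: "\<And>x y. eval_recf d [y, x] = Some (x - y)"
    using rec_fun2_diff by (auto simp: rec_fun2_def)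
  obtain t where t: "\<And>x. eval_recf t [x] = Some (triangle (Suc x))"
    using rec_fun_triangle[OF rec_fun_Suc[OF rec_fun_id]] by (auto simp: rec_fun_def)
  have "eval_recf (Comp_fn d [Comp_fn t [Proj_fn 0], Comp_fn Succ_fn [Proj_fn 1]]) [k, x]
     = Some (Suc x - triangle (Suc k))" for k x
    by (simp add: d t del: triangle_Suc)
  then have "rec_fun2 (\<lambda>k x. Suc x - triangle (Suc k))" unfolding rec_fun2_def by blast
  moreover have pair_nat: "x = pair_nat (fst_nat x) (snd_nat x)" for x by (simp add: pair_nat_def fst_nat_def snd_nat_def)
  have "\<exists>k. Suc x - triangle (Suc k) = 0" for x
    by (subst pair_nat[of x], rule exI[of _ "fst_nat x + snd_nat x"]) (simp add: pair_nat_def prod_encode_def)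
  ultimately have "rec_fun (\<lambda>x. LEAST k. Suc x - triangle (Suc k) = 0)" by (rule rec_fun_Least)
  moreover have "(LEAST k. Suc x - triangle (Suc k) = 0) = fst_nat x + snd_nat x" for x
    using pair_nat_row[of "fst_nat x" "snd_nat x"] pair_nat[of x] by simp
  ultimately show ?thesis by simp
qed

lemma rec_fun_fst_nat: "rec_fun F \<Longrightarrow> rec_fun (\<lambda>x. fst_nat (F x))"
proof (erule rec_fun_comp[rotated])
  have "x - triangle (fst_nat x + snd_nat x) = fst_nat x" for x
  proof -
    have "x = pair_nat (fst_nat x) (snd_nat x)" by (simp add: pair_nat_def fst_nat_def snd_nat_def)
    also have "\<dots> = triangle (fst_nat x + snd_nat x) + fst_nat x" by (simp add: pair_nat_def prod_encode_def)
    finally show ?thesis by linarith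
  qed
  moreover have "rec_fun (\<lambda>x. x - triangle (fst_nat x + snd_nat x))"
    by (intro rec_fun_diff rec_fun_id rec_fun_triangle rec_fun_row)
  ultimately show "rec_fun fst_nat" by simp
qed

lemma rec_fun_snd_nat: "rec_fun F \<Longrightarrow> rec_fun (\<lambda>x. snd_nat (F x))"
proof (erule rec_fun_comp[rotated])
  have "rec_fun (\<lambda>x. (fst_nat x + snd_nat x) - fst_nat x)"
    by (intro rec_fun_diff rec_fun_row rec_fun_fst_nat rec_fun_id)
  then show "rec_fun snd_nat" by simp
qed

subsection \<open>Computable functions between encoded types\<close>

text \<open>Not every number is a canonical code: all nonzero numbers decode to \<open>True\<close>.
  Requiring the passage to the canonical code to be recursive is what makes the identity function
  computable.\<close>

class encodable =
  fixes encode :: "'a \<Rightarrow> nat" and decode :: "nat \<Rightarrow> 'a"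
  assumes decode_encode [simp]: "decode (encode x) = x"
    and rec_fun_normal: "rec_fun (\<lambda>n. encode (decode n))"

instantiation nat :: encodable
begin
definition "encode_nat (x::nat) = x"
definition "decode_nat (x::nat) = x"
instance by standard (simp_all add: encode_nat_def decode_nat_def rec_fun_id)
end

instantiation bool :: encodable
begin
definition "encode_bool (x::bool) = (of_bool x :: nat)"
definition "decode_bool (x::nat) = (x \<noteq> 0)"
instance
proof
  have "(\<lambda>n. encode (decode n :: bool)) = (\<lambda>n. 1 - (1 - n))"
    by (auto simp: encode_bool_def decode_bool_def)
  moreover have "rec_fun (\<lambda>n. 1 - (1 - n))"
    by (intro rec_fun_diff rec_fun_const rec_fun_id)
  ultimately show "rec_fun (\<lambda>n. encode (decode n :: bool))" by simp
qed (simp add: encode_bool_def decode_bool_def)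
end

instantiation prod :: (encodable, encodable) encodable
begin
definition "encode_prod x = pair_nat (encode (fst x)) (encode (snd x))"
definition "decode_prod n = (decode (fst_nat n), decode (snd_nat n))"
instance
  by standard (auto simp: encode_prod_def decode_prod_def
    intro!: rec_fun_pair_nat rec_fun_fst_nat rec_fun_snd_nat rec_fun_id rec_fun_comp[OF rec_fun_normal])
end

definition computable :: "('a::encodable \<Rightarrow> 'b::encodable) \<Rightarrow> bool" where
  "computable f \<longleftrightarrow> rec_fun (\<lambda>n. encode (f (decode n)))"

named_theorems comp_intro

lemma computable_id [comp_intro]: "computable (\<lambda>x. x)"
  by (simp add: computable_def rec_fun_normal)

lemma computable_const [comp_intro]: "computable (\<lambda>x. c)"
  by (simp add: computable_def rec_fun_const)

lemma computable_comp:
  assumes "computable f" "computable g" shows "computable (\<lambda>x. f (g x))"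
  using rec_fun_comp[OF assms[unfolded computable_def]] by (simp add: computable_def)

lemma computable_Pair [comp_intro]:
  "computable f \<Longrightarrow> computable g \<Longrightarrow> computable (\<lambda>x. (f x, g x))"
  by (simp add: computable_def encode_prod_def rec_fun_pair_nat)

lemma computable_fst [comp_intro]:
  fixes f :: "'c::encodable \<Rightarrow> 'a::encodable \<times> 'b::encodable"
  shows "computable f \<Longrightarrow> computable (\<lambda>x. fst (f x))"
proof (erule computable_comp[rotated])
  show "computable (fst :: 'a::encodable \<times> 'b::encodable \<Rightarrow> _)"
    by (auto simp add: computable_def decode_prod_def
      intro!: rec_fun_comp[OF rec_fun_normal] rec_fun_fst_nat rec_fun_id)
qed

lemma computable_snd [comp_intro]:
  fixes f :: "'c::encodable \<Rightarrow> 'a::encodable \<times> 'b::encodable"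
  shows "computable f \<Longrightarrow> computable (\<lambda>x. snd (f x))"
proof (erule computable_comp[rotated])
  show "computable (snd :: 'a::encodable \<times> 'b::encodable \<Rightarrow> _)"
    by (auto simp add: computable_def decode_prod_def
      intro!: rec_fun_comp[OF rec_fun_normal] rec_fun_snd_nat rec_fun_id)
qed

lemma computable2I:
  "computable (\<lambda>p. F (fst p) (snd p)) \<Longrightarrow> computable f \<Longrightarrow> computable g \<Longrightarrow> computable (\<lambda>x. F (f x) (g x))"
  using computable_comp[OF _ computable_Pair, of "\<lambda>p. F (fst p) (snd p)" f g] by simp

lemma computable_nat_arith [comp_intro]:
  fixes f g :: "'a::encodable \<Rightarrow> nat"
  assumes "computable f" "computable g"
  shows "computable (\<lambda>x. f x + g x)" "computable (\<lambda>x. f x - g x)"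
  using assms by (auto simp: computable_def encode_nat_def rec_fun_add rec_fun_diff)

lemma computable_Suc [comp_intro]:
  fixes f :: "'a::encodable \<Rightarrow> nat"
  assumes "computable f"
  shows "computable (\<lambda>x. Suc (f x))"
  using assms by (auto simp: computable_def encode_nat_def rec_fun_Suc)

lemma computable_encode [comp_intro]:
  "computable f \<Longrightarrow> computable (\<lambda>x. encode (f x))"
  by (simp add: computable_def encode_nat_def)

lemma computable_decode [comp_intro]:
  "computable f \<Longrightarrow> computable (\<lambda>x. decode (f x) :: 'b::encodable)"
proof (erule computable_comp[rotated])
  show "computable (decode :: nat \<Rightarrow> 'b::encodable)"
    by (simp add: computable_def decode_nat_def rec_fun_normal)
qed

lemma computable_funpow [comp_intro]:
  fixes F :: "'a::encodable \<Rightarrow> 'b::encodable \<Rightarrow> 'b"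
  assumes "computable (\<lambda>p. F (fst p) (snd p))" "computable n" "computable y"
  shows "computable (\<lambda>x. (F x ^^ n x) (y x))"
proof -
  \<comment> \<open>The parameter \<open>x\<close> travels in the state, since
    \<open>rec_fun_iter\<close> iterates one fixed function.\<close>
  let ?G = "\<lambda>p. (fst p, F (fst p) (snd p))"
  have G: "computable ?G" using assms by (intro comp_intro)
  let ?R = "\<lambda>k. encode (?G (decode k))"
  have R: "rec_fun ?R" using G by (simp add: computable_def)
  have *: "(?R ^^ k) (encode (x, z)) = encode (x, (F x ^^ k) z)" for k x z
    by (induction k) auto
  have "rec_fun (\<lambda>m. (?R ^^ (encode (n (decode m)))) (encode (decode m :: 'a, y (decode m))))"
    using assms computable_Pair[OF computable_id assms(3)] by (intro rec_fun_iter R) (auto simp: computable_def)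
  then have "computable (\<lambda>x. (x, (F x ^^ n x) (y x)))"
    unfolding computable_def by (simp add: * encode_nat_def[symmetric] del: funpow.simps) (simp add: * encode_nat_def)
  from computable_snd[OF this] show ?thesis by simp
qed

text \<open>A conditional is a constant function iterated once or not at all, with the code of the
  truth value as iteration count.\<close>

lemma computable_if [comp_intro]:
  assumes "computable b" "computable f" "computable g"
  shows "computable (\<lambda>x. if b x then f x else g x)"
proof -
  have "computable (\<lambda>x. ((\<lambda>_. f x) ^^ encode (b x)) (g x))"
    using assms by (intro comp_intro computable_comp[OF assms(2)])
  moreover have "((\<lambda>_. f x) ^^ encode (b x)) (g x) = (if b x then f x else g x)" for x
    by (simp add: encode_bool_def)
  ultimately show ?thesis by simp
qed

lemma computable_not [comp_intro]:
  assumes "computable P" shows "computable (\<lambda>x. \<not> P x)"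
proof -
  have eq: "(\<lambda>x. \<not> P x) = (\<lambda>x. if P x then False else True)" by auto
  show ?thesis unfolding eq by (intro computable_if computable_const assms)
qed

lemma computable_logic [comp_intro]:
  assumes "computable P" "computable Q"
  shows "computable (\<lambda>x. P x \<and> Q x)" "computable (\<lambda>x. P x \<or> Q x)"
   "computable (\<lambda>x. P x \<longrightarrow> Q x)"
proof -
  have eq: "(\<lambda>x. P x \<and> Q x) = (\<lambda>x. if P x then Q x else False)"
    "(\<lambda>x. P x \<or> Q x) = (\<lambda>x. if P x then True else Q x)"
    "(\<lambda>x. P x \<longrightarrow> Q x) = (\<lambda>x. if P x then Q x else True)" by auto
  show "computable (\<lambda>x. P x \<and> Q x)" "computable (\<lambda>x. P x \<or> Q x)"
   "computable (\<lambda>x. P x \<longrightarrow> Q x)"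
    unfolding eq by (intro computable_if computable_const assms)+
qed

lemma computable_nat_order [comp_intro]:
  fixes f g :: "'a::encodable \<Rightarrow> nat"
  assumes "computable f" "computable g"
  shows "computable (\<lambda>x. f x \<le> g x)" "computable (\<lambda>x. f x < g x)"
proof -
  have *: "computable (\<lambda>x. h x = 0)" if "computable h" for h :: "'a \<Rightarrow> nat"
  proof -
    have "(\<lambda>x. h x = 0) = (\<lambda>x. \<not> decode (h x))" by (simp add: decode_bool_def)
    then show ?thesis using that by (auto intro!: comp_intro)
  qed
  have "(\<lambda>x. f x \<le> g x) = (\<lambda>x. f x - g x = 0)" "(\<lambda>x. f x < g x) = (\<lambda>x. Suc (f x) - g x = 0)"
    by auto
  then show "computable (\<lambda>x. f x \<le> g x)" "computable (\<lambda>x. f x < g x)"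
    by (simp_all only:) (intro * comp_intro assms)+
qed

lemma computable_eq [comp_intro]:
  assumes "computable f" "computable g"
  shows "computable (\<lambda>x. f x = g x)"
proof -
  have "(\<lambda>x. f x = g x) = (\<lambda>x. encode (f x) \<le> encode (g x) \<and> encode (g x) \<le> encode (f x))"
    by (metis antisym decode_encode order_refl)
  then show ?thesis using assms by (auto intro!: comp_intro)
qed

lemma computable_all_less [comp_intro]:
  fixes P :: "'a::encodable \<Rightarrow> nat \<Rightarrow> bool"
  assumes "computable (\<lambda>p. P (fst p) (snd p))" "computable b"
  shows "computable (\<lambda>x. \<forall>i < b x. P x i)"
proof -
  let ?F = "\<lambda>x s. (Suc (fst s), snd s \<and> P x (fst s))"
  have "(?F x ^^ n) (0, True) = (n, \<forall>i<n. P x i)" for x n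
    by (induction n) (auto simp: less_Suc_eq)
  moreover have "computable (\<lambda>x. snd ((?F x ^^ b x) (0, True)))"
    using assms by (intro comp_intro computable2I[OF assms(1)])
  ultimately show ?thesis by simp
qed

lemma computable_ex_less [comp_intro]:
  fixes P :: "'a::encodable \<Rightarrow> nat \<Rightarrow> bool"
  assumes "computable (\<lambda>p. P (fst p) (snd p))" "computable b"
  shows "computable (\<lambda>x. \<exists>i < b x. P x i)"
proof -
  have "(\<lambda>x. \<exists>i < b x. P x i) = (\<lambda>x. \<not> (\<forall>i < b x. \<not> P x i))" by auto
  then show ?thesis by (simp only:) (intro comp_intro assms)
qed

subsection \<open>Lists\<close>

lemma list_code_induct:
  "P 0 \<Longrightarrow> (\<And>x l. P l \<Longrightarrow> P (Suc (pair_nat x l))) \<Longrightarrow> P n"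
proof (induction n rule: less_induct)
  case (less n)
  show ?case
  proof (cases n)
    case (Suc m)
    have m: "pair_nat (fst_nat m) (snd_nat m) = m" by (simp add: pair_nat_def fst_nat_def snd_nat_def)
    have "snd_nat m \<le> m" using le_prod_encode_2[of "snd_nat m" "fst_nat m"] m by (simp add: pair_nat_def)
    then have "P (snd_nat m)" using less.IH less.prems Suc by simp
    then show ?thesis using less.prems(2)[of "snd_nat m" "fst_nat m"] m Suc by simp
  qed (use less in auto)
qed

text \<open>The state is a pair of an accumulator and the code of the remaining list.\<close>

definition fold_step :: "(nat \<Rightarrow> nat) \<Rightarrow> nat \<Rightarrow> nat" where
  "fold_step F s = (if snd_nat s = 0 then s else pair_nat (F (pair_nat (fst_nat s) (fst_nat (snd_nat s - 1)))) (snd_nat (snd_nat s - 1)))"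

lemma rec_fun_if0:
  assumes "rec_fun B" "rec_fun F" "rec_fun G"
  shows "rec_fun (\<lambda>x. if B x = 0 then F x else G x)"
proof -
  have "computable (\<lambda>x::nat. if B x \<le> 0 then F x else G x)"
    using assms by (intro comp_intro) (simp_all add: computable_def encode_nat_def decode_nat_def)
  then show ?thesis by (simp add: computable_def encode_nat_def decode_nat_def cong: if_cong)
qed

lemma list_encode_Cons: "Suc (pair_nat x (list_encode xs)) = list_encode (x # xs)"
  by (simp add: pair_nat_def)

lemma rec_fun_fold_step:
  assumes "rec_fun F" shows "rec_fun (fold_step F)"
  unfolding fold_step_def
  by (intro rec_fun_if0 rec_fun_pair_nat rec_fun_fst_nat rec_fun_snd_nat rec_fun_pred rec_fun_id rec_fun_comp[OF assms])

text \<open>The code of a list is at least its length, and a state with nothing left to read is a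
  fixed point; so the code itself can serve as iteration count.\<close>

lemma fold_step_iter:
  assumes "l \<le> n"
  shows "(fold_step F ^^ n) (pair_nat a l) = pair_nat (foldl (\<lambda>a b. F (pair_nat a b)) a (list_decode l)) 0"
  using assms
proof (induction l arbitrary: a n rule: list_code_induct)
  case 1
  have "fold_step F (pair_nat a 0) = pair_nat a 0" by (simp add: fold_step_def)
  then show ?case by (induction n) auto
next
  case (2 x l)
  obtain m where m: "n = Suc m" using 2 by (cases n) auto
  have "l \<le> m" using 2 m le_prod_encode_2[of l x] by (simp add: pair_nat_def)
  have "fold_step F (pair_nat a (Suc (pair_nat x l))) = pair_nat (F (pair_nat a x)) l" by (simp add: fold_step_def)
  then have "(fold_step F ^^ n) (pair_nat a (Suc (pair_nat x l))) = (fold_step F ^^ m) (pair_nat (F (pair_nat a x)) l)"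
    by (simp only: m funpow_Suc_right o_apply)
  then show ?case using 2(1)[OF \<open>l \<le> m\<close>] by (simp add: pair_nat_def)
qed

instantiation list :: (encodable) encodable
begin
definition "encode_list xs = list_encode (map encode xs)"
definition "decode_list n = map decode (list_decode n)"
instance
proof
  show "decode (encode xs) = xs" for xs :: "'a list"
    by (simp add: encode_list_def decode_list_def comp_def)
  \<comment> \<open>A left fold reverses the list: \<open>?G\<close> normalises the entries, and a
    second fold with \<open>?H\<close> restores the order.\<close>
  let ?G = "\<lambda>p. Suc (pair_nat (encode (decode (snd_nat p) :: 'a)) (fst_nat p))" and ?H = "\<lambda>p. Suc (pair_nat (snd_nat p) (fst_nat p))"
  have f: "foldl (\<lambda>a b. ?G (pair_nat a b)) (list_encode a) l = list_encode (rev (map (\<lambda>b. encode (decode b :: 'a)) l) @ a)"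
   "foldl (\<lambda>a b. ?H (pair_nat a b)) (list_encode a) l = list_encode (rev l @ a)"
    for l a by (induction l arbitrary: a) (simp_all add: list_encode_Cons del: list_encode.simps(2))
  have g: "rec_fun ?G" "rec_fun ?H"
    by (intro rec_fun_Suc rec_fun_pair_nat rec_fun_comp[OF rec_fun_normal] rec_fun_fst_nat rec_fun_snd_nat rec_fun_id)+
  define A where "A n = fst_nat ((fold_step ?G ^^ n) (pair_nat 0 n))" for n
  define B where "B n = fst_nat ((fold_step ?H ^^ n) (pair_nat 0 n))" for n
  have "rec_fun A" "rec_fun B" unfolding A_def B_def
    by (intro rec_fun_fst_nat rec_fun_iter rec_fun_fold_step g rec_fun_id rec_fun_pair_nat rec_fun_const)+
  then have "rec_fun (\<lambda>n. B (A n))" by (rule rec_fun_comp[rotated])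
  moreover have "B (A n) = encode (decode n :: 'a list)" for n
    using f(1)[of "[]" "list_decode n"] f(2)[of "[]" "list_decode (A n)"]
    by (simp add: A_def B_def fold_step_iter encode_list_def decode_list_def comp_def rev_map)
  ultimately show "rec_fun (\<lambda>n. encode (decode n :: 'a list))" by simp
qed
end

lemma computable_foldl [comp_intro]:
  fixes F :: "'c::encodable \<Rightarrow> 'a::encodable \<Rightarrow> 'b::encodable \<Rightarrow> 'a"
  assumes "computable (\<lambda>p. F (fst p) (fst (snd p)) (snd (snd p)))" "computable a" "computable l"
  shows "computable (\<lambda>x. foldl (F x) (a x) (l x))"
proof -
  let ?R = "\<lambda>n. let p = decode n :: ('c \<times> 'a) \<times> 'b in encode (fst (fst p), F (fst (fst p)) (snd (fst p)) (snd p))"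
  have "computable (\<lambda>p :: ('c \<times> 'a) \<times> 'b. (fst (fst p), F (fst (fst p)) (snd (fst p)) (snd p)))"
    by (intro comp_intro computable_comp[OF assms(1), of "\<lambda>p. (fst (fst p), snd (fst p), snd p)", simplified])
  then have R: "rec_fun ?R" by (simp add: computable_def Let_def)
  have *: "foldl (\<lambda>a b. ?R (pair_nat a b)) (encode (x, z)) (map encode l) = encode (x, foldl (F x) z l)" for x z l
    by (induction l arbitrary: z) (simp_all add: encode_prod_def decode_prod_def Let_def)
  have "rec_fun (\<lambda>m. fst_nat ((fold_step ?R ^^ (encode (l (decode m)))) (pair_nat (encode (decode m :: 'c, a (decode m))) (encode (l (decode m))))))"
    using assms computable_Pair[OF computable_id assms(2)]
    by (intro rec_fun_fst_nat rec_fun_iter rec_fun_fold_step R rec_fun_pair_nat) (auto simp: computable_def)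
  moreover have "fst_nat ((fold_step ?R ^^ (encode (l x))) (pair_nat (encode (x, a x)) (encode (l x)))) = encode (x, foldl (F x) (a x) (l x))" for x
    by (subst fold_step_iter[OF order_refl]) (simp add: encode_list_def * del: Let_def)
  ultimately have "computable (\<lambda>x. (x, foldl (F x) (a x) (l x)))"
    unfolding computable_def by simp
  from computable_snd[OF this] show ?thesis by simp
qed

lemma computable_Cons [comp_intro]:
  fixes f :: "'c::encodable \<Rightarrow> 'a::encodable"
  assumes "computable f" "computable l"
  shows "computable (\<lambda>x. f x # l x)"
proof -
  have "rec_fun (\<lambda>m. Suc (pair_nat (encode (f (decode m))) (encode (l (decode m)))))"
    using assms by (intro rec_fun_Suc rec_fun_pair_nat) (auto simp: computable_def)
  then show ?thesis by (simp add: computable_def encode_list_def pair_nat_def)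
qed

lemma computable_rev [comp_intro]:
  fixes l :: "'c::encodable \<Rightarrow> 'a::encodable list"
  assumes "computable l" shows "computable (\<lambda>x. rev (l x))"
proof -
  have "foldl (\<lambda>a b. b # a) a l = rev l @ a" for a l :: "'a list" by (induction l arbitrary: a) auto
  moreover have "computable (\<lambda>x. foldl (\<lambda>a b. b # a) [] (l x))" using assms by (intro comp_intro)
  ultimately show ?thesis by simp
qed

lemma computable_append [comp_intro]:
  fixes l k :: "'c::encodable \<Rightarrow> 'a::encodable list"
  assumes "computable l" "computable k" shows "computable (\<lambda>x. l x @ k x)"
proof -
  have "foldl (\<lambda>a b. b # a) a l = rev l @ a" for a l :: "'a list" by (induction l arbitrary: a) auto
  moreover have "computable (\<lambda>x. foldl (\<lambda>a b. b # a) (k x) (rev (l x)))" using assms by (intro comp_intro)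
  ultimately show ?thesis by simp
qed

lemma computable_map [comp_intro]:
  assumes "computable (\<lambda>p. F (fst p) (snd p))" "computable l" shows "computable (\<lambda>x. map (F x) (l x))"
proof -
  have "foldl (\<lambda>a b. F x b # a) a l = rev (map (F x) l) @ a" for a l x by (induction l arbitrary: a) auto
  moreover have "computable (\<lambda>x. rev (foldl (\<lambda>a b. F x b # a) [] (l x)))"
    using assms by (intro comp_intro computable2I[OF assms(1)])
  ultimately show ?thesis by simp
qed

lemma computable_concat [comp_intro]:
  fixes l :: "'c::encodable \<Rightarrow> 'a::encodable list list"
  assumes "computable l" shows "computable (\<lambda>x. concat (l x))"
proof -
  have "foldl (@) a l = a @ concat l" for a and l :: "'a list list" by (induction l arbitrary: a) auto
  moreover have "computable (\<lambda>x. foldl (@) [] (l x))" using assms by (intro comp_intro)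
  ultimately show ?thesis by simp
qed

lemma computable_sum_list [comp_intro]:
  fixes l :: "'a::encodable \<Rightarrow> nat list"
  assumes "computable l" shows "computable (\<lambda>x. sum_list (l x))"
proof -
  have "foldl (+) a l = a + sum_list l" for a and l :: "nat list" by (induction l arbitrary: a) auto
  moreover have "computable (\<lambda>x. foldl (+) 0 (l x))" using assms by (intro comp_intro)
  ultimately show ?thesis by simp
qed

lemma computable_ball [comp_intro]:
  assumes "computable (\<lambda>p. P (fst p) (snd p))" "computable l"
  shows "computable (\<lambda>x. \<forall>y \<in> set (l x). P x y)"
proof -
  have "foldl (\<lambda>a b. a \<and> P x b) a l = (a \<and> (\<forall>y \<in> set l. P x y))" for a l x by (induction l arbitrary: a) auto
  moreover have "computable (\<lambda>x. foldl (\<lambda>a b. a \<and> P x b) True (l x))"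
    using assms by (intro comp_intro computable2I[OF assms(1)])
  ultimately show ?thesis by simp
qed

lemma computable_bex [comp_intro]:
  assumes "computable (\<lambda>p. P (fst p) (snd p))" "computable l"
  shows "computable (\<lambda>x. \<exists>y \<in> set (l x). P x y)"
proof -
  have "(\<lambda>x. \<exists>y \<in> set (l x). P x y) = (\<lambda>x. \<not> (\<forall>y \<in> set (l x). \<not> P x y))" by auto
  then show ?thesis by (simp only:) (intro comp_intro assms)
qed

lemma computable_member [comp_intro]:
  assumes "computable f" "computable l"
  shows "computable (\<lambda>x. f x \<in> set (l x))"
proof -
  have "computable (\<lambda>x. \<exists>y \<in> set (l x). y = f x)"
    using assms by (intro comp_intro computable_comp[OF assms(1)])
  then show ?thesis by simp
qed

lemma computable_subset [comp_intro]:
  assumes "computable k" "computable l"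
  shows "computable (\<lambda>x. set (k x) \<subseteq> set (l x))"
proof -
  have "computable (\<lambda>x. \<forall>y \<in> set (k x). y \<in> set (l x))"
    using assms by (intro comp_intro computable_comp[OF assms(2)])
  then show ?thesis by (simp add: subset_eq)
qed

subsection \<open>Semidecidable predicates\<close>

definition semidecidable :: "('a::encodable \<Rightarrow> bool) \<Rightarrow> bool" where
  "semidecidable P \<longleftrightarrow> (\<exists>Q. computable (\<lambda>p. Q (fst p) (snd p)) \<and> (\<forall>x. P x \<longleftrightarrow> (\<exists>z::nat. Q x z)))"

lemma semidecidableI:
  assumes "computable (\<lambda>p. Q (fst p) (snd p))" "\<And>x. P x \<longleftrightarrow> (\<exists>z::'b::encodable. Q x z)"
  shows "semidecidable P"
proof -
  have "computable (\<lambda>p. Q (fst p) (decode (snd p)))"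
    by (intro comp_intro computable2I[OF assms(1)])
  moreover have "P x \<longleftrightarrow> (\<exists>z. Q x (decode z))" for x using assms(2) by (metis decode_encode)
  ultimately show ?thesis unfolding semidecidable_def by (intro exI[of _ "\<lambda>x z. Q x (decode z)"]) simp
qed

text \<open>One search bound serves all the \<open>i\<close> below \<open>b x\<close>.\<close>

lemma semidecidable_all_less:
  fixes b :: "'a::encodable \<Rightarrow> nat"
  assumes P: "semidecidable (\<lambda>p. P (fst p) (snd p))" and b: "computable b"
    and C: "computable (\<lambda>p. C (fst p) (snd p))"
  shows "semidecidable (\<lambda>x. \<forall>i < b x. C x i \<longrightarrow> P x i)"
proof -
  obtain Q where Q: "computable (\<lambda>p. Q (fst p) (snd p))" "\<And>x i. P x i \<longleftrightarrow> (\<exists>z::nat. Q (x, i) z)"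
    using P unfolding semidecidable_def by auto
  show ?thesis
  proof (rule semidecidableI)
    show "computable (\<lambda>p. \<forall>i < b (fst p). C (fst p) i \<longrightarrow> (\<exists>z < snd p. Q (fst p, i) z))"
      by (intro comp_intro computable2I[OF Q(1)] computable2I[OF C] computable_comp[OF b])
    fix x
    show "(\<forall>i < b x. C x i \<longrightarrow> P x i) \<longleftrightarrow> (\<exists>Z. \<forall>i < b x. C x i \<longrightarrow> (\<exists>z < Z. Q (x, i) z))"
    proof
      assume *: "\<forall>i < b x. C x i \<longrightarrow> P x i"
      define z where "z i = (SOME z. Q (x, i) z)" for i
      have z: "Q (x, i) (z i)" if "i < b x" "C x i" for i
        unfolding z_def using * that Q(2) by (meson someI_ex)
      have "z i < Suc (\<Sum>i<b x. z i)" if "i < b x" for i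
        using that by (simp add: less_Suc_eq_le member_le_sum)
      then show "\<exists>Z. \<forall>i < b x. C x i \<longrightarrow> (\<exists>z < Z. Q (x, i) z)" using z by blast
    qed (use Q(2) in blast)
  qed
qed

text \<open>Search for the least number that witnesses \<open>A\<close> or \<open>B\<close>, then
  test which of the two it witnesses. On \<open>D\<close> exactly one of them holds, so the search
  ends and the test gives the answer.\<close>

lemma decidable_onI:
  assumes "semidecidable A" "semidecidable B"
    and "\<And>i. i \<in> D \<Longrightarrow> P i \<Longrightarrow> A (f i) \<and> \<not> B (f i)"
    and "\<And>i. i \<in> D \<Longrightarrow> \<not> P i \<Longrightarrow> B (f i) \<and> \<not> A (f i)"
  shows "decidable_on (\<lambda>i. encode (f i)) D P"
proof -
  obtain Q R where Q: "computable (\<lambda>p. Q (fst p) (snd p))" "\<And>x. A x \<longleftrightarrow> (\<exists>z::nat. Q x z)"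
    and R: "computable (\<lambda>p. R (fst p) (snd p))" "\<And>x. B x \<longleftrightarrow> (\<exists>z::nat. R x z)"
    using assms(1,2) unfolding semidecidable_def by auto
  \<comment> \<open>The test is negated because \<open>Mu_fn\<close> stops at the value 0, the code
    of \<open>False\<close>.\<close>
  have "computable (\<lambda>p. encode (\<not> (Q (decode (snd p)) (fst p) \<or> R (decode (snd p)) (fst p))))"
    by (intro comp_intro computable2I[OF Q(1)] computable2I[OF R(1)])
  then have "rec_fun (\<lambda>n. let p = decode n in encode (\<not> (Q (decode (snd p)) (fst p) \<or> R (decode (snd p)) (fst p))))"
    by (simp add: computable_def encode_nat_def Let_def)
  from rec_fun2I[OF this]
  obtain r where r: "\<And>z x. eval_recf r [z, x] = Some (encode (\<not> (Q (decode x) z \<or> R (decode x) z)))"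
    by (auto simp: rec_fun2_def decode_prod_def Let_def decode_nat_def)
  have "computable (\<lambda>p. encode (Q (decode (snd p)) (fst p)))"
    by (intro comp_intro computable2I[OF Q(1)])
  then have "rec_fun (\<lambda>n. let p = decode n in encode (Q (decode (snd p)) (fst p)))"
    by (simp add: computable_def encode_nat_def Let_def)
  from rec_fun2I[OF this]
  obtain s where s: "\<And>z x. eval_recf s [z, x] = Some (encode (Q (decode x) z))"
    by (auto simp: rec_fun2_def decode_prod_def Let_def decode_nat_def)
  have "eval_recf (Comp_fn s [Mu_fn r, Proj_fn 0]) [encode (f i)] = Some (if P i then 1 else 0)"
    if i: "i \<in> D" for i
  proof -
    have ex: "\<exists>z. Q (f i) z \<or> R (f i) z" using assms(3,4)[OF i] Q(2) R(2) by blast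
    define z where "z = (LEAST z. Q (f i) z \<or> R (f i) z)"
    have z: "Q (f i) z \<or> R (f i) z" unfolding z_def using ex by (rule LeastI_ex)
    have "eval_recf (Mu_fn r) [encode (f i)] = Some z"
      using ex by (simp add: r encode_bool_def z_def)
    moreover have "Q (f i) z \<longleftrightarrow> P i" using z assms(3,4)[OF i] Q(2) R(2) by blast
    ultimately show ?thesis by (simp add: s encode_bool_def)
  qed
  then show ?thesis unfolding decidable_on_def by blast
qed

section \<open>Stiemke's lemma for integer lattices\<close>

definition int_lattice :: "(nat \<Rightarrow> int) set \<Rightarrow> bool" where
  "int_lattice L \<longleftrightarrow> (\<lambda>_. 0) \<in> L \<and> (\<forall>v\<in>L. \<forall>w\<in>L. (\<lambda>i. v i - w i) \<in> L)"

lemma int_lattice_diff: "int_lattice L \<Longrightarrow> v \<in> L \<Longrightarrow> w \<in> L \<Longrightarrow> (\<lambda>i. v i - w i) \<in> L"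
  by (simp add: int_lattice_def)

lemma int_lattice_neg: "int_lattice L \<Longrightarrow> v \<in> L \<Longrightarrow> (\<lambda>i. - v i) \<in> L"
  using int_lattice_diff[of L "\<lambda>_. 0" v] by (simp add: int_lattice_def)

lemma int_lattice_add: "int_lattice L \<Longrightarrow> v \<in> L \<Longrightarrow> w \<in> L \<Longrightarrow> (\<lambda>i. v i + w i) \<in> L"
  using int_lattice_diff[OF _ _ int_lattice_neg, of L v w] by simp

lemma int_lattice_mult:
  assumes L: "int_lattice L" and v: "v \<in> L" shows "(\<lambda>i. c * v i) \<in> L"
proof -
  have *: "(\<lambda>i. int n * v i) \<in> L" for n
  proof (induction n)
    case 0 show ?case using L by (simp add: int_lattice_def)
  next
    case (Suc n)
    from int_lattice_add[OF L v this] show ?case by (simp add: algebra_simps)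
  qed
  show ?thesis
  proof (cases c)
    case (nonneg n) then show ?thesis using * by simp
  next
    case (neg n)
    then show ?thesis using int_lattice_neg[OF L *[of "Suc n"]] by (simp only: minus_mult_left)
  qed
qed

definition int_dot :: "nat \<Rightarrow> (nat \<Rightarrow> int) \<Rightarrow> (nat \<Rightarrow> int) \<Rightarrow> int" where
  "int_dot m y x = (\<Sum>i<m. y i * x i)"

lemma int_dot_Suc [simp]: "int_dot (Suc m) y x = int_dot m y x + y m * x m"
  by (simp add: int_dot_def)

lemma int_dot_diff: "int_dot m y (\<lambda>i. v i - w i) = int_dot m y v - int_dot m y w"
  by (simp add: int_dot_def algebra_simps sum_subtractf)

lemma int_dot_add: "int_dot m y (\<lambda>i. v i + w i) = int_dot m y v + int_dot m y w"
  by (simp add: int_dot_def algebra_simps sum.distrib)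

lemma int_dot_mult: "int_dot m y (\<lambda>i. c * v i) = c * int_dot m y v"
  by (simp add: int_dot_def sum_distrib_left algebra_simps)

lemma int_dot_mult_left: "int_dot m (\<lambda>i. c * y i) v = c * int_dot m y v"
  by (simp add: int_dot_def sum_distrib_left algebra_simps)

lemma int_dot_cong: "(\<And>i. i < m \<Longrightarrow> y i = y' i) \<Longrightarrow> int_dot m y v = int_dot m y' v"
  by (simp add: int_dot_def)

lemma int_lattice_slice: "int_lattice L \<Longrightarrow> int_lattice {x\<in>L. x m = 0}"
  by (auto simp: int_lattice_def)

text \<open>On \<open>L\<close> the value \<open>int_dot m y x\<close> is proportional to
  \<open>x m\<close>: for any \<open>x1\<close> in \<open>L\<close> with \<open>x1 m > 0\<close>,
  the combination \<open>x1 m * x - x m * x1\<close> lies in the slice where \<open>y\<close>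
  vanishes. The factor \<open>q\<close> clears the denominator.\<close>

lemma functional_extend:
  assumes L: "int_lattice L" and y: "\<And>x. x \<in> L \<Longrightarrow> x m = 0 \<Longrightarrow> int_dot m y x = 0"
  obtains q p where "q > 0" "\<And>x. x \<in> L \<Longrightarrow> q * int_dot m y x + p * x m = 0"
proof (cases "\<forall>x\<in>L. x m = 0")
  case True
  then show ?thesis using that[of 1 0] y by simp
next
  case False
  then obtain x0 where x0: "x0 \<in> L" "x0 m \<noteq> 0" by blast
  obtain x1 where x1: "x1 \<in> L" "x1 m > 0"
  proof (cases "x0 m > 0")
    case False
    then show ?thesis using that[OF int_lattice_neg[OF L x0(1)]] x0 by simp
  qed (use that x0 in blast)
  show ?thesis
  proof (rule that[OF x1(2), of "- int_dot m y x1"])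
    fix x assume x: "x \<in> L"
    have "(\<lambda>i. x1 m * x i - x m * x1 i) \<in> L"
      by (intro int_lattice_diff int_lattice_mult L x x1)
    from y[OF this] show "x1 m * int_dot m y x + - int_dot m y x1 * x m = 0"
      by (simp add: int_dot_diff int_dot_mult)
  qed
qed

text \<open>Induction on \<open>m\<close>, with the hypothesis applied both to \<open>L\<close> and
  to its slice \<open>x m = 0\<close>. A functional on the slice extends to \<open>L\<close> by
  \<open>functional_extend\<close>, and only the sign of its last coefficient is in question; a
  vector that is positive on the first \<open>m\<close> coordinates but not on the last decides
  it.\<close>

theorem stiemke_int:
  assumes "int_lattice L"
  shows "(\<exists>x\<in>L. \<forall>i<m. x i > 0) \<or>
    (\<exists>y. (\<forall>i<m. y i \<ge> 0) \<and> (\<exists>i<m. y i > 0) \<and> (\<forall>x\<in>L. int_dot m y x = 0))"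
  using assms
proof (induction m arbitrary: L)
  case 0
  then show ?case by (auto simp: int_lattice_def)
next
  case (Suc m)
  note L = Suc.prems
  let ?L0 = "{x\<in>L. x m = 0}"
  show ?case
  proof (cases "\<exists>y. (\<forall>i<m. y i \<ge> 0) \<and> (\<exists>i<m. y i > 0) \<and> (\<forall>x\<in>L. int_dot m y x = 0)")
    case True
    then obtain y where y: "\<forall>i<m. y i \<ge> 0" "\<exists>i<m. y i > 0" "\<forall>x\<in>L. int_dot m y x = 0" by blast
    have "int_dot (Suc m) (y(m := 0)) x = 0" if "x \<in> L" for x
      using y(3) that int_dot_cong[of m "y(m := 0)" y x] by simp
    moreover have "\<forall>i<Suc m. (y(m := 0)) i \<ge> 0" using y(1) by auto
    moreover have "\<exists>i<Suc m. (y(m := 0)) i > 0" using y(2) by (metis fun_upd_other less_SucI nat_neq_iff)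
    ultimately show ?thesis by blast
  next
    case False
    with Suc.IH[OF L] obtain x where x: "x \<in> L" "\<forall>i<m. x i > 0" by blast
    show ?thesis
    proof (cases "x m > 0")
      case True
      then show ?thesis using x by (auto simp: less_Suc_eq)
    next
      case xm: False
      consider (pos) x0 where "x0 \<in> ?L0" "\<forall>i<m. x0 i > 0" |
        (y) y where "\<forall>i<m. y i \<ge> 0" "\<exists>i<m. y i > 0" "\<forall>x\<in>?L0. int_dot m y x = 0"
        using Suc.IH[OF int_lattice_slice[OF L, of m]] by blast
      then show ?thesis
      proof cases
        case pos
        show ?thesis
        proof (cases "\<forall>x\<in>L. x m = 0")
          case True
          \<comment> \<open>Every vector of \<open>L\<close> ends in 0, so the last coordinate is
            the required functional.\<close>
          have "int_dot (Suc m) (\<lambda>i. if i = m then 1 else 0) z = 0" if "z \<in> L" for z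
            using True that int_dot_cong[of m "\<lambda>i. if i = m then 1 else 0" "\<lambda>i. 0 * 0" z]
            by (simp only: int_dot_mult_left) simp
          then show ?thesis
            by (intro disjI2 exI[of _ "\<lambda>i. if i = m then 1 else 0"]) auto
        next
          case False
          then obtain z0 where z0: "z0 \<in> L" "z0 m \<noteq> 0" by blast
          obtain z where z: "z \<in> L" "z m > 0"
          proof (cases "z0 m > 0")
            case False
            then show ?thesis using that[OF int_lattice_neg[OF L z0(1)]] z0 by simp
          qed (use that z0 in blast)
          \<comment> \<open>The entries of \<open>x0\<close> below \<open>m\<close> are at least 1
            and its last entry is 0, so \<open>N\<close> copies of it outweigh every negative entry
            of \<open>z\<close> and leave \<open>z m\<close> as it is.\<close>
          define N where "N = 1 + (\<Sum>i<m. \<bar>z i\<bar>)"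
          have N: "N * x0 i + z i > 0" if "i < m" for i
          proof -
            have "\<bar>z i\<bar> \<le> (\<Sum>i<m. \<bar>z i\<bar>)" using that by (intro member_le_sum) auto
            moreover have "N * 1 \<le> N * x0 i"
              using pos(2) that by (intro mult_left_mono) (auto simp: N_def add_nonneg_nonneg sum_nonneg)
            ultimately show ?thesis by (simp add: N_def)
          qed
          have "(\<lambda>i. N * x0 i + z i) \<in> L" using pos(1) z(1)
            by (intro int_lattice_add int_lattice_mult L) auto
          then show ?thesis using N z(2) pos(1) by (intro disjI1 bexI) (auto simp: less_Suc_eq)
        qed
      next
        case y
        obtain q p where qp: "q > 0" "\<And>x. x \<in> L \<Longrightarrow> q * int_dot m y x + p * x m = 0"
          using functional_extend[OF L, of m y] y(3) by blast
        obtain i where i: "i < m" "y i > 0" using y(2) by blast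
        \<comment> \<open>The extended functional vanishes at \<open>x\<close>; its first part is
          positive there while \<open>x m\<close> is not, which forces \<open>p\<close> to be
          positive.\<close>
        have "int_dot m y x > 0" unfolding int_dot_def
          using y(1) x(2) i by (intro sum_pos2[of _ i]) (auto simp: less_imp_le)
        with qp have "p * x m < 0" using qp(2)[OF x(1)] by (smt (verit) mult_pos_pos)
        then have p: "p > 0" using xm by (simp add: mult_less_0_iff)
        let ?y = "\<lambda>i. if i < m then q * y i else p"
        have "int_dot (Suc m) ?y z = 0" if "z \<in> L" for z
          using qp(2)[OF that] int_dot_cong[of m ?y "\<lambda>i. q * y i" z] by (simp add: int_dot_mult_left)
        then show ?thesis using p qp(1) y(1)
          by (intro disjI2 exI[of _ ?y]) (auto simp: less_Suc_eq)
      qed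
    qed
  qed
qed

text \<open>The last \<open>l\<close> coordinates carry no sign condition: they are added one at a
  time by \<open>functional_extend\<close>, with coefficients of arbitrary sign. They will hold the
  generators of the group, which serve only to express its elements.\<close>

corollary stiemke_int_free:
  assumes "int_lattice L"
  shows "(\<exists>x\<in>L. (\<forall>i<m. x i > 0) \<and> (\<forall>i. m \<le> i \<and> i < m + l \<longrightarrow> x i = 0)) \<or>
    (\<exists>y. (\<forall>i<m. y i \<ge> 0) \<and> (\<exists>i<m. y i > 0) \<and> (\<forall>x\<in>L. int_dot (m + l) y x = 0))"
  using assms
proof (induction l arbitrary: L)
  case 0
  show ?case using stiemke_int[OF 0, of m] unfolding add_0_right by (meson leD)
next
  case (Suc l)
  note L = Suc.prems
  let ?L0 = "{x\<in>L. x (m + l) = 0}"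
  from Suc.IH[OF int_lattice_slice[OF L, of "m + l"]] show ?case
  proof (elim disjE bexE exE conjE)
    fix x assume x: "x \<in> ?L0" "\<forall>i<m. x i > 0" "\<forall>i. m \<le> i \<and> i < m + l \<longrightarrow> x i = 0"
    have "x i = 0" if "m \<le> i \<and> i < m + Suc l" for i
      using that x(1,3) by (cases "i = m + l") auto
    moreover have "x \<in> L" using x(1) by simp
    ultimately show ?thesis using x(2) by (intro disjI1 bexI[of _ x] conjI allI impI) simp_all
  next
    fix y i0 assume y: "\<forall>i<m. y i \<ge> 0" "i0 < m" "y i0 > 0" "\<forall>x\<in>?L0. int_dot (m + l) y x = 0"
    obtain q p where qp: "q > 0" "\<And>x. x \<in> L \<Longrightarrow> q * int_dot (m + l) y x + p * x (m + l) = 0"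
      using functional_extend[OF L, of "m + l" y] y(4) by auto
    define y' where "y' i = (if i < m + l then q * y i else p)" for i
    have "int_dot (m + l) y' z = int_dot (m + l) (\<lambda>i. q * y i) z" for z
      by (rule int_dot_cong) (simp add: y'_def)
    then have "int_dot (Suc (m + l)) y' z = 0" if "z \<in> L" for z
      using qp(2)[OF that] by (simp add: int_dot_mult_left) (simp add: y'_def)
    moreover have "\<forall>i<m. y' i \<ge> 0" "y' i0 > 0" using qp(1) y(1-3) by (simp_all add: y'_def)
    ultimately show ?thesis using \<open>i0 < m\<close> unfolding add_Suc_right
      by (intro disjI2 exI[of _ y'] conjI exI[of _ i0] ballI) simp_all
  qed
qed

section \<open>Nilpotent groups\<close>

subsection \<open>The lower central series\<close>

declare lower_central.simps(2) [simp del]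

context group
begin

abbreviation commutator :: "'a \<Rightarrow> 'a \<Rightarrow> 'a" where
  "commutator g h \<equiv> g \<otimes> h \<otimes> inv g \<otimes> inv h"

lemma inv_cancel_left [simp]:
  "x \<in> carrier G \<Longrightarrow> y \<in> carrier G \<Longrightarrow> inv x \<otimes> (x \<otimes> y) = y"
  "x \<in> carrier G \<Longrightarrow> y \<in> carrier G \<Longrightarrow> x \<otimes> (inv x \<otimes> y) = y"
  by (simp_all flip: m_assoc)

lemma lower_central_normal: "lower_central G n \<lhd> G"
proof (induction n)
  case 0
  show ?case by (simp add: normal_inv_iff subgroup_self)
next
  case (Suc n)
  note N = Suc.IH
  have sub: "lower_central G n \<subseteq> carrier G" using N normal_imp_subgroup subgroup.subset by blast
  show ?case unfolding lower_central.simps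
  proof (rule normal_generateI)
    fix x k assume "x \<in> {commutator g h | g h. g \<in> lower_central G n \<and> h \<in> carrier G}" and k: "k \<in> carrier G"
    then obtain g h where gh: "x = commutator g h" "g \<in> lower_central G n" "h \<in> carrier G" by blast
    have g: "g \<in> carrier G" using gh sub by blast
    have "k \<otimes> x \<otimes> inv k = commutator (k \<otimes> g \<otimes> inv k) (k \<otimes> h \<otimes> inv k)"
      using gh g k by (simp add: m_assoc inv_mult_group)
    moreover have "k \<otimes> g \<otimes> inv k \<in> lower_central G n" using N gh(2) k by (simp add: normal_inv_iff)
    ultimately show "k \<otimes> x \<otimes> inv k \<in> {commutator g h | g h. g \<in> lower_central G n \<and> h \<in> carrier G}"
      using gh k by blast
  qed (use sub in auto)
qed

lemmas lower_central_subgroup = normal_imp_subgroup[OF lower_central_normal]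
lemmas lower_central_carrier = subgroup.mem_carrier[OF lower_central_subgroup]

lemma commutator_lower_central:
  "g \<in> lower_central G n \<Longrightarrow> h \<in> carrier G \<Longrightarrow> commutator g h \<in> lower_central G (Suc n)"
  unfolding lower_central.simps by (rule generate.incl) blast

lemma commutator_in_normal:
  assumes N: "N \<lhd> G" and "g \<in> N" "h \<in> carrier G" shows "commutator g h \<in> N"
proof -
  have g: "g \<in> carrier G" using N assms(2) normal_imp_subgroup subgroup.mem_carrier by metis
  have "h \<otimes> inv g \<otimes> inv h \<in> N"
    using assms normal_inv_iff subgroup.m_inv_closed by metis
  then have "g \<otimes> (h \<otimes> inv g \<otimes> inv h) \<in> N"
    using assms normal_imp_subgroup subgroup.m_closed by metis
  then show ?thesis using g assms(3) by (simp add: m_assoc)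
qed

lemma lower_central_Suc_subset: "lower_central G (Suc n) \<subseteq> lower_central G n"
  using generate_subgroup_incl[OF _ lower_central_subgroup,
      of "{commutator g h | g h. g \<in> lower_central G n \<and> h \<in> carrier G}" n]
    commutator_in_normal[OF lower_central_normal] unfolding lower_central.simps(2) by blast

lemma normal_if_central_mod:
  assumes R: "subgroup R G" and N: "N \<subseteq> R" and c: "\<And>r h. r \<in> R \<Longrightarrow> h \<in> carrier G \<Longrightarrow> commutator r h \<in> N"
  shows "R \<lhd> G"
proof (rule normal_invI[OF R])
  fix h r assume hr: "h \<in> carrier G" "r \<in> R"
  then have r: "r \<in> carrier G" using subgroup.mem_carrier[OF R] by blast
  have "h \<otimes> r \<otimes> inv h = inv (commutator r h) \<otimes> r"
    using hr r by (simp add: inv_mult_group m_assoc)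
  moreover have "inv (commutator r h) \<in> R" using c[OF hr(2,1)] N by (intro subgroup.m_inv_closed[OF R]) blast
  ultimately show "h \<otimes> r \<otimes> inv h \<in> R" using subgroup.m_closed[OF R _ hr(2)] by simp
qed

text \<open>Commutators of the generators of one term with \<open>X\<close> generate the next term
  modulo the one after, because there the commutator is multiplicative in both arguments. That
  single commutators suffice for \<open>n > 0\<close> matters for saturation, which treats central
  elements of exactly this form.\<close>

lemma lower_central_finite_generators:
  assumes X: "finite X" "X \<subseteq> carrier G" "generate G X = carrier G"
  shows "\<exists>Y. finite Y \<and> Y \<subseteq> lower_central G n \<and>
     (n > 0 \<longrightarrow> Y \<subseteq> {commutator g h | g h. g \<in> carrier G \<and> h \<in> carrier G}) \<and>
     lower_central G n = generate G (Y \<union> lower_central G (Suc n))"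
proof (induction n)
  case 0
  have "generate G (X \<union> lower_central G (Suc 0)) = carrier G"
    using X(2,3) subgroup.subset[OF lower_central_subgroup] mono_generate[of X "X \<union> lower_central G (Suc 0)"]
      generate_incl[of "X \<union> lower_central G (Suc 0)"] by (intro subset_antisym) (simp_all del: lower_central.simps)
  then show ?case using X by (intro exI[of _ X]) simp
next
  case (Suc n)
  then obtain Y where Y: "finite Y" "Y \<subseteq> lower_central G n"
    "lower_central G n = generate G (Y \<union> lower_central G (Suc n))" by blast
  let ?C = "(\<lambda>(y, x). commutator y x) ` (Y \<times> X)"
  let ?S = "?C \<union> lower_central G (Suc (Suc n))"
  define R where "R = generate G ?S"
  have C: "?C \<subseteq> lower_central G (Suc n)"
    using Y(2) X(2) commutator_lower_central[of _ n] by (auto simp: subset_iff simp del: lower_central.simps)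
  have S: "?S \<subseteq> lower_central G (Suc n)" using C lower_central_Suc_subset[of "Suc n"] by blast
  have Sc: "?S \<subseteq> carrier G" using S subgroup.subset[OF lower_central_subgroup] by (rule subset_trans)
  have Rs: "subgroup R G" unfolding R_def by (rule generate_is_subgroup[OF Sc])
  have RG: "R \<subseteq> lower_central G (Suc n)" unfolding R_def
    by (rule generate_subgroup_incl[OF S lower_central_subgroup])
  have R2: "lower_central G (Suc (Suc n)) \<subseteq> R" unfolding R_def by (auto intro: generate.incl)
  have Rn: "R \<lhd> G"
    using RG commutator_lower_central by (intro normal_if_central_mod[OF Rs R2]) (simp add: subset_iff del: lower_central.simps)
  note Rm = subgroup.m_closed[OF Rs] and Ri = subgroup.m_inv_closed[OF Rs]
  have Rc: "h \<otimes> r \<otimes> inv h \<in> R" if "r \<in> R" "h \<in> carrier G" for r h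
    using Rn that by (simp add: normal_inv_iff)
  have gen_y: "commutator y h \<in> R" if y: "y \<in> Y" and h: "h \<in> carrier G" for y h
  proof -
    have yc: "y \<in> carrier G" using y Y(2) lower_central_carrier[of y n] by blast
    have "h \<in> generate G X" using h X by simp
    then show ?thesis
    proof (induction rule: generate.induct)
      case one show ?case using yc subgroup.one_closed[OF Rs] by simp
    next
      case (incl x)
      then show ?case unfolding R_def using y by (intro generate.incl UnI1 image_eqI[of _ _ "(y, x)"]) simp_all
    next
      case (inv x)
      then have x: "x \<in> carrier G" using X by blast
      have "commutator y x \<in> R" unfolding R_def using y inv by (intro generate.incl UnI1 image_eqI[of _ _ "(y, x)"]) simp_all
      then have "inv x \<otimes> inv (commutator y x) \<otimes> inv (inv x) \<in> R" using x by (intro Rc[OF Ri[OF \<open>commutator y x \<in> R\<close>]]) simp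
      then show ?case using x yc by (simp add: inv_mult_group m_assoc)
    next
      case (eng h1 h2)
      then have h: "h1 \<in> carrier G" "h2 \<in> carrier G" using X by auto
      \<comment> \<open>The identity is \<open>[y, h1 h2] = [y, h1] h1 [y, h2] h1^-1\<close>;
        normality of \<open>R\<close> absorbs the conjugation.\<close>
      have "commutator y h1 \<otimes> (h1 \<otimes> commutator y h2 \<otimes> inv h1) \<in> R" by (rule Rm[OF eng.IH(1) Rc[OF eng.IH(2) h(1)]])
      then show ?case using h yc by (simp add: inv_mult_group m_assoc)
    qed
  qed
  have gen_g: "commutator g h \<in> R" if g: "g \<in> lower_central G n" and h: "h \<in> carrier G" for g h
  proof -
    have YS: "commutator y h \<in> R \<and> y \<in> carrier G" if "y \<in> Y \<union> lower_central G (Suc n)" for y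
      using that
    proof
      assume "y \<in> Y" then show ?thesis using gen_y[OF _ h] lower_central_carrier[of y n] Y(2) by blast
    next
      assume y: "y \<in> lower_central G (Suc n)"
      show ?thesis using commutator_lower_central[OF y h] R2 lower_central_carrier[OF y] by blast
    qed
    have "g \<in> generate G (Y \<union> lower_central G (Suc n))" using g Y(3) by simp
    then show ?thesis
    proof (induction rule: generate.induct)
      case one show ?case using h subgroup.one_closed[OF Rs] by simp
    next
      case (incl y) then show ?case using YS by blast
    next
      case (inv y)
      then have "inv y \<otimes> inv (commutator y h) \<otimes> inv (inv y) \<in> R" using YS[OF inv] by (intro Rc[OF Ri]) simp_all
      then show ?case using inv YS h by (simp add: inv_mult_group m_assoc)
    next
      case (eng g1 g2)
      then have g: "g1 \<in> carrier G" "g2 \<in> carrier G"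
        using Y(3) lower_central_carrier[of _ n] by auto
      have "(g1 \<otimes> commutator g2 h \<otimes> inv g1) \<otimes> commutator g1 h \<in> R" by (rule Rm[OF Rc[OF eng.IH(2) g(1)] eng.IH(1)])
      then show ?case using h g by (simp add: inv_mult_group m_assoc)
    qed
  qed
  have "lower_central G (Suc n) \<subseteq> R"
    unfolding lower_central.simps by (rule generate_subgroup_incl[OF _ Rs]) (use gen_g in blast)
  with RG have "lower_central G (Suc n) = R" by blast
  moreover have "?C \<subseteq> {commutator g h | g h. g \<in> carrier G \<and> h \<in> carrier G}"
    using Y(2) X(2) subgroup.subset[OF lower_central_subgroup[of n]] by fast
  ultimately show ?case using Y(1) X(1) C unfolding R_def
    by (intro exI[of _ ?C]) simp
qed

text \<open>A series with cyclic factors, each central modulo the previous term. \<open>C\<close>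
  restricts the adjoined elements: to commutators for saturation, to the whole carrier for
  polycyclicity.\<close>

inductive central_chain :: "'a set \<Rightarrow> 'a set \<Rightarrow> bool" for C where
  trivial: "central_chain C {\<one>}"
| extend: "central_chain C N \<Longrightarrow> y \<in> C \<Longrightarrow> y \<in> carrier G \<Longrightarrow>
    (\<And>h. h \<in> carrier G \<Longrightarrow> commutator y h \<in> N) \<Longrightarrow> central_chain C {n \<otimes> y [^] (i::int) | n i. n \<in> N}"

lemma central_int_pow:
  assumes N: "N \<lhd> G" and y: "y \<in> carrier G" and c: "\<And>h. h \<in> carrier G \<Longrightarrow> commutator y h \<in> N"
    and h: "h \<in> carrier G"
  shows "commutator (y [^] (i::int)) h \<in> N"
proof -
  note Ns = normal_imp_subgroup[OF N]
  have nconj: "g \<otimes> n \<otimes> inv g \<in> N" if "n \<in> N" "g \<in> carrier G" for n g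
    using N that by (simp add: normal_inv_iff)
  \<comment> \<open>\<open>P\<close> is the preimage of the centre of the quotient by
    \<open>N\<close>, hence a subgroup.\<close>
  define P where "P = {g \<in> carrier G. \<forall>h\<in>carrier G. commutator g h \<in> N}"
  have "subgroup P G"
  proof
    show "P \<subseteq> carrier G" by (auto simp: P_def)
    show "\<one> \<in> P" using subgroup.one_closed[OF Ns] by (auto simp: P_def)
    fix g1 assume g1: "g1 \<in> P"
    show "inv g1 \<in> P"
    proof -
      have "inv g1 \<otimes> inv (commutator g1 h) \<otimes> inv (inv g1) \<in> N" if "h \<in> carrier G" for h
        using g1 that by (intro nconj[OF subgroup.m_inv_closed[OF Ns]]) (simp_all add: P_def)
      then show ?thesis using g1 by (simp add: P_def inv_mult_group m_assoc)
    qed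
    fix g2 assume g2: "g2 \<in> P"
    have "(g1 \<otimes> commutator g2 h \<otimes> inv g1) \<otimes> commutator g1 h \<in> N" if "h \<in> carrier G" for h
      using g1 g2 that by (simp_all add: P_def subgroup.m_closed[OF Ns nconj])
    then show "g1 \<otimes> g2 \<in> P" using g1 g2 by (simp add: P_def inv_mult_group m_assoc)
  qed
  moreover have "y \<in> P" using y c by (simp add: P_def)
  ultimately have "y [^] i \<in> P" by (rule subgroup_int_pow_closed)
  then show ?thesis using h by (simp add: P_def)
qed

lemma normal_extend:
  assumes N: "N \<lhd> G" and y: "y \<in> carrier G" and c: "\<And>h. h \<in> carrier G \<Longrightarrow> commutator y h \<in> N"
  shows "{n \<otimes> y [^] (i::int) | n i. n \<in> N} \<lhd> G" (is "?L \<lhd> G")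
proof (rule normal_invI)
  note Ns = normal_imp_subgroup[OF N]
  note Nc = subgroup.mem_carrier[OF Ns]
  show "subgroup ?L G"
  proof
    show "?L \<subseteq> carrier G" using Nc y by auto
    have "\<one> \<otimes> y [^] (0::int) \<in> ?L" using subgroup.one_closed[OF Ns] by blast
    then show "\<one> \<in> ?L" by simp
    fix a assume "a \<in> ?L"
    then obtain n i where a: "a = n \<otimes> y [^] (i::int)" "n \<in> N" by blast
    have conj: "y [^] (i::int) \<otimes> n \<otimes> inv (y [^] i) \<in> N" if "n \<in> N" for n i
      using N y that by (simp add: normal_inv_iff)
    have "inv a = (y [^] (-i) \<otimes> inv n \<otimes> inv (y [^] (-i))) \<otimes> y [^] (-i)"
      using a Nc y by (simp add: inv_mult_group m_assoc int_pow_neg)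
    then show "inv a \<in> ?L" using conj[OF subgroup.m_inv_closed[OF Ns a(2)]] by blast
    fix b assume "b \<in> ?L"
    then obtain m j where b: "b = m \<otimes> y [^] (j::int)" "m \<in> N" by blast
    have yy: "y [^] (i + j) = y [^] i \<otimes> y [^] j" using y by (simp add: int_pow_mult)
    have "a \<otimes> b = (n \<otimes> (y [^] i \<otimes> m \<otimes> inv (y [^] i))) \<otimes> y [^] (i + j)"
      using a b Nc y unfolding yy by (simp add: m_assoc)
    then show "a \<otimes> b \<in> ?L" using conj[OF b(2)] subgroup.m_closed[OF Ns a(2)] by blast
  qed
  fix h a assume h: "h \<in> carrier G" and "a \<in> ?L"
  then obtain n i where a: "a = n \<otimes> y [^] (i::int)" "n \<in> N" by blast
  have "h \<otimes> a \<otimes> inv h = ((h \<otimes> n \<otimes> inv h) \<otimes> inv (commutator (y [^] i) h)) \<otimes> y [^] i"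
    using a h y Nc by (simp add: inv_mult_group m_assoc)
  moreover have "(h \<otimes> n \<otimes> inv h) \<otimes> inv (commutator (y [^] i) h) \<in> N"
    using N h a(2)
    by (intro subgroup.m_closed[OF Ns _ subgroup.m_inv_closed[OF Ns central_int_pow[OF N y c h]]])
      (simp_all add: normal_inv_iff)
  ultimately show "h \<otimes> a \<otimes> inv h \<in> ?L" by blast
qed

lemma central_chain_normal: "central_chain C N \<Longrightarrow> N \<lhd> G"
proof (induction rule: central_chain.induct)
  case trivial show ?case by (rule one_is_normal)
qed (rule normal_extend)

lemma generate_insert_normal:
  assumes N: "N \<lhd> G" and y: "y \<in> carrier G" and c: "\<And>h. h \<in> carrier G \<Longrightarrow> commutator y h \<in> N"
  shows "generate G (insert y N) = {n \<otimes> y [^] (i::int) | n i. n \<in> N}" (is "_ = ?L")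
proof
  note Ns = normal_imp_subgroup[OF N]
  have "\<one> \<otimes> y [^] (1::int) \<in> ?L" using subgroup.one_closed[OF Ns] by blast
  then have "y \<in> ?L" using y by simp
  moreover have "N \<subseteq> ?L"
  proof
    fix n assume n: "n \<in> N"
    then have "n \<otimes> y [^] (0::int) \<in> ?L" by blast
    then show "n \<in> ?L" using subgroup.mem_carrier[OF Ns n] by simp
  qed
  ultimately have "insert y N \<subseteq> ?L" by simp
  then show "generate G (insert y N) \<subseteq> ?L"
    by (rule generate_subgroup_incl) (rule normal_imp_subgroup[OF normal_extend[OF N y c]])
  have "insert y N \<subseteq> carrier G" using y subgroup.subset[OF Ns] by blast
  then have "subgroup (generate G (insert y N)) G" by (rule generate_is_subgroup)
  from subgroup_int_pow_closed[OF this generate.incl[OF insertI1]]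
  have "n \<otimes> y [^] (i::int) \<in> generate G (insert y N)" if "n \<in> N" for n i
    using that by (intro generate.eng generate.incl[of n] insertI2)
  then show "?L \<subseteq> generate G (insert y N)" by blast
qed

lemma central_chain_between:
  assumes Y: "finite Y" "Y \<subseteq> lower_central G n" "Y \<subseteq> C" and c: "central_chain C (lower_central G (Suc n))"
  shows "central_chain C (generate G (Y \<union> lower_central G (Suc n)))"
  using Y
proof (induction Y rule: finite_induct)
  case empty
  have "generate G (lower_central G (Suc n)) = lower_central G (Suc n)"
    by (intro subset_antisym generate_subgroup_incl[OF _ lower_central_subgroup] subsetI generate.incl) simp_all
  then show ?case using c by simp
next
  case (insert y Y)
  let ?Z = "Y \<union> lower_central G (Suc n)"
  have IH: "central_chain C (generate G ?Z)" using insert by blast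
  note N = central_chain_normal[OF IH]
  have y: "y \<in> carrier G" using insert lower_central_carrier[of y n] by blast
  have com: "commutator y h \<in> generate G ?Z" if "h \<in> carrier G" for h
    using commutator_lower_central[of y n h] insert.prems that by (intro generate.incl UnI2) simp
  have Z: "?Z \<subseteq> carrier G" using insert.prems subgroup.subset[OF lower_central_subgroup] by auto
  have "generate G (insert y (generate G ?Z)) = generate G (insert y Y \<union> lower_central G (Suc n))"
  proof
    have "subgroup (generate G (insert y Y \<union> lower_central G (Suc n))) G"
      using Z y by (intro generate_is_subgroup) auto
    then show "generate G (insert y (generate G ?Z)) \<subseteq> generate G (insert y Y \<union> lower_central G (Suc n))"
      using mono_generate[of ?Z "insert y Y \<union> lower_central G (Suc n)"]
        generate.incl[of y "insert y Y \<union> lower_central G (Suc n)" G]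
      by (intro generate_subgroup_incl) (simp_all add: subset_insertI)
    show "generate G (insert y Y \<union> lower_central G (Suc n)) \<subseteq> generate G (insert y (generate G ?Z))"
      using generate.incl[of _ ?Z G] by (intro mono_generate) blast
  qed
  then show ?case
    using central_chain.extend[OF IH _ y com] insert.prems generate_insert_normal[OF N y com] by simp
qed

lemma central_chain_lower_central:
  assumes X: "finite X" "X \<subseteq> carrier G" "generate G X = carrier G"
    and nil: "lower_central G c = {\<one>}" and n: "n \<le> c"
    and C: "n > 0 \<Longrightarrow> {commutator g h | g h. g \<in> carrier G \<and> h \<in> carrier G} \<subseteq> C" "n = 0 \<Longrightarrow> C = carrier G"
  shows "central_chain C (lower_central G n)"
  using n C
proof (induction n rule: inc_induct)
  case base
  show ?case using central_chain.trivial nil by simp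
next
  case (step n)
  have CC: "{commutator g h | g h. g \<in> carrier G \<and> h \<in> carrier G} \<subseteq> C" using step.prems by (cases n) auto
  obtain Y where Y: "finite Y" "Y \<subseteq> lower_central G n"
     "n > 0 \<longrightarrow> Y \<subseteq> {commutator g h | g h. g \<in> carrier G \<and> h \<in> carrier G}"
     "lower_central G n = generate G (Y \<union> lower_central G (Suc n))"
    using lower_central_finite_generators[OF X, of n] by blast
  have "Y \<subseteq> C" using Y(2,3) CC step.prems(2) lower_central_carrier by (cases n) auto
  then show ?case using central_chain_between[OF Y(1,2) _ step.IH] CC Y(4) by simp
qed

end

subsection \<open>Saturation of subsemigroups\<close>

context group
begin

lemma subsemigroup_nat_pow:
  assumes M: "\<And>m m'. m \<in> M \<Longrightarrow> m' \<in> M \<Longrightarrow> m \<otimes> m' \<in> M" and m: "m \<in> M" "m \<in> carrier G" and n: "n > 0"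
  shows "m [^] (n::nat) \<in> M"
  using n
proof (induction n)
  case (Suc n)
  show ?case
  proof (cases n)
    case 0 then show ?thesis using m by simp
  next
    case (Suc k) then show ?thesis using M[OF Suc.IH m(1)] by simp
  qed
qed simp

lemma nat_pow_commute:
  assumes "z \<in> carrier G" "h \<in> carrier G" "z \<otimes> h = h \<otimes> z"
  shows "z [^] (k::nat) \<otimes> h = h \<otimes> z [^] k"
proof (induction k)
  case (Suc k)
  have "z [^] Suc k \<otimes> h = z [^] k \<otimes> h \<otimes> z" using assms by (simp add: m_assoc)
  then show ?case using assms by (simp add: Suc.IH m_assoc)
qed (use assms in simp)

lemma inv_commute:
  assumes "z \<in> carrier G" "h \<in> carrier G" "z \<otimes> h = h \<otimes> z"
  shows "inv z \<otimes> h = h \<otimes> inv z"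
proof -
  have "inv z \<otimes> h = inv z \<otimes> (h \<otimes> z) \<otimes> inv z" using assms(1,2) by (simp add: m_assoc)
  then show ?thesis using assms(1,2) by (simp add: m_assoc flip: assms(3))
qed

lemma int_pow_commute:
  assumes "z \<in> carrier G" "h \<in> carrier G" "z \<otimes> h = h \<otimes> z"
  shows "z [^] (k::int) \<otimes> h = h \<otimes> z [^] k"
proof (cases k)
  case (nonneg n)
  then show ?thesis using nat_pow_commute[OF assms, of n] by (simp only: int_pow_int)
next
  case (neg n)
  then show ?thesis using inv_commute[OF _ assms(2) nat_pow_commute[OF assms, of "Suc n"]] assms(1)
    by (simp only: int_pow_neg_int nat_pow_closed)
qed

lemma central_commutator_pow:
  assumes ab: "a \<in> carrier G" "b \<in> carrier G" and z: "z = commutator a b"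
    and c: "\<And>h. h \<in> carrier G \<Longrightarrow> z \<otimes> h = h \<otimes> z"
  shows "a [^] (m::nat) \<otimes> b [^] (n::nat) = z [^] (m * n) \<otimes> (b [^] n \<otimes> a [^] m)"
proof -
  have zc: "z \<in> carrier G" using ab z by simp
  have zk: "z [^] (k::nat) \<otimes> h = h \<otimes> z [^] k" if "h \<in> carrier G" for h k
    using nat_pow_commute[OF zc that c[OF that]] .
  have 1: "a \<otimes> b = z \<otimes> (b \<otimes> a)" using ab by (simp add: z m_assoc)
  have 2: "a [^] m \<otimes> b = z [^] m \<otimes> (b \<otimes> a [^] m)" for m :: nat
  proof (induction m)
    case (Suc m)
    have "a [^] Suc m \<otimes> b = a [^] m \<otimes> (a \<otimes> b)" using ab by (simp add: m_assoc)
    also have "\<dots> = (a [^] m \<otimes> z) \<otimes> (b \<otimes> a)" using ab zc by (simp add: 1 m_assoc)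
    also have "a [^] m \<otimes> z = z \<otimes> a [^] m" using c[of "a [^] m"] ab by simp
    also have "z \<otimes> a [^] m \<otimes> (b \<otimes> a) = z \<otimes> ((a [^] m \<otimes> b) \<otimes> a)" using ab zc by (simp add: m_assoc)
    also have "\<dots> = z \<otimes> z [^] m \<otimes> (b \<otimes> (a [^] m \<otimes> a))" unfolding Suc.IH using ab zc by (simp add: m_assoc)
    also have "z \<otimes> z [^] m = z [^] Suc m" using zc by (simp only: nat_pow_Suc2)
    finally show ?case by simp
  qed (use ab in simp)
  show ?thesis
  proof (induction n)
    case (Suc n)
    have "a [^] m \<otimes> b [^] Suc n = (a [^] m \<otimes> b [^] n) \<otimes> b" using ab by (simp add: m_assoc)
    also have "\<dots> = z [^] (m * n) \<otimes> (b [^] n \<otimes> (a [^] m \<otimes> b))"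
      unfolding Suc.IH using ab zc by (simp add: m_assoc)
    also have "\<dots> = z [^] (m * n) \<otimes> ((b [^] n \<otimes> z [^] m) \<otimes> (b \<otimes> a [^] m))"
      unfolding 2 using ab zc by (simp add: m_assoc)
    also have "b [^] n \<otimes> z [^] m = z [^] m \<otimes> b [^] n" using zk[of "b [^] n" m] ab by simp
    also have "z [^] (m * n) \<otimes> (z [^] m \<otimes> b [^] n \<otimes> (b \<otimes> a [^] m)) =
       (z [^] (m * n) \<otimes> z [^] m) \<otimes> (b [^] Suc n \<otimes> a [^] m)"
      using ab zc by (simp add: m_assoc)
    also have "z [^] (m * n) \<otimes> z [^] m = z [^] (m * Suc n)"
      using zc by (simp add: nat_pow_mult add.commute)
    finally show ?case .
  qed (use ab in simp)
qed

text \<open>The commutator of \<open>n\<close>-th powers grows quadratically in \<open>n\<close>, so it outweighs the correction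
  \<open>z\<^bsup>nq\<^esup>\<close> needed to bring the four factors into \<open>M\<close>; hence \<open>M\<close> contains both positive and
  negative powers of \<open>z\<close>.\<close>

lemma saturation_central:
  assumes ab: "a \<in> carrier G" "b \<in> carrier G" and z: "z = commutator a b"
    and c: "\<And>h. h \<in> carrier G \<Longrightarrow> z \<otimes> h = h \<otimes> z"
    and M: "M \<subseteq> carrier G" "\<And>m m'. m \<in> M \<Longrightarrow> m' \<in> M \<Longrightarrow> m \<otimes> m' \<in> M"
    and full: "\<And>g. g \<in> carrier G \<Longrightarrow> \<exists>k>0::nat. \<exists>i::int. g [^] k \<otimes> z [^] i \<in> M"
    and g: "g \<in> carrier G"
  shows "\<exists>k>0::nat. g [^] k \<in> M"
proof -
  have zc: "z \<in> carrier G" using ab z by simp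
  have zi: "z [^] (k::int) \<otimes> h = h \<otimes> z [^] k" if "h \<in> carrier G" for h k
    using int_pow_commute[OF zc that c[OF that]] .
  have mult: "(x \<otimes> z [^] i) \<otimes> (y \<otimes> z [^] j) = (x \<otimes> y) \<otimes> z [^] (i + j)"
    if "x \<in> carrier G" "y \<in> carrier G" for x y and i j :: int
  proof -
    have "(x \<otimes> z [^] i) \<otimes> (y \<otimes> z [^] j) = x \<otimes> (z [^] i \<otimes> y) \<otimes> z [^] j" using that zc by (simp add: m_assoc)
    also have "z [^] i \<otimes> y = y \<otimes> z [^] i" using zi that by simp
    also have "x \<otimes> (y \<otimes> z [^] i) \<otimes> z [^] j = (x \<otimes> y) \<otimes> (z [^] i \<otimes> z [^] j)" using that zc by (simp add: m_assoc)
    finally show ?thesis using zc by (simp add: int_pow_mult)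
  qed
  have power: "(x \<otimes> z [^] i) [^] n = x [^] n \<otimes> z [^] (i * int n)" if "x \<in> carrier G" for x i and n :: nat
  proof -
    have "(x \<otimes> z [^] i) [^] n = x [^] n \<otimes> (z [^] i) [^] n"
      by (rule pow_mult_distrib[OF zi[OF that, symmetric]]) (use that zc in simp_all)
    then show ?thesis using int_pow_pow[OF zc, of i "int n"] by (simp add: int_pow_int)
  qed
  have pair: "\<exists>A>0::nat. \<exists>i j. x [^] A \<otimes> z [^] (i::int) \<in> M \<and> inv (x [^] A) \<otimes> z [^] (j::int) \<in> M"
    if x: "x \<in> carrier G" for x
  proof -
    obtain k i where k: "k > 0" "x [^] (k::nat) \<otimes> z [^] (i::int) \<in> M" using full[OF x] by blast
    obtain l j where l: "l > 0" "inv x [^] (l::nat) \<otimes> z [^] (j::int) \<in> M" using full[of "inv x"] x by blast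
    have "x [^] (k * l) \<otimes> z [^] (i * int l) \<in> M"
      using subsemigroup_nat_pow[OF M(2) k(2) _ l(1)] x zc by (simp add: power nat_pow_pow)
    moreover have "inv (x [^] (k * l)) \<otimes> z [^] (j * int k) \<in> M"
      using subsemigroup_nat_pow[OF M(2) l(2) _ k(1)] x zc by (simp add: power nat_pow_pow nat_pow_inv mult.commute)
    ultimately show ?thesis using k(1) l(1) by (intro exI[of _ "k * l"]) auto
  qed
  obtain A i1 i3 where A: "A > 0" "a [^] (A::nat) \<otimes> z [^] (i1::int) \<in> M" "inv (a [^] A) \<otimes> z [^] (i3::int) \<in> M"
    using pair[OF ab(1)] by blast
  obtain B i2 i4 where B: "B > 0" "b [^] (B::nat) \<otimes> z [^] (i2::int) \<in> M" "inv (b [^] B) \<otimes> z [^] (i4::int) \<in> M"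
    using pair[OF ab(2)] by blast
  define q where "q = i1 + i2 + i3 + i4"
  \<comment> \<open>With this \<open>n\<close> the exponents \<open>q * n + N\<close> and
    \<open>q * n - N\<close> have opposite signs, since \<open>N\<close> is at least
    \<open>n * n\<close>.\<close>
  define n where "n = nat \<bar>q\<bar> + 1"
  have n: "n > 0" by (simp add: n_def)
  have pn: "x [^] n \<otimes> z [^] (i * int n) \<in> M" if "x \<otimes> z [^] i \<in> M" "x \<in> carrier G" for x i
    using subsemigroup_nat_pow[OF M(2) that(1) _ n] that zc by (simp add: power)
  let ?a = "a [^] (A * n)" and ?b = "b [^] (B * n)" and ?N = "(A * n) * (B * n)"
  have m: "?a \<otimes> z [^] (i1 * int n) \<in> M" "?b \<otimes> z [^] (i2 * int n) \<in> M"
    "inv ?a \<otimes> z [^] (i3 * int n) \<in> M" "inv ?b \<otimes> z [^] (i4 * int n) \<in> M"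
    using pn[OF A(2)] pn[OF A(3)] pn[OF B(2)] pn[OF B(3)] ab by (simp_all add: nat_pow_pow nat_pow_inv)
  have com: "?a \<otimes> ?b = z [^] ?N \<otimes> (?b \<otimes> ?a)" using central_commutator_pow[OF ab z c] .
  have "((?a \<otimes> ?b) \<otimes> inv ?a \<otimes> inv ?b) \<otimes> z [^] (i1 * int n + i2 * int n + i3 * int n + i4 * int n) \<in> M"
    using M(2)[OF M(2)[OF M(2)[OF m(1,2)] m(3)] m(4)] ab by (simp add: mult)
  moreover have "(?a \<otimes> ?b) \<otimes> inv ?a \<otimes> inv ?b = z [^] int ?N"
    unfolding com using ab zc by (simp add: m_assoc int_pow_int del: of_nat_mult)
  ultimately have "z [^] (int ?N + (i1 * int n + i2 * int n + i3 * int n + i4 * int n)) \<in> M"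
    by (simp only: int_pow_mult[OF zc])
  moreover have "i1 * int n + i2 * int n + i3 * int n + i4 * int n = q * int n"
    by (simp add: q_def algebra_simps)
  ultimately have 1: "z [^] (int ?N + q * int n) \<in> M" by simp
  have "((?b \<otimes> ?a) \<otimes> inv ?b \<otimes> inv ?a) \<otimes> z [^] (i2 * int n + i1 * int n + i4 * int n + i3 * int n) \<in> M"
    using M(2)[OF M(2)[OF M(2)[OF m(2,1)] m(4)] m(3)] ab by (simp add: mult)
  moreover have "(?b \<otimes> ?a) \<otimes> inv ?b \<otimes> inv ?a = inv ((?a \<otimes> ?b) \<otimes> inv ?a \<otimes> inv ?b)"
    using ab by (simp add: inv_mult_group m_assoc)
  then have "(?b \<otimes> ?a) \<otimes> inv ?b \<otimes> inv ?a = z [^] (- int ?N)"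
    unfolding com using ab zc by (simp add: m_assoc int_pow_neg_int inv_mult_group del: of_nat_mult)
  ultimately have "z [^] (- int ?N + (i2 * int n + i1 * int n + i4 * int n + i3 * int n)) \<in> M"
    by (simp only: int_pow_mult[OF zc])
  moreover have "i2 * int n + i1 * int n + i4 * int n + i3 * int n = q * int n"
    by (simp add: q_def algebra_simps)
  ultimately have 2: "z [^] (- int ?N + q * int n) \<in> M" by simp
  have N: "int ?N \<ge> int n * int n"
  proof -
    have "1 * 1 \<le> A * B" using A(1) B(1) by (intro mult_le_mono) auto
    then have "(1 * 1) * (n * n) \<le> (A * B) * (n * n)" by (rule mult_le_mono1)
    then show ?thesis by (simp add: algebra_simps flip: of_nat_mult)
  qed
  have "int n > \<bar>q\<bar>" by (simp add: n_def)
  then have "\<bar>q * int n\<bar> < int n * int n" using n by (simp add: abs_mult)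
  then have pos: "int ?N + q * int n > 0" "int ?N - q * int n > 0" using N by linarith+
  define p where "p = nat (int ?N + q * int n)"
  define r where "r = nat (int ?N - q * int n)"
  have pr: "p > 0" "r > 0" "int p = int ?N + q * int n" "int r = int ?N - q * int n"
    using pos by (simp_all add: p_def r_def)
  have zM: "z [^] int (p * r) \<in> M" "z [^] (- int (p * r)) \<in> M"
  proof -
    have "(z [^] int p) [^] r \<in> M" "(z [^] (- int r)) [^] p \<in> M"
      using 1 2 pr zc by (intro subsemigroup_nat_pow M(2); simp)+
    then show "z [^] int (p * r) \<in> M" "z [^] (- int (p * r)) \<in> M"
      using int_pow_pow[OF zc, of "int p" "int r"] int_pow_pow[OF zc, of "- int r" "int p"]
      by (simp_all add: int_pow_int algebra_simps)
  qed
  obtain k i where k: "k > 0" "g [^] (k::nat) \<otimes> z [^] (i::int) \<in> M" using full[OF g] by blast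
  let ?P = "p * r"
  have P: "?P > 0" using pr by simp
  have gP: "g [^] (k * ?P) \<otimes> z [^] (i * int ?P) \<in> M"
    using subsemigroup_nat_pow[OF M(2) k(2) _ P] g zc by (simp add: power nat_pow_pow del: of_nat_mult)
  have "g [^] (k * ?P) \<in> M"
  proof (cases "i = 0")
    case True then show ?thesis using gP g by simp
  next
    case False
    \<comment> \<open>As many copies of this power of \<open>z\<close> as the absolute value of
      \<open>i\<close>, with sign opposite to \<open>i\<close>, cancel the central factor in
      \<open>gP\<close>.\<close>
    define s where "s = (if i > 0 then - int ?P else int ?P)"
    have "(z [^] s) [^] (nat \<bar>i\<bar>) \<in> M"
      using zM False zc by (intro subsemigroup_nat_pow M(2)) (auto simp: s_def)
    then have "z [^] (s * \<bar>i\<bar>) \<in> M"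
      using int_pow_pow[OF zc, of s "int (nat \<bar>i\<bar>)"] by (simp only: int_pow_int) simp
    moreover have "s * \<bar>i\<bar> = - (i * int ?P)" by (simp add: s_def)
    ultimately have "z [^] (- (i * int ?P)) \<in> M" by simp
    from M(2)[OF gP this] show ?thesis
      using g zc by (simp add: m_assoc del: of_nat_mult flip: int_pow_mult)
  qed
  then show ?thesis using k(1) P by (intro exI[of _ "k * ?P"]) simp
qed

text \<open>In the quotient by \<open>N\<close> the commutator becomes central, so
  \<open>saturation_central\<close> applies to the image of \<open>M\<close>; equality of cosets
  leaves the factor \<open>n\<close>.\<close>

lemma saturation_step:
  assumes N: "N \<lhd> G" and ab: "a \<in> carrier G" "b \<in> carrier G"
    and c: "\<And>h. h \<in> carrier G \<Longrightarrow> commutator (commutator a b) h \<in> N"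
    and M: "M \<subseteq> carrier G" "\<And>m m'. m \<in> M \<Longrightarrow> m' \<in> M \<Longrightarrow> m \<otimes> m' \<in> M"
    and full: "\<And>g. g \<in> carrier G \<Longrightarrow>
       \<exists>k>0::nat. \<exists>n\<in>N. \<exists>i::int. \<exists>m\<in>M. g [^] k = n \<otimes> commutator a b [^] i \<otimes> m"
    and g: "g \<in> carrier G"
  shows "\<exists>k>0::nat. \<exists>n\<in>N. \<exists>m\<in>M. g [^] k = n \<otimes> m"
proof -
  interpret N: normal N G by (rule N)
  let ?Q = "G Mod N"
  interpret Q: group ?Q by (rule N.factorgroup_is_group)
  let ?p = "\<lambda>x. N #> x"
  interpret p: group_hom G ?Q ?p
    by unfold_locales (rule N.r_coset_hom_Mod)
  let ?y = "commutator a b"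
  have y: "?y \<in> carrier G" using ab by simp
  have pN: "?p n = \<one>\<^bsub>?Q\<^esub>" if "n \<in> N" for n
    using that N.rcos_const[OF is_group] by simp
  have carr: "\<exists>x\<in>carrier G. X = ?p x" if "X \<in> carrier ?Q" for X
    using that by (auto simp: carrier_FactGroup)
  have cent: "?p ?y \<otimes>\<^bsub>?Q\<^esub> X = X \<otimes>\<^bsub>?Q\<^esub> ?p ?y" if "X \<in> carrier ?Q" for X
  proof -
    obtain h where h: "h \<in> carrier G" "X = ?p h" using carr \<open>X \<in> carrier ?Q\<close> by blast
    have "?y \<otimes> h = commutator ?y h \<otimes> (h \<otimes> ?y)" using h(1) y by (simp add: m_assoc del: inv_mult_group)
    then have "?p ?y \<otimes>\<^bsub>?Q\<^esub> ?p h = ?p (commutator ?y h) \<otimes>\<^bsub>?Q\<^esub> (?p h \<otimes>\<^bsub>?Q\<^esub> ?p ?y)"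
      using h(1) y by (simp only: p.hom_mult[symmetric] m_closed inv_closed)
    also have "\<dots> = ?p h \<otimes>\<^bsub>?Q\<^esub> ?p ?y"
      unfolding pN[OF c[OF h(1)]] using h(1) y by (intro Q.l_one Q.m_closed p.hom_closed)
    finally show ?thesis using h(2) by simp
  qed
  have "\<exists>k>0::nat. ?p g [^]\<^bsub>?Q\<^esub> k \<in> ?p ` M"
  proof (rule Q.saturation_central[of "?p a" "?p b" "?p ?y"])
    show "?p a \<in> carrier ?Q" "?p b \<in> carrier ?Q" "?p g \<in> carrier ?Q" using ab g by (simp_all only: p.hom_closed)
    show "?p ?y = Q.commutator (?p a) (?p b)"
      using ab by (simp only: p.hom_mult p.hom_inv m_closed inv_closed)
    show "?p ` M \<subseteq> carrier ?Q" using M(1) p.hom_closed by blast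
    fix X Y assume "X \<in> ?p ` M" "Y \<in> ?p ` M"
    then obtain m m' where m: "m \<in> M" "m' \<in> M" "X = ?p m" "Y = ?p m'" by blast
    then have "X \<otimes>\<^bsub>?Q\<^esub> Y = ?p (m \<otimes> m')" using M(1) p.hom_mult[of m m'] by blast
    then show "X \<otimes>\<^bsub>?Q\<^esub> Y \<in> ?p ` M" using M(2) m by blast
  next
    fix X assume "X \<in> carrier ?Q"
    then obtain x where x: "x \<in> carrier G" "X = ?p x" using carr by blast
    obtain k n i m where k: "k > 0" "n \<in> N" "m \<in> M" "x [^] (k::nat) = n \<otimes> ?y [^] (i::int) \<otimes> m"
      using full[OF x(1)] by blast
    have car: "n \<in> carrier G" "m \<in> carrier G" "?y [^] i \<in> carrier G" using k M(1) y by auto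
    have "X [^]\<^bsub>?Q\<^esub> k = ?p (x [^] k)" using x p.hom_nat_pow by simp
    also have "\<dots> = ?p n \<otimes>\<^bsub>?Q\<^esub> ?p (?y [^] i) \<otimes>\<^bsub>?Q\<^esub> ?p m"
      unfolding k(4) using car by (simp only: p.hom_mult m_closed)
    also have "\<dots> = ?p ?y [^]\<^bsub>?Q\<^esub> i \<otimes>\<^bsub>?Q\<^esub> ?p m"
      unfolding pN[OF k(2)] p.hom_int_pow[OF y] using y by (simp only: Q.l_one Q.int_pow_closed p.hom_closed)
    finally have e: "X [^]\<^bsub>?Q\<^esub> k = ?p ?y [^]\<^bsub>?Q\<^esub> i \<otimes>\<^bsub>?Q\<^esub> ?p m" .
    have com: "?p ?y [^]\<^bsub>?Q\<^esub> i \<otimes>\<^bsub>?Q\<^esub> ?p m = ?p m \<otimes>\<^bsub>?Q\<^esub> ?p ?y [^]\<^bsub>?Q\<^esub> i"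
      by (rule Q.int_pow_commute[OF _ _ cent]) (use y car in \<open>simp_all only: p.hom_closed\<close>)
    have "X [^]\<^bsub>?Q\<^esub> k \<otimes>\<^bsub>?Q\<^esub> ?p ?y [^]\<^bsub>?Q\<^esub> (- i) = ?p m"
      unfolding e com using y car
      by (simp only: Q.m_assoc Q.int_pow_closed p.hom_closed Q.int_pow_neg Q.inv_closed Q.r_inv Q.r_one)
    then show "\<exists>k>0::nat. \<exists>i::int. X [^]\<^bsub>?Q\<^esub> k \<otimes>\<^bsub>?Q\<^esub> ?p ?y [^]\<^bsub>?Q\<^esub> i \<in> ?p ` M"
      using k(1,3) by blast
  qed (use cent in blast)
  then obtain k m where k: "k > 0" "m \<in> M" "?p g [^]\<^bsub>?Q\<^esub> (k::nat) = ?p m" by blast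
  then have "?p (g [^] k) = ?p m" using p.hom_nat_pow[OF g] by simp
  then have "g [^] k \<in> N #> m" using rcos_self[OF nat_pow_closed[OF g] N.subgroup_axioms, of k] by simp
  then obtain n where "n \<in> N" "g [^] k = n \<otimes> m" by (auto simp: r_coset_def)
  then show ?thesis using k(1,2) by blast
qed

text \<open>Descending along the central chain of the commutator subgroup removes one cyclic factor
  at a time. Each factor is generated by a commutator, as \<open>saturation_step\<close>
  requires.\<close>

theorem saturation:
  assumes X: "finite X" "X \<subseteq> carrier G" "generate G X = carrier G" and nil: "lower_central G c = {\<one>}"
    and M: "M \<subseteq> carrier G" "\<And>m m'. m \<in> M \<Longrightarrow> m' \<in> M \<Longrightarrow> m \<otimes> m' \<in> M"
    and full: "\<And>g. g \<in> carrier G \<Longrightarrow> \<exists>k>0::nat. \<exists>n\<in>lower_central G 1. \<exists>m\<in>M. g [^] k = n \<otimes> m"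
    and g: "g \<in> carrier G"
  shows "\<exists>k>0::nat. g [^] k \<in> M"
proof -
  let ?C = "{commutator g h | g h. g \<in> carrier G \<and> h \<in> carrier G}"
  \<comment> \<open>The chain is needed from index 1, so the length is raised by one to cover
    \<open>c = 0\<close>.\<close>
  have nil': "lower_central G (Suc c) = {\<one>}"
    using lower_central_Suc_subset[of c] nil subgroup.one_closed[OF lower_central_subgroup, of "Suc c"] by auto
  have ch: "central_chain ?C (lower_central G 1)"
    by (rule central_chain_lower_central[OF X nil']) auto
  have "\<forall>g\<in>carrier G. \<exists>k>0::nat. g [^] k \<in> M"
    if "central_chain ?C N" "\<forall>g\<in>carrier G. \<exists>k>0::nat. \<exists>n\<in>N. \<exists>m\<in>M. g [^] k = n \<otimes> m" for N
    using that
  proof (induction rule: central_chain.induct)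
    case trivial
    then show ?case using M(1) by (metis l_one singletonD subsetD)
  next
    case (extend N y)
    obtain a b where ab: "a \<in> carrier G" "b \<in> carrier G" "y = commutator a b" using extend.hyps(2) by blast
    show ?case
    proof (rule extend.IH, rule ballI)
      fix g assume g: "g \<in> carrier G"
      show "\<exists>k>0::nat. \<exists>n\<in>N. \<exists>m\<in>M. g [^] k = n \<otimes> m"
      proof (rule saturation_step[OF central_chain_normal[OF extend.hyps(1)] ab(1,2) _ M _ g])
        show "commutator (commutator a b) h \<in> N" if "h \<in> carrier G" for h
          using extend.hyps(4)[OF that] ab(3) by simp
        show "\<exists>k>0::nat. \<exists>n\<in>N. \<exists>i::int. \<exists>m\<in>M. g [^] k = n \<otimes> commutator a b [^] i \<otimes> m"
          if "g \<in> carrier G" for g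
          using extend.prems that unfolding ab(3) by blast
      qed
    qed
  qed
  from this[OF ch] full g show ?thesis by blast
qed

end

subsection \<open>Subsemigroups of the abelianization\<close>

definition list_prod :: "('a, 'b) monoid_scheme \<Rightarrow> 'a list \<Rightarrow> 'a" where
  "list_prod G ws = foldr (\<otimes>\<^bsub>G\<^esub>) ws \<one>\<^bsub>G\<^esub>"

lemma list_prod_simps [simp]:
  "list_prod G [] = \<one>\<^bsub>G\<^esub>" "list_prod G (w # ws) = w \<otimes>\<^bsub>G\<^esub> list_prod G ws"
  by (simp_all add: list_prod_def)

primrec pow_prod :: "('a, 'b) monoid_scheme \<Rightarrow> (nat \<Rightarrow> 'a) \<Rightarrow> (nat \<Rightarrow> int) \<Rightarrow> nat \<Rightarrow> 'a" where
  "pow_prod G a v 0 = \<one>\<^bsub>G\<^esub>"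
| "pow_prod G a v (Suc n) = pow_prod G a v n \<otimes>\<^bsub>G\<^esub> a n [^]\<^bsub>G\<^esub> v n"

context group
begin

lemma list_prod_closed [simp]: "set ws \<subseteq> carrier G \<Longrightarrow> list_prod G ws \<in> carrier G"
  by (induction ws) auto

lemma list_prod_append:
  "set ws \<subseteq> carrier G \<Longrightarrow> set vs \<subseteq> carrier G \<Longrightarrow> list_prod G (ws @ vs) = list_prod G ws \<otimes> list_prod G vs"
  by (induction ws) (auto simp: m_assoc)

lemma list_prod_replicate:
  "w \<in> carrier G \<Longrightarrow> list_prod G (replicate n w) = w [^] n"
  by (induction n) (simp_all only: replicate.simps list_prod_simps nat_pow_Suc2 nat_pow_0)

lemma pow_prod_closed [simp]: "(\<And>i. i < n \<Longrightarrow> a i \<in> carrier G) \<Longrightarrow> pow_prod G a v n \<in> carrier G"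
  by (induction n) auto

lemma pow_prod_zero: "(\<And>i. i < n \<Longrightarrow> v i = 0) \<Longrightarrow> pow_prod G a v n = \<one>"
  by (induction n) auto

lemma pow_prod_unit:
  "i < n \<Longrightarrow> (\<And>i. i < n \<Longrightarrow> a i \<in> carrier G) \<Longrightarrow> pow_prod G a (\<lambda>j. if j = i then 1 else 0) n = a i"
proof (induction n)
  case (Suc n)
  show ?case
  proof (cases "i = n")
    case True
    then have "pow_prod G a (\<lambda>j. if j = i then 1 else 0) n = \<one>" by (intro pow_prod_zero) auto
    then show ?thesis using Suc.prems True by simp
  next
    case False
    then show ?thesis using Suc by simp
  qed
qed simp

lemma pow_prod_add_zero:
  "(\<And>i. i < n + l \<Longrightarrow> a i \<in> carrier G) \<Longrightarrow> (\<And>i. n \<le> i \<Longrightarrow> i < n + l \<Longrightarrow> v i = 0) \<Longrightarrow>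
    pow_prod G a v (n + l) = pow_prod G a v n"
  by (induction l) simp_all

end

context comm_group
begin

lemma pow_prod_diff:
  "(\<And>i. i < n \<Longrightarrow> a i \<in> carrier G) \<Longrightarrow>
    pow_prod G a (\<lambda>i. v i - w i) n = pow_prod G a v n \<otimes> inv (pow_prod G a w n)"
proof (induction n)
  case (Suc n)
  have a: "a n \<in> carrier G" "\<And>i. i < n \<Longrightarrow> a i \<in> carrier G" using Suc.prems by auto
  have "pow_prod G a (\<lambda>i. v i - w i) (Suc n) =
      (pow_prod G a v n \<otimes> inv (pow_prod G a w n)) \<otimes> (a n [^] v n \<otimes> inv (a n [^] w n))"
    using Suc.IH[OF a(2)] a(1) by (simp add: int_pow_diff)
  also have "\<dots> = (pow_prod G a v n \<otimes> a n [^] v n) \<otimes> inv (pow_prod G a w n \<otimes> a n [^] w n)"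
    using a by (simp add: inv_mult m_ac)
  finally show ?case by simp
qed simp

lemma pow_prod_neg:
  "(\<And>i. i < n \<Longrightarrow> a i \<in> carrier G) \<Longrightarrow> pow_prod G a (\<lambda>i. - w i) n = inv (pow_prod G a w n)"
  using pow_prod_diff[of n a "\<lambda>_. 0" w] pow_prod_zero[of n "\<lambda>_. 0" a] by simp

lemma pow_prod_add:
  "(\<And>i. i < n \<Longrightarrow> a i \<in> carrier G) \<Longrightarrow>
    pow_prod G a (\<lambda>i. v i + w i) n = pow_prod G a v n \<otimes> pow_prod G a w n"
  using pow_prod_diff[of n a v "\<lambda>i. - w i"] pow_prod_neg[of n a w] by simp

end

context group
begin

lemma abelianization:
  assumes D: "D = lower_central G 1"
  shows "comm_group (G Mod D)"
proof (rule group.group_comm_groupI)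
  interpret D: normal D G unfolding D by (rule lower_central_normal)
  let ?Q = "G Mod D"
  show "group ?Q" by (rule D.factorgroup_is_group)
  then interpret Q: group ?Q .
  let ?p = "\<lambda>x. D #> x"
  interpret p: group_hom G ?Q ?p by unfold_locales (rule D.r_coset_hom_Mod)
  fix X Y assume "X \<in> carrier ?Q" "Y \<in> carrier ?Q"
  then obtain x y where xy: "x \<in> carrier G" "y \<in> carrier G" "X = ?p x" "Y = ?p y"
    unfolding carrier_FactGroup by blast
  have "commutator x y \<in> D"
    unfolding D using commutator_lower_central[of x 0 y] xy(1,2) by simp
  then have e: "?p (commutator x y) = \<one>\<^bsub>?Q\<^esub>" using D.rcos_const[OF is_group] by simp
  have "x \<otimes> y = commutator x y \<otimes> (y \<otimes> x)" using xy(1,2) by (simp add: m_assoc)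
  then have "?p x \<otimes>\<^bsub>?Q\<^esub> ?p y = ?p (commutator x y) \<otimes>\<^bsub>?Q\<^esub> (?p y \<otimes>\<^bsub>?Q\<^esub> ?p x)"
    using xy(1,2) by (simp only: p.hom_mult[symmetric] m_closed inv_closed)
  also have "\<dots> = ?p y \<otimes>\<^bsub>?Q\<^esub> ?p x"
    unfolding e using xy(1,2) by (intro Q.l_one Q.m_closed p.hom_closed)
  finally show "X \<otimes>\<^bsub>?Q\<^esub> Y = Y \<otimes>\<^bsub>?Q\<^esub> X" unfolding xy(3,4) .
qed

definition hom_int :: "('a \<Rightarrow> int) \<Rightarrow> bool" where
  "hom_int f \<longleftrightarrow> (\<forall>x\<in>carrier G. \<forall>y\<in>carrier G. f (x \<otimes> y) = f x + f y)"

lemma list_prod_pow_prod: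
  assumes "set ts \<subseteq> carrier G"
  shows "n \<le> length ts \<Longrightarrow> (\<And>i. i < n \<Longrightarrow> x i > 0) \<Longrightarrow>
    \<exists>ws. set ws = set (take n ts) \<and> list_prod G ws = pow_prod G ((!) ts) x n"
proof (induction n)
  case (Suc n)
  then obtain ws where ws: "set ws = set (take n ts)" "list_prod G ws = pow_prod G ((!) ts) x n" by auto
  have t: "ts ! n \<in> carrier G" using assms Suc.prems by auto
  have wc: "set ws \<subseteq> carrier G" using ws(1) assms set_take_subset by fast
  let ?k = "nat (x n)"
  have k: "?k > 0" "int ?k = x n" using Suc.prems(2)[of n] by auto
  have "set (ws @ replicate ?k (ts ! n)) = set (take (Suc n) ts)"
    using ws(1) k(1) Suc.prems(1) by (simp add: take_Suc_conv_app_nth)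
  moreover have "list_prod G (ws @ replicate ?k (ts ! n)) = pow_prod G ((!) ts) x (Suc n)"
    using t wc ws(2) list_prod_append[of ws "replicate ?k (ts ! n)"] k int_pow_int[of G "ts ! n" ?k]
    by (simp add: list_prod_replicate set_replicate_conv_if)
  ultimately show ?case by blast
qed simp

lemma (in group_hom) pow_prod_hom:
  "(\<And>i. i < n \<Longrightarrow> a i \<in> carrier G) \<Longrightarrow> h (pow_prod G a v n) = pow_prod H (\<lambda>i. h (a i)) v n"
  by (induction n) (simp_all add: hom_int_pow)

lemma pow_prod_cong: "(\<And>i. i < n \<Longrightarrow> a i = b i) \<Longrightarrow> pow_prod G a v n = pow_prod G b v n"
  by (induction n) simp_all

text \<open>Stiemke's lemma is applied to the lattice of relations among \<open>ts\<close>, the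
  inverse of \<open>g\<close> and the generators. A positive relation expresses a power of
  \<open>g\<close> through all of \<open>ts\<close>; a functional vanishing on every relation is a
  homomorphism.\<close>

theorem positive_power_or_hom:
  assumes X: "finite X" "X \<subseteq> carrier G" "generate G X = carrier G"
    and T: "set ts \<subseteq> carrier G" and g: "g \<in> carrier G"
  shows "(\<exists>k>0::nat. \<exists>n\<in>lower_central G 1. \<exists>ws. set ws = set ts \<and> g [^] k = n \<otimes> list_prod G ws) \<or>
    (\<exists>\<phi>. hom_int \<phi> \<and> (\<forall>t\<in>set ts. \<phi> t \<ge> 0) \<and> (\<exists>g\<in>carrier G. \<phi> g \<noteq> 0))"
proof -
  define D where "D = lower_central G 1"
  let ?Q = "G Mod D"
  interpret D: normal D G unfolding D_def by (rule lower_central_normal)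
  interpret Q: comm_group ?Q by (rule abelianization[OF D_def])
  let ?p = "\<lambda>x. D #> x"
  interpret p: group_hom G ?Q ?p by unfold_locales (rule D.r_coset_hom_Mod)
  obtain xs where xs: "set xs = X" using X(1) finite_list by blast
  \<comment> \<open>The entries whose coefficients must be positive come first: \<open>ts\<close>
    and the inverse of \<open>g\<close>, whose coefficient becomes the exponent \<open>k\<close>.
    The generators \<open>xs\<close> fill the unconstrained coordinates.\<close>
  define fs where "fs = ts @ [inv g] @ xs"
  define m where "m = Suc (length ts)"
  define N where "N = m + length xs"
  have fs: "set fs \<subseteq> carrier G" "length fs = N" using T g xs X by (auto simp: fs_def N_def m_def)
  define a where "a i = ?p (fs ! i)" for i
  have fc: "fs ! i \<in> carrier G" if "i < N" for i using fs that by (metis nth_mem subsetD)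
  have ac: "a i \<in> carrier ?Q" if "i < N" for i unfolding a_def using fc that p.hom_closed by blast
  define E where "E v = pow_prod ?Q a v N" for v
  have Ec: "E v \<in> carrier ?Q" for v unfolding E_def using ac by simp
  have Ediff: "E (\<lambda>i. v i - w i) = E v \<otimes>\<^bsub>?Q\<^esub> inv\<^bsub>?Q\<^esub> E w"
    and Eadd: "E (\<lambda>i. v i + w i) = E v \<otimes>\<^bsub>?Q\<^esub> E w"
    and Eneg: "E (\<lambda>i. - w i) = inv\<^bsub>?Q\<^esub> E w" for v w
    unfolding E_def by (rule Q.pow_prod_diff Q.pow_prod_add Q.pow_prod_neg, use ac in blast)+
  define L where "L = {v. E v = \<one>\<^bsub>?Q\<^esub>}"
  have L: "int_lattice L"
    unfolding int_lattice_def L_def using Ediff Q.pow_prod_zero[of N "\<lambda>_. 0" a]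
    by (simp add: E_def del: one_FactGroup mult_FactGroup)
  from stiemke_int_free[OF L, of m "length xs"] show ?thesis
  proof
    assume "\<exists>x\<in>L. (\<forall>i<m. 0 < x i) \<and> (\<forall>i. m \<le> i \<and> i < m + length xs \<longrightarrow> x i = 0)"
    then obtain x where x: "E x = \<one>\<^bsub>?Q\<^esub>" "\<And>i. i < m \<Longrightarrow> 0 < x i" "\<And>i. m \<le> i \<Longrightarrow> i < N \<Longrightarrow> x i = 0"
      unfolding L_def N_def by blast
    obtain ws where ws: "set ws = set ts" "list_prod G ws = pow_prod G ((!) ts) x (length ts)"
      using list_prod_pow_prod[OF T, of "length ts" x] x(2) by (auto simp: m_def)
    have wc: "list_prod G ws \<in> carrier G" using ws(1) T by simp
    define k where "k = nat (x (length ts))"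
    have k: "k > 0" "x (length ts) = int k" using x(2)[of "length ts"] by (simp_all add: k_def m_def)
    have "pow_prod ?Q a x (length ts) = pow_prod ?Q (\<lambda>i. ?p (ts ! i)) x (length ts)"
      by (rule Q.pow_prod_cong) (simp add: a_def fs_def nth_append)
    also have "\<dots> = ?p (list_prod G ws)" unfolding ws(2) using T by (intro p.pow_prod_hom[symmetric]) auto
    finally have 1: "pow_prod ?Q a x (length ts) = ?p (list_prod G ws)" .
    have "a (length ts) = ?p (inv g)" by (simp add: a_def fs_def)
    moreover have "E x = pow_prod ?Q a x m" unfolding E_def N_def
      using ac x(3) by (intro Q.pow_prod_add_zero) (simp_all add: N_def)
    ultimately have "\<one>\<^bsub>?Q\<^esub> = ?p (list_prod G ws) \<otimes>\<^bsub>?Q\<^esub> ?p (inv g) [^]\<^bsub>?Q\<^esub> int k"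
      unfolding x(1) m_def using 1 k(2) by simp
    also have "?p (inv g) [^]\<^bsub>?Q\<^esub> int k = ?p (inv (g [^] k))"
      using g by (simp only: int_pow_int p.hom_nat_pow[symmetric] inv_closed nat_pow_inv)
    also have "?p (list_prod G ws) \<otimes>\<^bsub>?Q\<^esub> ?p (inv (g [^] k)) = ?p (list_prod G ws \<otimes> inv (g [^] k))"
      using wc g by (simp only: p.hom_mult nat_pow_closed inv_closed)
    finally have "D #> (list_prod G ws \<otimes> inv (g [^] k)) = D" by simp
    then have d: "list_prod G ws \<otimes> inv (g [^] k) \<in> D"
      using rcos_self[of "list_prod G ws \<otimes> inv (g [^] k)" D] wc g D.subgroup_axioms by simp
    have "g [^] k = inv (list_prod G ws \<otimes> inv (g [^] k)) \<otimes> list_prod G ws"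
      using wc g by (simp add: inv_mult_group m_assoc)
    then show ?thesis using D.m_inv_closed[OF d] ws(1) k(1) unfolding D_def by blast
  next
    assume "\<exists>y. (\<forall>i<m. 0 \<le> y i) \<and> (\<exists>i<m. 0 < y i) \<and> (\<forall>x\<in>L. int_dot (m + length xs) y x = 0)"
    then obtain y i0 where y: "\<And>i. i < m \<Longrightarrow> 0 \<le> y i" "i0 < m" "0 < y i0" "\<And>x. x \<in> L \<Longrightarrow> int_dot N y x = 0"
      unfolding N_def by blast
    have unit: "E (\<lambda>j. if j = i then 1 else 0) = a i" if "i < N" for i
      unfolding E_def using that ac by (rule Q.pow_prod_unit)
    have ex: "\<exists>v. E v = ?p h" if "h \<in> carrier G" for h
    proof -
      have "h \<in> generate G X" using that X by simp
      then show ?thesis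
      proof (induction rule: generate.induct)
        case one
        have "E (\<lambda>_. 0) = ?p \<one>" unfolding p.hom_one E_def by (rule Q.pow_prod_zero) simp
        then show ?case by blast
      next
        case (incl x)
        then obtain j where j: "j < length xs" "x = xs ! j" using xs by (metis in_set_conv_nth)
        have "m + j < N" "fs ! (m + j) = x" using j by (simp_all add: N_def m_def fs_def nth_append)
        then show ?case using unit a_def by metis
      next
        case (inv x)
        then obtain j where j: "j < length xs" "x = xs ! j" using xs by (metis in_set_conv_nth)
        have mj: "m + j < N" "fs ! (m + j) = x" using j by (simp_all add: N_def m_def fs_def nth_append)
        have "E (\<lambda>i. - (if i = m + j then 1 else 0)) = inv\<^bsub>?Q\<^esub> (?p x)"
          unfolding Eneg using unit[OF mj(1)] mj(2) by (simp add: a_def)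
        also have "\<dots> = ?p (inv x)" using inv X(2) by (intro p.hom_inv[symmetric]) blast
        finally show ?case by blast
      next
        case (eng h1 h2)
        then obtain v w where "E v = ?p h1" "E w = ?p h2" by blast
        moreover have "h1 \<in> carrier G" "h2 \<in> carrier G" using eng X(3) by auto
        ultimately have "E (\<lambda>i. v i + w i) = ?p (h1 \<otimes> h2)" unfolding Eadd by (simp only: p.hom_mult)
        then show ?case by blast
      qed
    qed
    \<comment> \<open>Any exponent vector for \<open>h\<close> will do: two of them differ by a
      relation, on which \<open>y\<close> vanishes.\<close>
    define \<phi> where "\<phi> h = int_dot N y (SOME v. E v = ?p h)" for h
    have \<phi>: "\<phi> h = int_dot N y v" if "E v = ?p h" for h v
    proof -
      let ?w = "SOME v. E v = ?p h"
      have w: "E ?w = ?p h" using someI[of "\<lambda>v. E v = ?p h", OF that] .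
      have "(\<lambda>i. v i - ?w i) \<in> L" unfolding L_def using w that Ec[of v] by (simp add: Ediff del: one_FactGroup mult_FactGroup)
      from y(4)[OF this] show ?thesis by (simp add: \<phi>_def int_dot_diff)
    qed
    have hom: "hom_int \<phi>" unfolding hom_int_def
    proof (intro ballI)
      fix h1 h2 assume h: "h1 \<in> carrier G" "h2 \<in> carrier G"
      obtain v w where vw: "E v = ?p h1" "E w = ?p h2" using ex h by metis
      have "E (\<lambda>i. v i + w i) = ?p (h1 \<otimes> h2)" unfolding Eadd vw using h by (simp only: p.hom_mult)
      then show "\<phi> (h1 \<otimes> h2) = \<phi> h1 + \<phi> h2" using \<phi>[OF vw(1)] \<phi>[OF vw(2)] by (simp add: \<phi> int_dot_add)
    qed
    have dot_unit: "int_dot N y (\<lambda>j. if j = i then 1 else 0) = y i" if "i < N" for i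
      using that by (simp add: int_dot_def if_distrib sum.delta cong: if_cong)
    have \<phi>i: "\<phi> (fs ! i) = y i" if "i < N" for i
      using \<phi>[of "\<lambda>j. if j = i then 1 else 0" "fs ! i"] unit[OF that] dot_unit[OF that] by (simp add: a_def)
    have mN: "m \<le> N" by (simp add: N_def)
    have "\<phi> t \<ge> 0" if t: "t \<in> set ts" for t
    proof -
      obtain i where i: "i < length ts" "t = ts ! i" using t by (metis in_set_conv_nth)
      then have "i < m" "fs ! i = t" by (simp_all add: m_def fs_def nth_append)
      then show ?thesis using \<phi>i[of i] y(1)[of i] mN by simp
    qed
    moreover have "\<phi> (fs ! i0) \<noteq> 0" "fs ! i0 \<in> carrier G" using \<phi>i[of i0] fc[of i0] y(2,3) mN by simp_all
    ultimately show ?thesis using hom by blast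
  qed
qed

text \<open>The products that use every element of \<open>ts\<close> form a subsemigroup, which is
  saturated if no such homomorphism exists. It is enough to use saturation at the identity, since
  the powers of the identity are trivial.\<close>

theorem identity_or_hom:
  assumes X: "finite X" "X \<subseteq> carrier G" "generate G X = carrier G" and nil: "lower_central G c = {\<one>}"
    and T: "set ts \<subseteq> carrier G"
  shows "(\<exists>ws. set ws = set ts \<and> list_prod G ws = \<one>) \<or>
    (\<exists>\<phi>. hom_int \<phi> \<and> (\<forall>t\<in>set ts. \<phi> t \<ge> 0) \<and> (\<exists>g\<in>carrier G. \<phi> g \<noteq> 0))"
proof (rule disjCI)
  assume no: "\<not> (\<exists>\<phi>. hom_int \<phi> \<and> (\<forall>t\<in>set ts. \<phi> t \<ge> 0) \<and> (\<exists>g\<in>carrier G. \<phi> g \<noteq> 0))"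
  define M where "M = list_prod G ` {ws. set ws = set ts}"
  have "\<exists>k>0::nat. \<one> [^] k \<in> M"
  proof (rule saturation[OF X nil])
    show "M \<subseteq> carrier G" using T list_prod_closed by (auto simp: M_def)
    fix m m' assume "m \<in> M" "m' \<in> M"
    then obtain v w where "m = list_prod G v" "m' = list_prod G w" "set v = set ts" "set w = set ts"
      unfolding M_def by blast
    then show "m \<otimes> m' \<in> M" unfolding M_def using T
      by (intro image_eqI[of _ _ "v @ w"]) (simp_all add: list_prod_append)
  next
    fix g assume "g \<in> carrier G"
    from positive_power_or_hom[OF X T this] no
    show "\<exists>k>0::nat. \<exists>n\<in>lower_central G 1. \<exists>m\<in>M. g [^] k = n \<otimes> m" unfolding M_def by blast
  qed simp
  then show "\<exists>ws. set ws = set ts \<and> list_prod G ws = \<one>" unfolding M_def by auto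
qed

end

subsection \<open>Polycyclic groups\<close>

context group
begin

text \<open>Normality of \<open>N\<close> is asked only inside \<open>L\<close>, so that the notion
  survives intersection with a subgroup of \<open>L\<close>.\<close>

definition cyclic_ext :: "'a set \<Rightarrow> 'a set \<Rightarrow> 'a \<Rightarrow> bool" where
  "cyclic_ext N L y \<longleftrightarrow> subgroup L G \<and> y \<in> L \<and> (\<forall>l\<in>L. \<forall>n\<in>N. l \<otimes> n \<otimes> inv l \<in> N) \<and>
     L = {n \<otimes> y [^] (i::int) | n i. n \<in> N}"

text \<open>Here \<open>m\<close> bounds the Hirsch length of \<open>L\<close>, which drops on passing to the kernel of a nonzero
  homomorphism to the integers.\<close>

inductive poly_cyclic :: "nat \<Rightarrow> 'a set \<Rightarrow> bool" where
  trivial: "poly_cyclic 0 {\<one>}"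
| finite: "poly_cyclic m N \<Longrightarrow> cyclic_ext N L y \<Longrightarrow> i > 0 \<Longrightarrow> y [^] (i::nat) \<in> N \<Longrightarrow> poly_cyclic m L"
| infinite: "poly_cyclic m N \<Longrightarrow> cyclic_ext N L y \<Longrightarrow> poly_cyclic (Suc m) L"

lemma poly_cyclic_subgroup: "poly_cyclic m L \<Longrightarrow> subgroup L G"
  by (induction rule: poly_cyclic.induct) (auto simp: cyclic_ext_def triv_subgroup)

lemma cyclic_ext_trivial:
  assumes K: "subgroup K G" shows "cyclic_ext K K \<one>"
proof -
  note Kc = subgroup.mem_carrier[OF K]
  have "{n \<otimes> \<one> [^] (i::int) | n i. n \<in> K} = {n |n. n \<in> K}"
    using Kc by (intro Collect_cong) (metis int_pow_one r_one)
  moreover have "l \<otimes> n \<otimes> inv l \<in> K" if "l \<in> K" "n \<in> K" for l n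
    using that by (intro subgroup.m_closed[OF K] subgroup.m_inv_closed[OF K])
  ultimately show ?thesis using K subgroup.one_closed[OF K] unfolding cyclic_ext_def by simp
qed

text \<open>\<open>x\<close> is an element of \<open>K\<close> with least positive exponent of
  \<open>y\<close>, and division with remainder does the rest. The clause on powers keeps a finite
  factor finite, so the bound on the Hirsch length does not grow.\<close>

lemma cyclic_ext_subgroup:
  assumes N: "subgroup N G" and L: "cyclic_ext N L y" and K: "subgroup K G" "K \<subseteq> L"
  shows "\<exists>x. cyclic_ext (K \<inter> N) K x \<and> (\<forall>i::nat. y [^] i \<in> N \<longrightarrow> x [^] i \<in> K \<inter> N)"
proof -
  have Ls: "subgroup L G" and yL: "y \<in> L" and conj: "\<And>l n. l \<in> L \<Longrightarrow> n \<in> N \<Longrightarrow> l \<otimes> n \<otimes> inv l \<in> N"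
    and Leq: "\<And>g. g \<in> L \<Longrightarrow> \<exists>n\<in>N. \<exists>i::int. g = n \<otimes> y [^] i"
    using L unfolding cyclic_ext_def by blast+
  have yc: "y \<in> carrier G" using subgroup.mem_carrier[OF Ls yL] .
  have yiL: "y [^] (i::int) \<in> L" for i using subgroup_int_pow_closed[OF Ls yL] .
  note Nc = subgroup.mem_carrier[OF N] and Kc = subgroup.mem_carrier[OF K(1)]
  \<comment> \<open>A relation and not a function: the exponent is not unique if some nontrivial
    power of \<open>y\<close> lies in \<open>N\<close>.\<close>
  define E where "E g i \<longleftrightarrow> (\<exists>n\<in>N. g = n \<otimes> y [^] (i::int))" for g i
  have E_mult: "E (g \<otimes> h) (i + j)" if gh: "E g i" "E h j" for g h i j
  proof -
    obtain n m where n: "n \<in> N" "g = n \<otimes> y [^] i" and m: "m \<in> N" "h = m \<otimes> y [^] j"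
      using gh unfolding E_def by blast
    have "g \<otimes> h = (n \<otimes> (y [^] i \<otimes> m \<otimes> inv (y [^] i))) \<otimes> (y [^] i \<otimes> y [^] j)"
      using n m Nc yc by (simp add: m_assoc)
    moreover have "n \<otimes> (y [^] i \<otimes> m \<otimes> inv (y [^] i)) \<in> N"
      using subgroup.m_closed[OF N n(1) conj[OF yiL m(1)]] .
    ultimately show ?thesis unfolding E_def int_pow_mult[OF yc] by blast
  qed
  have E_inv: "E (inv g) (- i)" if Eg: "E g i" for g i
  proof -
    obtain n where n: "n \<in> N" "g = n \<otimes> y [^] i" using Eg unfolding E_def by blast
    have "inv g = (y [^] (- i) \<otimes> inv n \<otimes> inv (y [^] (- i))) \<otimes> y [^] (- i)"
      using n Nc yc by (simp add: inv_mult_group m_assoc int_pow_neg)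
    moreover have "y [^] (- i) \<otimes> inv n \<otimes> inv (y [^] (- i)) \<in> N"
      by (rule conj[OF yiL subgroup.m_inv_closed[OF N n(1)]])
    ultimately show ?thesis unfolding E_def by blast
  qed
  have E_nat: "E (g [^] (n::nat)) (i * int n)" if "E g i" for g i n
  proof (induction n)
    case 0
    show ?case unfolding E_def using subgroup.one_closed[OF N] by (intro bexI[of _ \<one>]) simp_all
  next
    case (Suc n)
    from E_mult[OF this that] show ?case by (simp add: algebra_simps)
  qed
  have E_pow: "E (g [^] (j::int)) (i * j)" if "E g i" "g \<in> carrier G" for g i j
  proof (cases j)
    case (nonneg n) then show ?thesis using E_nat[OF that(1), of n] by (simp only: int_pow_int)
  next
    case (neg n)
    then show ?thesis using E_inv[OF E_nat[OF that(1), of "Suc n"]] that(2)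
      by (simp only: int_pow_neg_int mult_minus_right)
  qed
  have E0: "E g 0 \<longleftrightarrow> g \<in> N" if "g \<in> carrier G" for g
    using that Nc unfolding E_def by auto
  have normal: "\<forall>l\<in>K. \<forall>n\<in>K \<inter> N. l \<otimes> n \<otimes> inv l \<in> K \<inter> N"
    using conj K by (auto intro: subgroup.m_closed subgroup.m_inv_closed)
  show ?thesis
  proof (cases "\<exists>g\<in>K. \<exists>i. E g i \<and> i \<noteq> 0")
    case False
    have "g \<in> N" if "g \<in> K" for g
    proof -
      obtain i where "E g i" using Leq K(2) \<open>g \<in> K\<close> unfolding E_def by blast
      with False that have "E g 0" by blast
      then show ?thesis using E0 Kc that by blast
    qed
    then have KN: "K \<inter> N = K" by blast
    have "cyclic_ext (K \<inter> N) K \<one>" unfolding KN by (rule cyclic_ext_trivial[OF K(1)])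
    moreover have "\<one> [^] i \<in> K \<inter> N" for i :: nat
      unfolding KN nat_pow_one by (rule subgroup.one_closed[OF K(1)])
    ultimately show ?thesis by blast
  next
    case True
    then obtain g0 i0 where g0: "g0 \<in> K" "E g0 i0" "i0 \<noteq> 0" by blast
    define P where "P d \<longleftrightarrow> d > 0 \<and> (\<exists>g\<in>K. E g (int d))" for d
    have "\<exists>d. P d"
    proof (cases "i0 > 0")
      case True
      then show ?thesis unfolding P_def using g0 by (intro exI[of _ "nat i0"]) auto
    next
      case False
      then show ?thesis unfolding P_def using g0 E_inv[OF g0(2)] subgroup.m_inv_closed[OF K(1) g0(1)]
        by (intro exI[of _ "nat (- i0)"]) auto
    qed
    define d where "d = (LEAST d. P d)"
    have Pd: "P d" unfolding d_def using \<open>\<exists>d. P d\<close> by (rule LeastI_ex)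
    have dmin: "d \<le> d'" if "P d'" for d' unfolding d_def using that by (rule Least_le)
    obtain x where x: "x \<in> K" "E x (int d)" "d > 0" using Pd unfolding P_def by blast
    have xc: "x \<in> carrier G" using x Kc by blast
    note xi = subgroup_int_pow_closed[OF K(1) x(1)]
    have "K = {n \<otimes> x [^] (i::int) | n i. n \<in> K \<inter> N}"
    proof
      show "K \<subseteq> {n \<otimes> x [^] (i::int) | n i. n \<in> K \<inter> N}"
      proof
        fix k assume k: "k \<in> K"
        obtain i where i: "E k i" using Leq K(2) \<open>k \<in> K\<close> unfolding E_def by blast
        define q where "q = i div int d"
        have "E (k \<otimes> x [^] (- q)) (i + int d * (- q))" by (rule E_mult[OF i E_pow[OF x(2) xc]])
        moreover have "i + int d * (- q) = i mod int d" by (simp add: q_def minus_mult_div_eq_mod)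
        ultimately have E: "E (k \<otimes> x [^] (- q)) (i mod int d)" by simp
        have kx: "k \<otimes> x [^] (- q) \<in> K" using subgroup.m_closed[OF K(1) k xi[of "- q"]] .
        have "i mod int d = 0"
        proof (rule ccontr)
          assume "i mod int d \<noteq> 0"
          moreover have "i mod int d \<ge> 0" "i mod int d < int d" using x(3) by simp_all
          ultimately have r: "i mod int d > 0" "i mod int d < int d" by linarith+
          then have "P (nat (i mod int d))" unfolding P_def using E kx by auto
          from dmin[OF this] r show False by simp
        qed
        then have "k \<otimes> x [^] (- q) \<in> K \<inter> N" using E E0 kx Kc by auto
        moreover have "k = (k \<otimes> x [^] (- q)) \<otimes> x [^] q"
          using xc Kc[OF k] by (simp add: m_assoc int_pow_neg)
        ultimately show "k \<in> {n \<otimes> x [^] (i::int) | n i. n \<in> K \<inter> N}" by blast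
      qed
      show "{n \<otimes> x [^] (i::int) | n i. n \<in> K \<inter> N} \<subseteq> K" using subgroup.m_closed[OF K(1) _ xi] by blast
    qed
    then have c: "cyclic_ext (K \<inter> N) K x" using K(1) normal x(1) unfolding cyclic_ext_def by blast
    have "x [^] i \<in> K \<inter> N" if "y [^] (i::nat) \<in> N" for i
    proof -
      have xiK: "x [^] i \<in> K" using xi[of "int i"] by (simp add: int_pow_int)
      obtain n where n: "n \<in> N" "x [^] i = n \<otimes> y [^] (int d * int i)" using E_nat[OF x(2), of i] unfolding E_def by blast
      have "y [^] (int d * int i) = (y [^] i) [^] d"
        using int_pow_pow[OF yc, of "int i" "int d"] by (simp only: int_pow_int mult.commute)
      moreover have "(y [^] i) [^] d \<in> N" using subgroup_int_pow_closed[OF N that, of "int d"] by (simp add: int_pow_int)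
      ultimately show ?thesis using n xiK subgroup.m_closed[OF N n(1)] by simp
    qed
    with c show ?thesis by blast
  qed
qed

lemma additive_facts:
  fixes \<phi> :: "'a \<Rightarrow> int"
  assumes L: "subgroup L G" and add: "\<forall>x\<in>L. \<forall>y\<in>L. \<phi> (x \<otimes> y) = \<phi> x + \<phi> y"
  shows "\<phi> \<one> = 0" "\<And>x. x \<in> L \<Longrightarrow> \<phi> (inv x) = - \<phi> x"
    "\<And>x i. x \<in> L \<Longrightarrow> \<phi> (x [^] (i::int)) = i * \<phi> x" "subgroup {k\<in>L. \<phi> k = 0} G"
proof -
  note Lc = subgroup.mem_carrier[OF L]
  have \<phi>: "\<phi> (x \<otimes> y) = \<phi> x + \<phi> y" if "x \<in> L" "y \<in> L" for x y using add that by blast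
  show one: "\<phi> \<one> = 0" using \<phi>[of \<one> \<one>] subgroup.one_closed[OF L] by simp
  show inv: "\<phi> (inv x) = - \<phi> x" if "x \<in> L" for x
    using \<phi>[OF that subgroup.m_inv_closed[OF L that]] one Lc[OF that] by simp
  have nat: "\<phi> (x [^] (n::nat)) = int n * \<phi> x \<and> x [^] n \<in> L" if "x \<in> L" for x n
    by (induction n) (use that one \<phi> L in \<open>auto simp: algebra_simps subgroup.one_closed subgroup.m_closed\<close>)
  show "\<phi> (x [^] (i::int)) = i * \<phi> x" if "x \<in> L" for x i
  proof (cases i)
    case (nonneg n) then show ?thesis using nat[OF that, of n] by (simp add: int_pow_int)
  next
    case (neg n)
    then show ?thesis using nat[OF that, of "Suc n"] inv Lc[OF that] by (simp only: int_pow_neg_int mult_minus_left)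
  qed
  show "subgroup {k\<in>L. \<phi> k = 0} G"
  proof
    show "{k\<in>L. \<phi> k = 0} \<subseteq> carrier G" using Lc by blast
  qed (use one inv \<phi> L in \<open>auto simp: subgroup.one_closed subgroup.m_closed subgroup.m_inv_closed\<close>)
qed

lemma cyclic_extD:
  assumes "cyclic_ext N L y" "subgroup N G"
  shows "subgroup L G" "y \<in> L" "N \<subseteq> L" "\<And>g. g \<in> L \<Longrightarrow> \<exists>n\<in>N. \<exists>i::int. g = n \<otimes> y [^] i"
proof -
  show L: "subgroup L G" "y \<in> L" "\<And>g. g \<in> L \<Longrightarrow> \<exists>n\<in>N. \<exists>i::int. g = n \<otimes> y [^] i"
    using assms(1) unfolding cyclic_ext_def by blast+
  show "N \<subseteq> L"
  proof
    fix n assume n: "n \<in> N"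
    have "n \<otimes> y [^] (0::int) \<in> L" using n assms(1) unfolding cyclic_ext_def by blast
    then show "n \<in> L" using subgroup.mem_carrier[OF assms(2) n] by simp
  qed
qed

text \<open>If \<open>\<phi>\<close> is nonzero somewhere on \<open>N\<close>, the induction
  hypothesis treats the kernel in \<open>N\<close>, and \<open>cyclic_ext_subgroup\<close> rebuilds
  the whole kernel with a factor of the same kind. Otherwise the kernel is \<open>N\<close> itself,
  which saves an infinite factor; over a finite factor this case cannot arise, because
  \<open>\<phi>\<close> would vanish on \<open>y\<close> too.\<close>

lemma poly_cyclic_kernel:
  fixes \<phi> :: "'a \<Rightarrow> int"
  shows "poly_cyclic m L \<Longrightarrow> (\<forall>x\<in>L. \<forall>y\<in>L. \<phi> (x \<otimes> y) = \<phi> x + \<phi> y) \<Longrightarrow> g \<in> L \<Longrightarrow> \<phi> g \<noteq> 0 \<Longrightarrow>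
    \<exists>m'<m. poly_cyclic m' {k\<in>L. \<phi> k = 0}"
proof (induction arbitrary: g rule: poly_cyclic.induct)
  case trivial
  show ?case using additive_facts(1)[OF triv_subgroup trivial.prems(1)] trivial.prems(2,3) by simp
next
  case (finite m N L y i)
  have N: "subgroup N G" using poly_cyclic_subgroup[OF finite.hyps(1)] .
  note L = cyclic_extD[OF finite.hyps(2) N]
  note add = additive_facts[OF L(1) finite.prems(1)]
  let ?K = "{k\<in>L. \<phi> k = 0}"
  have "\<exists>g\<in>N. \<phi> g \<noteq> 0"
  proof (rule ccontr)
    assume "\<not> ?thesis"
    then have z: "\<phi> n = 0" if "n \<in> N" for n using that by blast
    have "\<phi> (y [^] int i) = 0" using z[OF finite.hyps(4)] by (simp add: int_pow_int)
    then have y: "\<phi> y = 0" using add(3)[OF L(2), of "int i"] finite.hyps(3) by simp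
    obtain n j where n: "n \<in> N" "g = n \<otimes> y [^] (j::int)" using L(4)[OF finite.prems(2)] by blast
    have "\<phi> g = \<phi> n + \<phi> (y [^] j)" unfolding n(2)
      using bspec[OF bspec[OF finite.prems(1), of n], of "y [^] j"] n(1) L(3)
        subgroup_int_pow_closed[OF L(1,2), of j] by blast
    then show False using z[OF n(1)] add(3)[OF L(2), of j] y finite.prems(3) by simp
  qed
  then obtain h where h: "h \<in> N" "\<phi> h \<noteq> 0" by blast
  have KN: "?K \<inter> N = {k\<in>N. \<phi> k = 0}" using L(3) by blast
  have "\<exists>m'<m. poly_cyclic m' (?K \<inter> N)" unfolding KN
    using finite.prems(1) L(3) by (intro finite.IH[OF _ h]) blast
  then obtain m' where m': "m' < m" "poly_cyclic m' (?K \<inter> N)" by blast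
  obtain x where x: "cyclic_ext (?K \<inter> N) ?K x" "\<forall>i::nat. y [^] i \<in> N \<longrightarrow> x [^] i \<in> ?K \<inter> N"
    using cyclic_ext_subgroup[OF N finite.hyps(2) add(4)] by blast
  have "poly_cyclic m' ?K" using poly_cyclic.finite[OF m'(2) x(1) finite.hyps(3)] x(2) finite.hyps(4) by blast
  then show ?case using m'(1) by blast
next
  case (infinite m N L y)
  have N: "subgroup N G" using poly_cyclic_subgroup[OF infinite.hyps(1)] .
  note L = cyclic_extD[OF infinite.hyps(2) N]
  note add = additive_facts[OF L(1) infinite.prems(1)]
  let ?K = "{k\<in>L. \<phi> k = 0}"
  have \<phi>L: "\<phi> (n \<otimes> y [^] (j::int)) = \<phi> n + j * \<phi> y" if "n \<in> N" for n j
    using bspec[OF bspec[OF infinite.prems(1), of n], of "y [^] j"] that L(3)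
      subgroup_int_pow_closed[OF L(1,2), of j] add(3)[OF L(2), of j] by auto
  show ?case
  proof (cases "\<exists>g\<in>N. \<phi> g \<noteq> 0")
    case True
    then obtain h where h: "h \<in> N" "\<phi> h \<noteq> 0" by blast
    have KN: "?K \<inter> N = {k\<in>N. \<phi> k = 0}" using L(3) by blast
    have "\<exists>m'<m. poly_cyclic m' (?K \<inter> N)" unfolding KN
      using infinite.prems(1) L(3) by (intro infinite.IH[OF _ h]) blast
    then obtain m' where m': "m' < m" "poly_cyclic m' (?K \<inter> N)" by blast
    obtain x where x: "cyclic_ext (?K \<inter> N) ?K x"
      using cyclic_ext_subgroup[OF N infinite.hyps(2) add(4)] by blast
    show ?thesis using poly_cyclic.infinite[OF m'(2) x] m'(1) by auto
  next
    case False
    then have z: "\<phi> n = 0" if "n \<in> N" for n using that by blast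
    obtain n0 j0 where n0: "n0 \<in> N" "g = n0 \<otimes> y [^] (j0::int)" using L(4)[OF infinite.prems(2)] by blast
    have y: "\<phi> y \<noteq> 0" using infinite.prems(3) \<phi>L[OF n0(1), of j0] z[OF n0(1)] unfolding n0(2) by auto
    have "k \<in> N" if k: "k \<in> L" "\<phi> k = 0" for k
    proof -
      obtain n j where n: "n \<in> N" "k = n \<otimes> y [^] (j::int)" using L(4)[OF k(1)] by blast
      then have "j = 0" using k(2) \<phi>L[OF n(1)] z[OF n(1)] y by simp
      then show ?thesis using n subgroup.mem_carrier[OF N] by simp
    qed
    then have "?K = N" using L(3) z by blast
    then show ?thesis using infinite.hyps(1) by auto
  qed
qed

lemma poly_cyclic_finitely_generated:
  "poly_cyclic m L \<Longrightarrow> \<exists>X. finite X \<and> X \<subseteq> L \<and> generate G X = L"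
proof -
  have ext: "\<exists>X. finite X \<and> X \<subseteq> L \<and> generate G X = L"
    if N: "subgroup N G" "cyclic_ext N L y" and ex: "\<exists>X. finite X \<and> X \<subseteq> N \<and> generate G X = N" for N L y
  proof -
    note L = cyclic_extD[OF N(2,1)]
    obtain X where X: "finite X" "X \<subseteq> N" "generate G X = N" using ex by blast
    let ?Y = "insert y X"
    have Y: "?Y \<subseteq> L" using X(2) L(2,3) by blast
    have s: "subgroup (generate G ?Y) G"
      by (rule generate_is_subgroup) (use Y subgroup.subset[OF L(1)] in blast)
    have "L \<subseteq> generate G ?Y"
    proof
      fix g assume "g \<in> L"
      then obtain n i where n: "n \<in> N" "g = n \<otimes> y [^] (i::int)" using L(4) by blast
      have "n \<in> generate G ?Y" using n(1) X(3) mono_generate[of X ?Y] by blast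
      moreover have "y [^] i \<in> generate G ?Y"
        by (rule subgroup_int_pow_closed[OF s generate.incl]) simp
      ultimately show "g \<in> generate G ?Y" unfolding n(2) by (rule generate.eng)
    qed
    then show ?thesis using X(1) Y generate_subgroup_incl[OF Y L(1)] by (intro exI[of _ ?Y]) simp
  qed
  assume "poly_cyclic m L"
  then show ?thesis
  proof (induction rule: poly_cyclic.induct)
    case trivial
    have "generate G {} = {\<one>}" using generate_subgroup_incl[OF _ triv_subgroup, of "{}"] generate.one[of G "{}"] by auto
    then show ?case by (intro exI[of _ "{}"]) simp
  next
    case (finite m N L y i)
    show ?case by (rule ext[OF poly_cyclic_subgroup[OF finite.hyps(1)] finite.hyps(2) finite.IH])
  next
    case (infinite m N L y)
    show ?case by (rule ext[OF poly_cyclic_subgroup[OF infinite.hyps(1)] infinite.hyps(2) infinite.IH])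
  qed
qed

lemma central_chain_poly_cyclic: "central_chain C N \<Longrightarrow> \<exists>m. poly_cyclic m N"
proof (induction rule: central_chain.induct)
  case trivial
  show ?case using poly_cyclic.trivial by blast
next
  case (extend N y)
  let ?L = "{n \<otimes> y [^] (i::int) | n i. n \<in> N}"
  note N = central_chain_normal[OF extend.hyps(1)]
  have L: "subgroup ?L G" by (rule normal_imp_subgroup[OF normal_extend[OF N extend.hyps(3,4)]])
  have "\<one> \<otimes> y [^] (1::int) \<in> ?L" using subgroup.one_closed[OF normal_imp_subgroup[OF N]] by blast
  then have "y \<in> ?L" using extend.hyps(3) by simp
  moreover have "\<forall>l\<in>?L. \<forall>n\<in>N. l \<otimes> n \<otimes> inv l \<in> N"
    using N subgroup.mem_carrier[OF L] unfolding normal_inv_iff by blast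
  ultimately have "cyclic_ext N ?L y" using L unfolding cyclic_ext_def by blast
  then show ?case using extend.IH poly_cyclic.infinite by blast
qed

lemma nilpotent_poly_cyclic:
  assumes X: "finite X" "X \<subseteq> carrier G" "generate G X = carrier G" and nil: "lower_central G c = {\<one>}"
  shows "\<exists>m. poly_cyclic m (carrier G)"
  using central_chain_poly_cyclic[OF central_chain_lower_central[OF X nil, of 0 "carrier G"]] by simp

end

section \<open>Polynomial functions\<close>

text \<open>Differences are taken along left multiplication, because the translations that must be
  controlled act on the right and commute with them.\<close>

definition dif :: "('a, 'b) monoid_scheme \<Rightarrow> 'a \<Rightarrow> ('a \<Rightarrow> int) \<Rightarrow> 'a \<Rightarrow> int" where
  "dif G h f = (\<lambda>g. f (h \<otimes>\<^bsub>G\<^esub> g) - f g)"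

text \<open>On the group \<open>K\<close>, the function \<open>f\<close> is polynomial of degree less than \<open>d\<close>; values outside \<open>K\<close> are ignored.\<close>

fun pol :: "('a, 'b) monoid_scheme \<Rightarrow> 'a set \<Rightarrow> nat \<Rightarrow> ('a \<Rightarrow> int) \<Rightarrow> bool" where
  "pol G K 0 f \<longleftrightarrow> (\<forall>g\<in>K. f g = 0)"
| "pol G K (Suc d) f \<longleftrightarrow> (\<forall>h\<in>K. pol G K d (dif G h f))"

text \<open>The weighted variant: a difference along an element of the \<open>w\<close>-th term of the filtration \<open>\<Gamma>\<close>
  lowers the degree by \<open>w + 1\<close>.\<close>

fun wpol :: "('a, 'b) monoid_scheme \<Rightarrow> 'a set \<Rightarrow> (nat \<Rightarrow> 'a set) \<Rightarrow> nat \<Rightarrow> ('a \<Rightarrow> int) \<Rightarrow> bool" where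
  "wpol G K \<Gamma> 0 f \<longleftrightarrow> (\<forall>g\<in>K. f g = 0)"
| "wpol G K \<Gamma> (Suc e) f \<longleftrightarrow> (\<forall>w. \<forall>h\<in>\<Gamma> w. wpol G K \<Gamma> (e - w) (dif G h f))"

locale integer_extension = group +
  fixes \<phi> :: "'a \<Rightarrow> int" and t :: 'a and c :: nat
  assumes additive: "x \<in> carrier G \<Longrightarrow> y \<in> carrier G \<Longrightarrow> \<phi> (x \<otimes> y) = \<phi> x + \<phi> y"
    and t_closed [simp]: "t \<in> carrier G" and \<phi>_t: "\<phi> t = 1"
    and nilp: "lower_central G c = {\<one>}"
begin

definition K where "K = {g \<in> carrier G. \<phi> g = 0}"
text \<open>The lower central series of the whole group, cut down to \<open>K\<close>. It is chosen
  instead of that of \<open>K\<close> because commutators with \<open>t\<close> push it one term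
  down, which expresses that \<open>t\<close> acts unipotently.\<close>

definition \<Gamma> where "\<Gamma> w = lower_central G w \<inter> K"

abbreviation wp where "wp \<equiv> wpol G K \<Gamma>"

lemma additive_ball: "\<forall>x\<in>carrier G. \<forall>y\<in>carrier G. \<phi> (x \<otimes> y) = \<phi> x + \<phi> y"
  using additive by blast

lemmas \<phi>_facts = additive_facts[OF subgroup_self additive_ball]

lemma K_subgroup: "subgroup K G"
  unfolding K_def by (rule \<phi>_facts(4))

lemma K_carrier: "k \<in> K \<Longrightarrow> k \<in> carrier G"
  by (simp add: K_def)

lemmas K_mult = subgroup.m_closed[OF K_subgroup]

lemma \<Gamma>_K: "h \<in> \<Gamma> w \<Longrightarrow> h \<in> K"
  by (simp add: \<Gamma>_def)

lemma K_\<Gamma>: "h \<in> K \<Longrightarrow> h \<in> \<Gamma> 0"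
  by (simp add: \<Gamma>_def K_def)

lemma \<phi>_conj: "g \<in> carrier G \<Longrightarrow> h \<in> carrier G \<Longrightarrow> \<phi> (g \<otimes> h \<otimes> inv g) = \<phi> h"
  by (simp add: additive \<phi>_facts)

lemma \<Gamma>_conj:
  assumes "h \<in> \<Gamma> w" "g \<in> carrier G" shows "inv g \<otimes> h \<otimes> g \<in> \<Gamma> w"
proof -
  have h: "h \<in> carrier G" "h \<in> lower_central G w" "\<phi> h = 0" using assms(1) by (simp_all add: \<Gamma>_def K_def)
  have "inv g \<otimes> h \<otimes> inv (inv g) \<in> lower_central G w"
    using lower_central_normal[of w] h assms(2) unfolding normal_inv_iff by blast
  moreover have "\<phi> (inv g \<otimes> h \<otimes> inv (inv g)) = 0" using \<phi>_conj[of "inv g" h] h assms(2) by simp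
  ultimately show ?thesis using assms(2) h(1) by (simp add: \<Gamma>_def K_def)
qed

lemma \<Gamma>_commutator:
  assumes "h \<in> \<Gamma> w" shows "inv t \<otimes> h \<otimes> t \<otimes> inv h \<in> \<Gamma> (Suc w)"
proof -
  have h: "h \<in> carrier G" "h \<in> lower_central G w" "\<phi> h = 0" using assms by (simp_all add: \<Gamma>_def K_def)
  have "commutator h (inv t) \<in> lower_central G (Suc w)" by (rule commutator_lower_central) (use h in simp_all)
  then have "inv (commutator h (inv t)) \<in> lower_central G (Suc w)"
    by (rule subgroup.m_inv_closed[OF lower_central_subgroup])
  moreover have "inv (commutator h (inv t)) = inv t \<otimes> h \<otimes> t \<otimes> inv h"
    using h(1) by (simp add: inv_mult_group m_assoc)
  moreover have "\<phi> (inv t \<otimes> h \<otimes> t \<otimes> inv h) = 0"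
    using h by (simp add: additive \<phi>_facts)
  ultimately show ?thesis using h by (simp add: \<Gamma>_def K_def)
qed

lemma \<Gamma>_trivial:
  assumes "c \<le> w" "h \<in> \<Gamma> w" shows "h = \<one>"
proof -
  have "lower_central G w \<subseteq> {\<one>}" using assms(1)
  proof (induction w rule: dec_induct)
    case (step n)
    then show ?case using lower_central_Suc_subset[of n] by blast
  qed (simp add: nilp)
  then show ?thesis using assms(2) by (auto simp: \<Gamma>_def)
qed

lemma decompose:
  assumes "g \<in> carrier G"
  shows "t [^] (- \<phi> g) \<otimes> g \<in> K" "g = t [^] (\<phi> g) \<otimes> (t [^] (- \<phi> g) \<otimes> g)"
proof -
  show "t [^] (- \<phi> g) \<otimes> g \<in> K"
    using assms \<phi>_facts(3)[of t "- \<phi> g"] by (simp add: K_def additive \<phi>_t)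
  show "g = t [^] (\<phi> g) \<otimes> (t [^] (- \<phi> g) \<otimes> g)" using assms by (simp add: int_pow_neg)
qed

lemma wp_cong: "(\<And>g. g \<in> K \<Longrightarrow> f g = f' g) \<Longrightarrow> wp e f = wp e f'"
proof (induction e arbitrary: f f' rule: less_induct)
  case (less e)
  show ?case
  proof (cases e)
    case 0 then show ?thesis using less.prems by simp
  next
    case (Suc d)
    have "wp (d - w) (dif G h f) = wp (d - w) (dif G h f')" if "h \<in> \<Gamma> w" for h w
      using less.prems \<Gamma>_K[OF that] K_mult Suc by (intro less.IH) (simp_all add: dif_def)
    then show ?thesis using Suc by simp
  qed
qed

lemma wp_zero: "wp e (\<lambda>_. 0)"
proof (induction e rule: less_induct)
  case (less e)
  show ?case by (cases e) (simp_all add: dif_def less)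
qed

lemma wp_mono: "wp e f \<Longrightarrow> e \<le> e' \<Longrightarrow> wp e' f"
proof (induction e arbitrary: e' f rule: less_induct)
  case (less e)
  show ?case
  proof (cases e)
    case 0 then show ?thesis using less.prems wp_cong[of f "\<lambda>_. 0" e'] wp_zero by simp
  next
    case (Suc d)
    then obtain d' where d': "e' = Suc d'" "d \<le> d'" using less.prems by (cases e') auto
    have "wp (d' - w) (dif G h f)" if "h \<in> \<Gamma> w" for h w
      by (rule less.IH[of "d - w"]) (use less.prems(1) that Suc d' in auto)
    then show ?thesis using d' by simp
  qed
qed

lemma dif_add: "dif G h (\<lambda>g. f g + f' g) = (\<lambda>g. dif G h f g + dif G h f' g)"
  by (auto simp: dif_def)

lemma dif_neg: "dif G h (\<lambda>g. - f g) = (\<lambda>g. - dif G h f g)"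
  by (auto simp: dif_def)

lemma wp_add: "wp e f \<Longrightarrow> wp e f' \<Longrightarrow> wp e (\<lambda>g. f g + f' g)"
proof (induction e arbitrary: f f' rule: less_induct)
  case (less e)
  show ?case using less by (cases e) (auto simp: dif_add)
qed

lemma wp_neg: "wp e f \<Longrightarrow> wp e (\<lambda>g. - f g)"
proof (induction e arbitrary: f rule: less_induct)
  case (less e)
  show ?case using less by (cases e) (auto simp: dif_neg)
qed

text \<open>Functions on \<open>G\<close> that are polynomial along every coset \<open>t\<^sup>i K\<close>, with coefficients of decreasing degree in
  the direction of \<open>t\<close>.\<close>

fun coset_pol :: "nat \<Rightarrow> ('a \<Rightarrow> int) \<Rightarrow> bool" where
  "coset_pol 0 F \<longleftrightarrow> (\<forall>g\<in>carrier G. F g = 0)"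
| "coset_pol (Suc e) F \<longleftrightarrow> (\<forall>i::int. wp (Suc e) (\<lambda>k. F (t [^] i \<otimes> k))) \<and> coset_pol e (dif G t F)"

lemma coset_pol_cong: "(\<And>g. g \<in> carrier G \<Longrightarrow> F g = F' g) \<Longrightarrow> coset_pol e F = coset_pol e F'"
proof (induction e arbitrary: F F')
  case (Suc e)
  have "coset_pol e (dif G t F) = coset_pol e (dif G t F')" by (rule Suc.IH) (simp add: dif_def Suc.prems)
  moreover have "wp (Suc e) (\<lambda>k. F (t [^] i \<otimes> k)) = wp (Suc e) (\<lambda>k. F' (t [^] i \<otimes> k))" for i :: int
    by (rule wp_cong) (simp add: Suc.prems K_carrier)
  ultimately show ?case unfolding coset_pol.simps by simp
qed simp

lemma coset_pol_zero: "coset_pol e (\<lambda>_. 0)"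
proof (induction e)
  case (Suc e)
  then show ?case using wp_zero[of "Suc e"] by (simp add: dif_def del: wpol.simps)
qed simp

lemma coset_pol_mono: "coset_pol e F \<Longrightarrow> e \<le> e' \<Longrightarrow> coset_pol e' F"
proof (induction e arbitrary: e' F)
  case 0
  then show ?case using coset_pol_cong[of F "\<lambda>_. 0" e'] coset_pol_zero by simp
next
  case (Suc e)
  then obtain d where d: "e' = Suc d" "e \<le> d" by (cases e') auto
  then show ?case using Suc.prems(1) Suc.IH[of "dif G t F" d] wp_mono[of "Suc e" _ "Suc d"]
    by (simp del: wpol.simps)
qed

lemma coset_pol_add: "coset_pol e F \<Longrightarrow> coset_pol e F' \<Longrightarrow> coset_pol e (\<lambda>g. F g + F' g)"
  by (induction e arbitrary: F F') (simp_all add: dif_add wp_add del: wpol.simps)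

lemma coset_pol_neg: "coset_pol e F \<Longrightarrow> coset_pol e (\<lambda>g. - F g)"
  by (induction e arbitrary: F) (simp_all add: dif_neg wp_neg del: wpol.simps)

text \<open>The outer induction is on \<open>e\<close>, the inner one on \<open>c - w\<close>,
  ending where the filtration is trivial. Moving a difference along \<open>t\<close> past one along
  \<open>h\<close> costs a commutator of \<open>h\<close> with \<open>t\<close>; this lies one term
  deeper, which pays for the degree lost along \<open>t\<close>.\<close>

lemma coset_pol_dif: "h \<in> \<Gamma> w \<Longrightarrow> coset_pol e F \<Longrightarrow> coset_pol (e - Suc w) (dif G h F)"
proof (induction e arbitrary: F h w rule: less_induct)
  case (less e)
  show ?case using less.prems
  proof (induction "c - w" arbitrary: h w)
    case 0
    then have "h = \<one>" using \<Gamma>_trivial by simp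
    then show ?case using coset_pol_cong[of "dif G h F" "\<lambda>_. 0"] coset_pol_zero by (simp add: dif_def)
  next
    case (Suc n)
    have h: "h \<in> K" "h \<in> carrier G" using Suc.prems(1) \<Gamma>_K K_carrier by blast+
    show ?case
    proof (cases e)
      case 0
      then show ?thesis using Suc.prems h by (simp add: dif_def)
    next
      case (Suc e0)
      note e = this
      have wp_part: "wp (e0 - w) (\<lambda>k. dif G h F (t [^] i \<otimes> k))" for i :: int
      proof -
        let ?h = "inv (t [^] i) \<otimes> h \<otimes> t [^] i"
        have hG: "?h \<in> \<Gamma> w" using \<Gamma>_conj[OF Suc.prems(1)] by simp
        have "wp (e0 - w) (dif G ?h (\<lambda>k. F (t [^] i \<otimes> k)))"
          using Suc.prems(2) hG e by simp
        moreover have "dif G ?h (\<lambda>k. F (t [^] i \<otimes> k)) k = dif G h F (t [^] i \<otimes> k)" if "k \<in> K" for k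
          using h(2) K_carrier[OF that] by (simp add: dif_def m_assoc)
        ultimately show ?thesis using wp_cong[of "dif G ?h (\<lambda>k. F (t [^] i \<otimes> k))"] by simp
      qed
      show ?thesis
      proof (cases "e0 - w")
        case 0
        have "dif G h F g = 0" if "g \<in> carrier G" for g
        proof -
          have "dif G h F (t [^] \<phi> g \<otimes> (t [^] (- \<phi> g) \<otimes> g)) = 0"
            using wp_part[of "\<phi> g"] decompose(1)[OF that] 0 by simp
          then show ?thesis unfolding decompose(2)[OF that, symmetric] .
        qed
        then show ?thesis using e 0 by simp
      next
        case (Suc T)
        let ?h = "inv t \<otimes> h \<otimes> t" and ?c = "inv t \<otimes> h \<otimes> t \<otimes> inv h"
        have hG: "?h \<in> \<Gamma> w" using \<Gamma>_conj[OF \<open>h \<in> \<Gamma> w\<close> t_closed] .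
        have cG: "?c \<in> \<Gamma> (Suc w)" by (rule \<Gamma>_commutator[OF \<open>h \<in> \<Gamma> w\<close>])
        have Tw: "e0 - Suc w = T" using Suc by simp
        have "coset_pol (e0 - Suc w) (dif G ?h (dif G t F))"
          by (rule less.IH) (use e hG \<open>coset_pol e F\<close> in simp_all)
        then have 1: "coset_pol T (dif G ?h (dif G t F))" by (simp only: Tw)
        have "coset_pol (e - Suc (Suc w)) (dif G ?c F)"
          by (rule \<open>\<And>h w. n = c - w \<Longrightarrow> h \<in> \<Gamma> w \<Longrightarrow> coset_pol e F \<Longrightarrow> coset_pol (e - Suc w) (dif G h F)\<close>)
            (use \<open>Suc n = c - w\<close> cG \<open>coset_pol e F\<close> in simp_all)
        then have 2: "coset_pol T (dif G ?c F)" using Tw e by simp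
        have "coset_pol (T - Suc w) (dif G h (dif G ?c F))"
          by (rule less.IH[OF _ \<open>h \<in> \<Gamma> w\<close> 2]) (use Tw e in simp)
        then have 3: "coset_pol T (dif G h (dif G ?c F))" by (rule coset_pol_mono) simp
        \<comment> \<open>Since \<open>t ?h = h t\<close> and \<open>?h = ?c h\<close>, the last two
          summands together equal \<open>F (?h g) - F (h g)\<close>, the error made by commuting
          \<open>h\<close> past \<open>t\<close>.\<close>
        have eq: "dif G t (dif G h F) g = dif G ?h (dif G t F) g + (dif G ?c F g + dif G h (dif G ?c F) g)"
          if "g \<in> carrier G" for g
        proof -
          have "t \<otimes> (?h \<otimes> g) = h \<otimes> (t \<otimes> g)" "?c \<otimes> (h \<otimes> g) = ?h \<otimes> g"
            using that h(2) by (simp_all add: m_assoc)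
          then show ?thesis by (simp add: dif_def)
        qed
        have "coset_pol T (dif G t (dif G h F))"
          using coset_pol_add[OF 1 coset_pol_add[OF 2 3]] coset_pol_cong[OF eq] by simp
        then show ?thesis using wp_part e Suc by (simp del: wpol.simps)
      qed
    qed
  qed
qed

lemma t_int_pow_Suc: "x \<in> carrier G \<Longrightarrow> t [^] (i::int) \<otimes> (t \<otimes> x) = t \<otimes> (t [^] i \<otimes> x)"
  using int_pow_commute[OF t_closed t_closed HOL.refl, of i] by (simp flip: m_assoc)

lemma coset_pol_shift: "coset_pol e F \<Longrightarrow> coset_pol e (\<lambda>g. F (t [^] (i::int) \<otimes> g))"
proof (induction e arbitrary: F)
  case (Suc e)
  have "wp (Suc e) (\<lambda>k. F (t [^] i \<otimes> (t [^] j \<otimes> k)))" for j :: int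
  proof -
    have "wp (Suc e) (\<lambda>k. F (t [^] (i + j) \<otimes> k))" using Suc.prems by (simp del: wpol.simps)
    then show ?thesis by (subst wp_cong[of _ "\<lambda>k. F (t [^] (i + j) \<otimes> k)"]) (simp_all add: int_pow_mult m_assoc K_carrier)
  qed
  moreover have "coset_pol e (dif G t (\<lambda>g. F (t [^] i \<otimes> g)))"
  proof -
    have "coset_pol e (\<lambda>g. dif G t F (t [^] i \<otimes> g))" using Suc by simp
    then show ?thesis by (subst coset_pol_cong[of _ "\<lambda>g. dif G t F (t [^] i \<otimes> g)"]) (simp_all add: dif_def t_int_pow_Suc)
  qed
  ultimately show ?case by simp
qed simp

text \<open>Each \<open>g\<close> is a power of \<open>t\<close> times an element of
  \<open>K\<close>, and the difference along a product is the sum of the two differences and their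
  composite. Along \<open>t\<close> a degree is lost by the definition of \<open>coset_pol\<close>,
  along \<open>K\<close> by \<open>coset_pol_dif\<close> at weight 0.\<close>

lemma coset_pol_dif_any:
  assumes F: "coset_pol (Suc e) F" and g: "g \<in> carrier G"
  shows "coset_pol e (dif G g F)"
proof -
  have nat: "coset_pol e (dif G (t [^] (n::nat)) F)" for n
  proof (induction n)
    case 0
    show ?case using coset_pol_cong[of "dif G (t [^] (0::nat)) F" "\<lambda>_. 0" e] coset_pol_zero by (simp add: dif_def)
  next
    case (Suc n)
    have "coset_pol e (\<lambda>x. dif G (t [^] n) F (t [^] (1::int) \<otimes> x) + dif G t F x)"
      using F by (intro coset_pol_add coset_pol_shift[OF Suc]) simp
    then show ?case
      by (subst coset_pol_cong[of _ "\<lambda>x. dif G (t [^] n) F (t [^] (1::int) \<otimes> x) + dif G t F x"])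
        (simp_all add: dif_def m_assoc)
  qed
  have int: "coset_pol e (dif G (t [^] (i::int)) F)" for i
  proof (cases i)
    case (nonneg n) then show ?thesis using nat[of n] by (simp only: int_pow_int)
  next
    case (neg n)
    \<comment> \<open>The difference along an inverse is the negated difference along the element,
      translated by the inverse.\<close>
    have "coset_pol e (\<lambda>x. - dif G (t [^] (Suc n)) F (t [^] i \<otimes> x))" by (intro coset_pol_neg coset_pol_shift nat)
    moreover have "dif G (t [^] i) F x = - dif G (t [^] (Suc n)) F (t [^] i \<otimes> x)" if "x \<in> carrier G" for x
    proof -
      have "t [^] Suc n \<otimes> (t [^] i \<otimes> x) = x" unfolding neg int_pow_neg_int[OF t_closed]
        using that by (simp del: nat_pow_Suc)
      then show ?thesis by (simp add: dif_def del: nat_pow_Suc)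
    qed
    ultimately show ?thesis using coset_pol_cong[of "dif G (t [^] i) F"] by simp
  qed
  let ?k = "t [^] (- \<phi> g) \<otimes> g" and ?t = "t [^] (\<phi> g)"
  note k = decompose[OF g]
  have kQ: "coset_pol e (dif G ?k F)" using coset_pol_dif[OF K_\<Gamma>[OF k(1)] F] by simp
  have "coset_pol (e - Suc 0) (dif G ?k (dif G ?t F))" by (rule coset_pol_dif[OF K_\<Gamma>[OF k(1)] int])
  then have "coset_pol e (dif G ?k (dif G ?t F))" by (rule coset_pol_mono) simp
  from coset_pol_add[OF coset_pol_add[OF int this] kQ]
  have "coset_pol e (\<lambda>x. dif G ?t F x + dif G ?k (dif G ?t F) x + dif G ?k F x)" .
  moreover have "dif G g F x = dif G ?t F x + dif G ?k (dif G ?t F) x + dif G ?k F x" if x: "x \<in> carrier G" for x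
  proof -
    have "g \<otimes> x = ?t \<otimes> (?k \<otimes> x)" using k(2) x g by (simp add: int_pow_neg m_assoc)
    then show ?thesis by (simp add: dif_def)
  qed
  ultimately show ?thesis using coset_pol_cong[of "dif G g F"] by simp
qed

lemma coset_pol_pol: "coset_pol e F \<Longrightarrow> pol G (carrier G) e F"
  by (induction e arbitrary: F) (simp_all add: coset_pol_dif_any del: coset_pol.simps(2))

text \<open>An ordinary difference lowers the degree by 1, whereas an element of
  \<open>\<Gamma> w\<close> has to lower the weighted degree by \<open>w + 1\<close>. As
  \<open>\<Gamma> w\<close> is trivial from \<open>w = c\<close> on, scaling degrees by
  \<open>Suc c\<close> leaves enough room.\<close>

lemma wpol_of_pol: "pol G K d f \<Longrightarrow> wp (Suc c * d) f"
proof (induction d arbitrary: f)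
  case (Suc d)
  have "wp (Suc c * d + c - w) (dif G h f)" if h: "h \<in> \<Gamma> w" for h w
  proof (cases "w \<le> c")
    case True
    have "wp (Suc c * d) (dif G h f)" using Suc.IH Suc.prems \<Gamma>_K[OF h] by simp
    then show ?thesis by (rule wp_mono) (use True in simp)
  next
    case False
    then have "h = \<one>" by (intro \<Gamma>_trivial[OF _ h]) simp
    then have "dif G h f g = 0" if "g \<in> K" for g using K_carrier[OF that] by (simp add: dif_def)
    then show ?thesis using wp_cong[of "dif G h f" "\<lambda>_. 0"] wp_zero by simp
  qed
  then have "wp (Suc (Suc c * d + c)) f" by simp
  then show ?case by (simp add: algebra_simps)
qed simp

text \<open>The extended function is constant along \<open>t\<close>, so its difference in that
  direction vanishes, and on each coset of \<open>K\<close> it is a copy of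
  \<open>f\<close>.\<close>

theorem pol_extension:
  assumes "pol G K d f"
  shows "pol G (carrier G) (Suc c * d) (\<lambda>g. f (t [^] (- \<phi> g) \<otimes> g))"
proof (rule coset_pol_pol)
  let ?F = "\<lambda>g. f (t [^] (- \<phi> g) \<otimes> g)"
  have shift: "?F (t [^] i \<otimes> k) = f k" if "k \<in> K" for i :: int and k
  proof -
    have "\<phi> (t [^] i \<otimes> k) = i" using that \<phi>_facts(3)[of t i] by (simp add: additive K_def \<phi>_t)
    then show ?thesis using K_carrier[OF that] by (simp add: int_pow_neg)
  qed
  have "coset_pol e ?F" if "wp e f" for e
  proof (cases e)
    case 0
    then show ?thesis using that decompose(1) by simp
  next
    case (Suc d)
    have "wp e (\<lambda>k. ?F (t [^] i \<otimes> k))" for i :: int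
      using that wp_cong[of "\<lambda>k. ?F (t [^] i \<otimes> k)" f e] shift by simp
    moreover have "dif G t ?F g = 0" if "g \<in> carrier G" for g
    proof -
      have "t [^] (- \<phi> (t \<otimes> g)) \<otimes> (t \<otimes> g) = t [^] (- \<phi> g) \<otimes> g"
      proof -
        have "t [^] (- \<phi> (t \<otimes> g)) = t [^] (- \<phi> g) \<otimes> t [^] (-1 :: int)"
          using that by (simp add: additive \<phi>_t add.commute flip: int_pow_mult)
        then show ?thesis using that by (simp add: int_pow_neg m_assoc)
      qed
      then show ?thesis by (simp add: dif_def)
    qed
    then have "coset_pol d (dif G t ?F)" using coset_pol_cong[of "dif G t ?F" "\<lambda>_. 0" d] coset_pol_zero by simp
    ultimately show ?thesis using Suc by simp
  qed
  then show "coset_pol (Suc c * d) ?F" using wpol_of_pol[OF assms] .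
qed

end

section \<open>The separating polynomial, by descent along kernels\<close>

lemma pol_consistent: "pol (G\<lparr>carrier := A\<rparr>) K d f = pol G K d f"
  by (induction d arbitrary: f) (simp_all add: dif_def)

lemma list_prod_consistent: "list_prod (G\<lparr>carrier := A\<rparr>) ws = list_prod G ws"
  by (simp add: list_prod_def)

context group
begin

lemma lower_central_subgroup_mono:
  assumes K: "subgroup K G"
  shows "lower_central (G\<lparr>carrier := K\<rparr>) n \<subseteq> lower_central G n"
proof (induction n)
  case 0
  show ?case using subgroup.subset[OF K] by simp
next
  case (Suc n)
  let ?H = "G\<lparr>carrier := K\<rparr>"
  interpret H: group ?H by (rule subgroup_imp_group[OF K])
  let ?S = "{g \<otimes>\<^bsub>?H\<^esub> h \<otimes>\<^bsub>?H\<^esub> inv\<^bsub>?H\<^esub> g \<otimes>\<^bsub>?H\<^esub> inv\<^bsub>?H\<^esub> h | g h. g \<in> lower_central ?H n \<and> h \<in> carrier ?H}"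
  have sub: "g \<in> K" if "g \<in> lower_central ?H n" for g using H.lower_central_carrier[OF that] by simp
  have S: "?S \<subseteq> K"
  proof
    fix x assume "x \<in> ?S"
    then obtain g h where gh: "x = H.commutator g h" "g \<in> lower_central ?H n" "h \<in> carrier ?H" by blast
    then have "H.commutator g h \<in> carrier ?H" using H.lower_central_carrier by blast
    then show "x \<in> K" using gh(1) by simp
  qed
  have "?S \<subseteq> {commutator g h | g h. g \<in> lower_central G n \<and> h \<in> carrier G}"
  proof
    fix x assume "x \<in> ?S"
    then obtain g h where gh: "x = H.commutator g h" "g \<in> lower_central ?H n" "h \<in> carrier ?H" by blast
    have "x = commutator g h"
      using gh m_inv_consistent[OF K, of g] m_inv_consistent[OF K, of h] sub[OF gh(2)] by simp
    moreover have "h \<in> carrier G" using gh(3) subgroup.subset[OF K] by auto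
    ultimately show "x \<in> {commutator g h | g h. g \<in> lower_central G n \<and> h \<in> carrier G}"
      using gh(2) Suc.IH by blast
  qed
  then show ?case unfolding lower_central.simps generate_consistent[OF S K] by (rule mono_generate)
qed

definition shifts :: "'a set \<Rightarrow> ('a \<Rightarrow> int) \<Rightarrow> 'a \<Rightarrow> int \<Rightarrow> bool" where
  "shifts K f s a \<longleftrightarrow> (\<forall>g\<in>K. f (g \<otimes> s) = f g + a)"

text \<open>Stated for subgroups of one fixed group, since a homomorphism vanishing on all of
  \<open>ts\<close> moves the problem to its kernel with smaller \<open>m\<close>. The hypothesis on
  \<open>ts\<close> speaks of products only and is inherited unchanged, as is the bound
  \<open>c\<close> on the class.\<close>

lemma positive_polynomial_subgroup:
  assumes nil: "lower_central G c = {\<one>}"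
  shows "poly_cyclic m K \<Longrightarrow> set ts \<subseteq> K \<Longrightarrow> \<nexists>ws. set ws = set ts \<and> list_prod G ws = \<one> \<Longrightarrow>
    \<exists>d f. pol G K d f \<and> (\<forall>s\<in>set ts. \<exists>a\<ge>0. shifts K f s a) \<and> (\<exists>s\<in>set ts. \<exists>a>0. shifts K f s a)"
proof (induction m arbitrary: K rule: less_induct)
  case (less m)
  have K: "subgroup K G" by (rule poly_cyclic_subgroup[OF less.prems(1)])
  let ?H = "G\<lparr>carrier := K\<rparr>"
  interpret H: group ?H by (rule subgroup_imp_group[OF K])
  have nilH: "lower_central ?H c = {\<one>\<^bsub>?H\<^esub>}"
    using lower_central_subgroup_mono[OF K, of c] subgroup.one_closed[OF H.lower_central_subgroup, of c] nil by auto
  obtain X where X: "finite X" "X \<subseteq> K" "generate G X = K"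
    using poly_cyclic_finitely_generated[OF less.prems(1)] by blast
  have XH: "generate ?H X = carrier ?H" using generate_consistent[OF X(2) K] X(3) by simp
  obtain \<phi> g0 where \<phi>: "H.hom_int \<phi>" "\<forall>s\<in>set ts. \<phi> s \<ge> 0" "g0 \<in> K" "\<phi> g0 \<noteq> 0"
    using H.identity_or_hom[OF X(1) _ XH nilH, of ts] X(2) less.prems(2,3)
    by (auto simp: list_prod_consistent)
  have add: "\<forall>x\<in>K. \<forall>y\<in>K. \<phi> (x \<otimes> y) = \<phi> x + \<phi> y" using \<phi>(1) unfolding H.hom_int_def by simp
  note facts = additive_facts[OF K add]
  show ?case
  proof (cases "\<exists>s\<in>set ts. \<phi> s > 0")
    case True
    \<comment> \<open>One difference of a homomorphism is constant and the second vanishes, hence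
      degree below 2.\<close>
    have "pol G K 2 \<phi>" using add subgroup.m_closed[OF K] by (simp add: numeral_2_eq_2 dif_def)
    moreover have "shifts K \<phi> s (\<phi> s)" if "s \<in> set ts" for s
      using add that less.prems(2) unfolding shifts_def by blast
    ultimately show ?thesis using True \<phi>(2) by blast
  next
    case False
    define P where "P d \<longleftrightarrow> d > 0 \<and> (\<exists>x\<in>K. \<phi> x = int d)" for d
    have "\<exists>d. P d"
    proof (cases "\<phi> g0 > 0")
      case True
      then show ?thesis unfolding P_def using \<phi>(3) by (intro exI[of _ "nat (\<phi> g0)"]) auto
    next
      case False
      then show ?thesis unfolding P_def using \<phi>(3,4) facts(2)[OF \<phi>(3)] subgroup.m_inv_closed[OF K \<phi>(3)]
        by (intro exI[of _ "nat (- \<phi> g0)"]) auto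
    qed
    \<comment> \<open>The image of \<open>\<phi>\<close> is generated by its least positive value
      \<open>d\<close>. Dividing by \<open>d\<close> makes the homomorphism onto and gives the
      element \<open>t\<close> of value 1 that \<open>integer_extension\<close> asks for.\<close>
    define d where "d = (LEAST d. P d)"
    have Pd: "P d" unfolding d_def using \<open>\<exists>d. P d\<close> by (rule LeastI_ex)
    obtain t where t: "t \<in> K" "\<phi> t = int d" and d: "d > 0" using Pd unfolding P_def by blast
    have dvd: "int d dvd \<phi> x" if x: "x \<in> K" for x
    proof (rule ccontr)
      assume "\<not> int d dvd \<phi> x"
      then have "\<phi> x mod int d \<noteq> 0" by (simp add: dvd_eq_mod_eq_0)
      moreover have "\<phi> x mod int d \<ge> 0" "\<phi> x mod int d < int d" using d by simp_all
      ultimately have r: "\<phi> x mod int d > 0" "\<phi> x mod int d < int d" by linarith+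
      let ?q = "\<phi> x div int d"
      have tq: "t [^] (- ?q) \<in> K" by (rule subgroup_int_pow_closed[OF K t(1)])
      have "\<phi> (x \<otimes> t [^] (- ?q)) = \<phi> x + (- ?q) * int d"
        using bspec[OF bspec[OF add x] tq] facts(3)[OF t(1), of "- ?q"] t(2) by simp
      also have "\<dots> = \<phi> x mod int d" by (simp add: minus_div_mult_eq_mod)
      finally have "P (nat (\<phi> x mod int d))" unfolding P_def
        using r subgroup.m_closed[OF K x tq] by auto
      then have "d \<le> nat (\<phi> x mod int d)" unfolding d_def by (rule Least_le)
      with r show False by simp
    qed
    define \<psi> where "\<psi> x = \<phi> x div int d" for x
    have \<psi>add: "\<psi> (x \<otimes> y) = \<psi> x + \<psi> y" if "x \<in> K" "y \<in> K" for x y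
      using add that dvd[OF that(1)] by (simp add: \<psi>_def div_plus_div_distrib_dvd_left)
    have \<psi>0: "\<psi> x = 0 \<longleftrightarrow> \<phi> x = 0" if "x \<in> K" for x
      using dvd[OF that] d by (auto simp: \<psi>_def elim: dvdE)
    interpret E: integer_extension ?H \<psi> t c
      by unfold_locales (use \<psi>add t d nilH in \<open>simp_all add: \<psi>_def\<close>)
    have EK: "E.K = {k \<in> K. \<phi> k = 0}" unfolding E.K_def using \<psi>0 by auto
    obtain m' where m': "m' < m" "poly_cyclic m' E.K"
      using poly_cyclic_kernel[OF less.prems(1) add \<phi>(3,4)] unfolding EK by blast
    have tsK: "set ts \<subseteq> E.K" unfolding EK using False \<phi>(2) less.prems(2) by force
    obtain e f where f: "pol G E.K e f" "\<forall>s\<in>set ts. \<exists>a\<ge>0. shifts E.K f s a"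
       "\<exists>s\<in>set ts. \<exists>a>0. shifts E.K f s a"
      using less.IH[OF m' tsK less.prems(3)] by blast
    \<comment> \<open>Right multiplication by \<open>s\<close> in the kernel leaves
      \<open>\<psi>\<close> fixed, so \<open>F\<close> is shifted by the same constant as
      \<open>f\<close>.\<close>
    define F where "F g = f (t [^]\<^bsub>?H\<^esub> (- \<psi> g) \<otimes>\<^bsub>?H\<^esub> g)" for g
    have "pol G K (Suc c * e) F"
      using E.pol_extension[of e f] f(1) unfolding F_def by (simp add: pol_consistent)
    moreover have "shifts K F s a" if s: "s \<in> set ts" "shifts E.K f s a" for s a
      unfolding shifts_def
    proof
      fix g assume g: "g \<in> K"
      have sK: "s \<in> K" "\<psi> s = 0" using s(1) tsK \<psi>0 unfolding EK by auto
      let ?k = "t [^]\<^bsub>?H\<^esub> (- \<psi> g) \<otimes>\<^bsub>?H\<^esub> g"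
      have k: "?k \<in> E.K" using E.decompose(1)[of g] g by simp
      have "t [^]\<^bsub>?H\<^esub> (- \<psi> g) \<in> carrier ?H" by (rule H.int_pow_closed) (simp add: t(1))
      then have "t [^]\<^bsub>?H\<^esub> (- \<psi> g) \<otimes>\<^bsub>?H\<^esub> (g \<otimes>\<^bsub>?H\<^esub> s) = ?k \<otimes>\<^bsub>?H\<^esub> s"
        using g sK(1) by (intro H.m_assoc[symmetric]) simp_all
      moreover have "\<psi> (g \<otimes> s) = \<psi> g" using \<psi>add[OF g sK(1)] sK(2) by simp
      ultimately have "F (g \<otimes> s) = f (?k \<otimes> s)" by (simp add: F_def)
      also have "\<dots> = f ?k + a" using s(2) k unfolding shifts_def by blast
      finally show "F (g \<otimes> s) = F g + a" by (simp add: F_def)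
    qed
    ultimately show ?thesis using f(2,3) by (intro exI[of _ "Suc c * e"] exI[of _ F]) blast
  qed
qed

theorem positive_polynomial:
  assumes X: "finite X" "X \<subseteq> carrier G" "generate G X = carrier G" and nil: "nilpotent_group G"
    and ts: "set ts \<subseteq> carrier G" "\<nexists>ws. set ws = set ts \<and> list_prod G ws = \<one>"
  shows "\<exists>d f. pol G (carrier G) d f \<and> (\<forall>s\<in>set ts. \<exists>a\<ge>0. shifts (carrier G) f s a) \<and>
    (\<exists>s\<in>set ts. \<exists>a>0. shifts (carrier G) f s a)"
proof -
  obtain c where c: "lower_central G c = {\<one>}" using nil unfolding nilpotent_group_def by blast
  obtain m where "poly_cyclic m (carrier G)" using nilpotent_poly_cyclic[OF X c] by blast
  from positive_polynomial_subgroup[OF c this ts] show ?thesis .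
qed

end

section \<open>Certificates on words\<close>

text \<open>The sum of \<open>c (u @ w' @ v)\<close> over all scattered subwords \<open>w'\<close> of \<open>w\<close>. A polynomial function on words
  has the form \<open>\<lambda>w. spread c w [] []\<close> with finitely supported \<open>c\<close>, its Magnus coefficients.\<close>

primrec spread :: "('x list \<Rightarrow> 'n::comm_monoid_add) \<Rightarrow> 'x list \<Rightarrow> 'x list \<Rightarrow> 'x list \<Rightarrow> 'n" where
  "spread c [] u v = c (u @ v)"
| "spread c (x # w) u v = spread c w (u @ [x]) v + spread c w u v"

lemma spread_snoc: "spread c (w @ [x]) u v = spread c w u (x # v) + spread c w u v"
  by (induction w arbitrary: u) (simp_all add: ac_simps)

lemma spread_diff:
  "spread (\<lambda>u. int (p u) - int (q u)) w u v = int (spread p w u v) - int (spread q w u v)"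
  by (induction w arbitrary: u) simp_all

lemma spread_zero: "(\<And>w'. c (u @ w' @ v) = 0) \<Longrightarrow> spread c w u v = 0"
proof (induction w arbitrary: u)
  case Nil
  from Nil[of "[]"] show ?case by simp
next
  case (Cons x w)
  have "c ((u @ [x]) @ w' @ v) = 0" for w' using Cons.prems[of "x # w'"] by simp
  then show ?case using Cons by simp
qed

text \<open>\<open>u\<close> and \<open>v\<close> stand for letters picked on either side of
  \<open>r\<close>; having the condition for all of them is what permits deletion in any
  context.\<close>

lemma spread_insert:
  assumes "\<And>u v. spread c r u v = c (u @ v)"
  shows "spread c (a @ r @ b) u v = spread c (a @ b) u v"
proof -
  have "spread c (r @ b) u v = spread c b u v" for u v
  proof (induction b arbitrary: v rule: rev_induct)
    case (snoc x b)
    then show ?case using spread_snoc[of c "r @ b" x u v] by (simp add: spread_snoc)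
  qed (simp add: assms)
  then show ?thesis by (induction a arbitrary: u) simp_all
qed

lemma spread_append:
  assumes "\<And>u. u \<noteq> [] \<Longrightarrow> spread c t u [] = c u" "spread c t [] [] = c [] + k"
  shows "spread c (w @ t) u [] = spread c w u [] + (if u = [] then k else 0)"
  by (induction w arbitrary: u) (simp_all add: assms ac_simps)

section \<open>Iterated differences and Magnus coefficients\<close>

definition wdif :: "'x \<Rightarrow> ('x list \<Rightarrow> int) \<Rightarrow> 'x list \<Rightarrow> int" where
  "wdif x F = (\<lambda>w. F (x # w) - F w)"

primrec wdifs :: "'x list \<Rightarrow> ('x list \<Rightarrow> int) \<Rightarrow> 'x list \<Rightarrow> int" where
  "wdifs [] F = F"
| "wdifs (x # u) F = wdifs u (wdif x F)"

definition coef :: "('x list \<Rightarrow> int) \<Rightarrow> 'x list \<Rightarrow> int" where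
  "coef F u = wdifs u F []"

lemma wdifs_append: "wdifs (u @ v) F = wdifs v (wdifs u F)"
  by (induction u arbitrary: F) simp_all

lemma wdif_add: "wdif x (\<lambda>w. F w + F' w) = (\<lambda>w. wdif x F w + wdif x F' w)"
  by (auto simp: wdif_def)

lemma wdifs_add: "wdifs u (\<lambda>w. F w + F' w) = (\<lambda>w. wdifs u F w + wdifs u F' w)"
  by (induction u arbitrary: F F') (simp_all add: wdif_add)

text \<open>Newton's forward difference formula for words:
  \<open>F (x # w) = wdif x F w + F w\<close> is iterated letter by letter. With \<open>u\<close>
  and \<open>v\<close> empty it recovers \<open>F\<close> from its coefficients.\<close>

lemma spread_coef: "spread (coef F) w u v = coef (\<lambda>z. wdifs u F (w @ z)) v"
proof (induction w arbitrary: u)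
  case Nil
  show ?case by (simp add: coef_def wdifs_append)
next
  case (Cons x w)
  have "(\<lambda>z. wdifs u F ((x # w) @ z)) = (\<lambda>z. wdifs (u @ [x]) F (w @ z) + wdifs u F (w @ z))"
    by (simp add: wdifs_append wdif_def)
  then show ?case using Cons by (simp add: coef_def wdifs_add)
qed

lemma wdifs_cong:
  "(\<And>w. w \<in> words_over X \<Longrightarrow> F w = F' w) \<Longrightarrow> u \<in> words_over X \<Longrightarrow> w \<in> words_over X \<Longrightarrow>
    wdifs u F w = wdifs u F' w"
proof (induction u arbitrary: F F')
  case (Cons x u)
  have "wdifs u (wdif x F) w = wdifs u (wdif x F') w"
    using Cons.prems by (intro Cons.IH) (auto simp: wdif_def)
  then show ?case by simp
qed simp

lemma wdifs_insert:
  "(\<And>a z. a \<in> words_over X \<Longrightarrow> z \<in> words_over X \<Longrightarrow> F (a @ r @ z) = F (a @ z)) \<Longrightarrow>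
    u \<in> words_over X \<Longrightarrow> z \<in> words_over X \<Longrightarrow> wdifs u F (r @ z) = wdifs u F z"
proof (induction u arbitrary: F)
  case Nil
  then show ?case using Nil.prems(1)[of "[]" z] by simp
next
  case (Cons x u)
  have "wdif x F (a @ r @ z) = wdif x F (a @ z)" if "a \<in> words_over X" "z \<in> words_over X" for a z
    using Cons.prems(1)[of "x # a" z] Cons.prems(1)[of a z] Cons.prems(2) that by (simp add: wdif_def)
  then show ?case using Cons by simp
qed

lemma wdifs_shift:
  "(\<And>w. w \<in> words_over X \<Longrightarrow> F (w @ t) = F w + k) \<Longrightarrow> u \<in> words_over X \<Longrightarrow> w \<in> words_over X \<Longrightarrow>
    wdifs u F (w @ t) = wdifs u F w + (if u = [] then k else 0)"
proof (induction u arbitrary: F k)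
  case (Cons x u)
  have "wdif x F (w @ t) = wdif x F w + 0" if "w \<in> words_over X" for w
    using Cons.prems(1)[of "x # w"] Cons.prems(1)[of w] Cons.prems(2) that by (simp add: wdif_def)
  then have "wdifs u (wdif x F) (w @ t) = wdifs u (wdif x F) w + (if u = [] then 0 else 0)"
    using Cons.prems(2,3) by (intro Cons.IH) simp_all
  then show ?case by simp
qed simp

subsection \<open>Soundness and completeness of coefficient tables\<close>

text \<open>Formal inverses count as independent letters, so the cancelling pairs are treated like
  relators. The conditions are linear in \<open>c\<close> and ensure that deleting a relator in any
  context preserves the value.\<close>

definition relator_balanced :: "'a set \<Rightarrow> 'a gword set \<Rightarrow> ('a gword \<Rightarrow> int) \<Rightarrow> bool" where
  "relator_balanced X R c \<longleftrightarrow> (\<forall>u v. (\<forall>r\<in>R. spread c r u v = c (u @ v)) \<and>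
     (\<forall>x\<in>X. \<forall>b. spread c [(x, b), (x, \<not> b)] u v = c (u @ v)))"

text \<open>The coefficient form of \<open>F (w @ t) = F w + k\<close>: every difference kills a
  constant, so only the coefficient at the empty word changes.\<close>

definition translates :: "('a gword \<Rightarrow> int) \<Rightarrow> 'a gword \<Rightarrow> int \<Rightarrow> bool" where
  "translates c t k \<longleftrightarrow> (\<forall>u. u \<noteq> [] \<longrightarrow> spread c t u [] = c u) \<and> spread c t [] [] = c [] + k"

lemma spread_pres_rel:
  assumes "relator_balanced X R c" "(v, w) \<in> pres_rel X R"
  shows "spread c v [] [] = spread c w [] []"
  using assms(2)
proof (induction rule: pres_rel.induct)
  case (cancel u v x b)
  then show ?case using spread_insert[of c "[(x, b), (x, \<not> b)]" u v "[]" "[]"] assms(1)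
    unfolding relator_balanced_def by blast
next
  case (relator u v r)
  then show ?case using spread_insert[of c r u v "[]" "[]"] assms(1)
    unfolding relator_balanced_def by blast
qed simp_all

lemma translates_concat:
  assumes "\<And>t. t \<in> set ws \<Longrightarrow> translates c t (k t)"
  shows "spread c (concat ws) [] [] = c [] + sum_list (map k ws)"
  using assms
proof (induction ws rule: rev_induct)
  case (snoc t ws)
  have "spread c (concat ws @ t) [] [] = spread c (concat ws) [] [] + k t"
    using spread_append[of c t "k t" "concat ws" "[]"] snoc.prems[of t] by (simp add: translates_def)
  then show ?case using snoc by simp
qed simp

text \<open>Evaluating at \<open>concat ws\<close> adds up the constants of the factors. If the word
  were trivial the sum would be 0, although all constants are nonnegative and that of
  \<open>t0\<close>, which occurs in \<open>ws\<close>, is positive.\<close>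

theorem coefficient_table_sound:
  assumes c: "relator_balanced X R c"
    and t: "\<And>t. t \<in> T \<Longrightarrow> \<exists>k\<ge>0. translates c t k" "t0 \<in> T" "translates c t0 k0" "k0 > 0"
    and ws: "set ws = T"
  shows "(concat ws, []) \<notin> pres_rel X R"
proof
  assume "(concat ws, []) \<in> pres_rel X R"
  from spread_pres_rel[OF c this] have e: "spread c (concat ws) [] [] = c []" by simp
  define k where "k t = (THE k. translates c t k)" for t
  have kk: "k t = a" if "translates c t a" for t a
    unfolding k_def using that by (intro the_equality) (auto simp: translates_def)
  have k: "translates c t (k t) \<and> k t \<ge> 0" if "t \<in> T" for t using t(1)[OF that] kk by auto
  have "sum_list (map k ws) = 0" using translates_concat[of ws c k] k ws e by simp
  then have "k t0 = 0" using k t(2) ws sum_list_nonneg_eq_0_iff[of "map k ws"] by auto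
  then show False using kk[OF t(3)] t(4) by simp
qed

definition pres_fun :: "'a set \<Rightarrow> 'a gword set \<Rightarrow> ('a gword set \<Rightarrow> int) \<Rightarrow> 'a gword \<Rightarrow> int" where
  "pres_fun X R f w = f (word_elt X R w)"

text \<open>Each letter of \<open>u\<close> takes one difference and so lowers the degree; this is
  what makes the table of coefficients finite.\<close>

lemma coef_pol_zero:
  "pol (pres_group X R) (carrier (pres_group X R)) d f \<Longrightarrow> u \<in> words_over X \<Longrightarrow> d \<le> length u \<Longrightarrow>
    coef (pres_fun X R f) u = 0"
proof (induction d arbitrary: f u)
  case 0
  have "pres_fun X R f w = 0" if "w \<in> words_over X" for w
    using 0 that by (auto simp: pres_fun_def carrier_pres_group)
  then have "coef (pres_fun X R f) u = wdifs u (\<lambda>_. 0) []"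
    unfolding coef_def using 0 by (intro wdifs_cong) auto
  moreover have "wdifs u (\<lambda>_. 0) = (\<lambda>_. 0)" by (induction u) (simp_all add: wdif_def)
  ultimately show ?case by simp
next
  case (Suc d)
  then obtain x v where u: "u = x # v" by (cases u) auto
  let ?G = "pres_group X R"
  have x: "[x] \<in> words_over X" "v \<in> words_over X" using Suc.prems u by simp_all
  let ?g = "word_elt X R [x]"
  have "?g \<in> carrier ?G" using x by (auto simp: carrier_pres_group)
  then have "pol ?G (carrier ?G) d (dif ?G ?g f)" using Suc.prems by simp
  from Suc.IH[OF this x(2)] have "coef (pres_fun X R (dif ?G ?g f)) v = 0" using Suc.prems u by simp
  moreover have "wdif x (pres_fun X R f) w = pres_fun X R (dif ?G ?g f) w" if "w \<in> words_over X" for w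
    using mult_pres_group[OF x(1) that] by (simp add: wdif_def pres_fun_def dif_def)
  then have "coef (wdif x (pres_fun X R f)) v = coef (pres_fun X R (dif ?G ?g f)) v"
    unfolding coef_def using x by (intro wdifs_cong) auto
  ultimately show ?case by (simp add: u coef_def)
qed

lemma finite_words_of_bounded_length: "finite X \<Longrightarrow> finite {u \<in> words_over X. length u < d}"
proof -
  assume "finite X"
  then have "finite {u. set u \<subseteq> X \<times> (UNIV :: bool set) \<and> length u \<le> d}" by (intro finite_lists_length_le) auto
  then show ?thesis by (rule finite_subset[rotated]) (auto simp: words_over_def lists_eq_set)
qed

text \<open>Words outside \<open>words_over X\<close> represent no element, so \<open>c\<close> is
  set to 0 there. This keeps the support finite, and the balance conditions for such outer words
  read 0 = 0.\<close>

theorem coefficient_table_complete: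
  assumes X: "finite X" and R: "R \<subseteq> words_over X"
    and f: "pol (pres_group X R) (carrier (pres_group X R)) d f"
  defines "c \<equiv> \<lambda>u. if u \<in> words_over X then coef (pres_fun X R f) u else 0"
  shows "finite {u. c u \<noteq> 0}" "relator_balanced X R c"
    "\<And>t k. t \<in> words_over X \<Longrightarrow>
      (\<And>g. g \<in> carrier (pres_group X R) \<Longrightarrow> f (g \<otimes>\<^bsub>pres_group X R\<^esub> word_elt X R t) = f g + k) \<Longrightarrow>
      translates c t k"
proof -
  let ?F = "pres_fun X R f"
  have "{u. c u \<noteq> 0} \<subseteq> {u \<in> words_over X. length u < d}"
    using coef_pol_zero[OF f] by (auto simp: c_def not_le[symmetric])
  then show "finite {u. c u \<noteq> 0}" using finite_words_of_bounded_length[OF X] by (rule finite_subset)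
  have c_spread: "spread c w u v = spread (coef ?F) w u v"
    if "w \<in> words_over X" "u \<in> words_over X" "v \<in> words_over X" for w u v
    using that by (induction w arbitrary: u) (simp_all add: c_def)
  have c_out: "spread c w u v = 0" if "u \<notin> words_over X \<or> v \<notin> words_over X" for w u v
    by (rule spread_zero) (use that in \<open>auto simp: c_def\<close>)
  have bal: "spread c r u v = c (u @ v)"
    if r: "r \<in> words_over X" "(r, []) \<in> pres_rel X R" for r u v
  proof (cases "u \<in> words_over X \<and> v \<in> words_over X")
    case True
    have "?F (a @ r @ z) = ?F (a @ z)" if "a \<in> words_over X" "z \<in> words_over X" for a z
      using pres_rel_context[OF r(2) that] that r(1) word_elt_eq_iff[of "a @ r @ z" X "a @ z" R]
      by (simp add: pres_fun_def)
    then have "wdifs u ?F (r @ z) = wdifs u ?F z" if "z \<in> words_over X" for z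
      using wdifs_insert[of X ?F r u z] True that by blast
    then have "coef (\<lambda>z. wdifs u ?F (r @ z)) v = coef (wdifs u ?F) v"
      unfolding coef_def using True by (intro wdifs_cong[of X]) auto
    then show ?thesis using True r(1) c_spread[of r u v]
      by (simp add: spread_coef) (simp add: c_def coef_def wdifs_append)
  next
    case False
    then show ?thesis using c_out by (auto simp: c_def)
  qed
  have "(r, []) \<in> pres_rel X R" if "r \<in> R" for r
    using pres_rel.relator[of "[]" X "[]" r R] that R by auto
  moreover have "([(x, b), (x, \<not> b)], []) \<in> pres_rel X R" if "x \<in> X" for x b
    using pres_rel.cancel[of "[]" X "[]" x b R] that by simp
  moreover have "[(x, b), (x, \<not> b)] \<in> words_over X" if "x \<in> X" for x and b :: bool
    using that by simp
  ultimately show "relator_balanced X R c"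
    unfolding relator_balanced_def using bal R by (meson subsetD)
  fix t k assume t: "t \<in> words_over X"
    and k: "\<And>g. g \<in> carrier (pres_group X R) \<Longrightarrow> f (g \<otimes>\<^bsub>pres_group X R\<^esub> word_elt X R t) = f g + k"
  have F: "?F (w @ t) = ?F w + k" if "w \<in> words_over X" for w
    using k[of "word_elt X R w"] mult_pres_group[OF that t] that
    by (auto simp: pres_fun_def carrier_pres_group)
  have shift: "spread c t u [] = c u + (if u = [] then k else 0)" if "u \<in> words_over X" for u
  proof -
    have "spread c t u [] = wdifs u ?F t"
      using c_spread[OF t that, of "[]"] by (simp add: spread_coef coef_def)
    also have "\<dots> = wdifs u ?F [] + (if u = [] then k else 0)"
      using wdifs_shift[of X ?F t k u "[]", OF _ that] F by simp
    also have "wdifs u ?F [] = c u" using that by (simp add: c_def coef_def)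
    finally show ?thesis .
  qed
  have "spread c t u [] = c u" if "u \<noteq> []" for u
  proof (cases "u \<in> words_over X")
    case True
    then show ?thesis using shift[of u] that by simp
  next
    case False
    then show ?thesis using c_out[of u "[]" t] by (simp add: c_def)
  qed
  then show "translates c t k" using shift[of "[]"] unfolding translates_def by simp
qed

subsection \<open>The two problems in terms of words\<close>

definition full_identity :: "'a set \<Rightarrow> 'a gword set \<Rightarrow> 'a gword set \<Rightarrow> bool" where
  "full_identity X R T \<longleftrightarrow> (\<exists>ws. set ws = T \<and> (concat ws, []) \<in> pres_rel X R)"

lemma concat_words_over: "concat ws \<in> words_over X \<longleftrightarrow> set ws \<subseteq> words_over X"
  by (induction ws) auto

lemma list_prod_word_elt:
  "set ws \<subseteq> words_over X \<Longrightarrow> list_prod (pres_group X R) (map (word_elt X R) ws) = word_elt X R (concat ws)"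
  by (induction ws) (simp_all add: one_pres_group mult_pres_group concat_words_over)

lemma pres_group_generated:
  "generate (pres_group X R) ((\<lambda>x. word_elt X R [(x, False)]) ` X) = carrier (pres_group X R)" (is "generate ?G ?Y = _")
proof
  interpret group ?G by (rule group_pres_group)
  have Y: "?Y \<subseteq> carrier ?G" by (auto simp: carrier_pres_group)
  then show "generate ?G ?Y \<subseteq> carrier ?G" by (rule generate_incl)
  have letter: "word_elt X R [(x, b)] \<in> generate ?G ?Y" if x: "x \<in> X" for x b
  proof (cases b)
    case False
    then show ?thesis using x by (auto intro: generate.incl)
  next
    case True
    have "([(x, True), (x, \<not> True)], []) \<in> pres_rel X R"
      using pres_rel.cancel[of "[]" X "[]" x True R] x by simp
    then have "word_elt X R [(x, True)] \<otimes>\<^bsub>?G\<^esub> word_elt X R [(x, False)] = \<one>\<^bsub>?G\<^esub>"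
      using x by (simp add: mult_pres_group one_pres_group word_elt_eq_iff)
    then have "inv\<^bsub>?G\<^esub> word_elt X R [(x, False)] = word_elt X R [(x, True)]"
      using x by (intro inv_equality) (auto simp: carrier_pres_group)
    then show ?thesis using x True generate.inv[of "word_elt X R [(x, False)]" ?Y ?G] by auto
  qed
  have "word_elt X R w \<in> generate ?G ?Y" if "w \<in> words_over X" for w
    using that
  proof (induction w)
    case Nil
    show ?case using generate.one[of ?G ?Y] by (simp add: one_pres_group)
  next
    case (Cons p w)
    obtain x b where p: "p = (x, b)" by force
    have "word_elt X R [(x, b)] \<otimes>\<^bsub>?G\<^esub> word_elt X R w \<in> generate ?G ?Y"
      using Cons p by (intro generate.eng letter) auto
    then show ?case using Cons.prems p by (simp add: mult_pres_group)
  qed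
  then show "carrier ?G \<subseteq> generate ?G ?Y" by (auto simp: carrier_pres_group)
qed

text \<open>Different words of \<open>ts\<close> may represent the same element, so a single lift of
  \<open>es\<close> to words can miss some of them. For each \<open>t\<close> a lift is taken that
  prefers \<open>t\<close> among the words of its element; concatenating these lifts uses every
  word.\<close>

lemma full_identity_if_elements:
  assumes T: "set ts \<subseteq> words_over X"
    and es: "set es = word_elt X R ` set ts" "list_prod (pres_group X R) es = \<one>\<^bsub>pres_group X R\<^esub>"
  shows "full_identity X R (set ts)"
proof -
  have "\<exists>vs. t \<in> set vs \<and> set vs \<subseteq> set ts \<and> (concat vs, []) \<in> pres_rel X R" if t: "t \<in> set ts" for t
  proof -
    define \<rho> where "\<rho> g = (if g = word_elt X R t then t else SOME s. s \<in> set ts \<and> word_elt X R s = g)" for g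
    have \<rho>: "\<rho> g \<in> set ts \<and> word_elt X R (\<rho> g) = g" if g: "g \<in> set es" for g
    proof -
      have "\<exists>s. s \<in> set ts \<and> word_elt X R s = g" using g es(1) by auto
      from someI_ex[OF this] show ?thesis using t by (simp add: \<rho>_def)
    qed
    let ?vs = "map \<rho> es"
    have sub: "set ?vs \<subseteq> set ts" using \<rho> by auto
    have "map (word_elt X R) ?vs = es" using \<rho> by (auto intro: map_idI)
    then have "word_elt X R (concat ?vs) = word_elt X R []"
      using list_prod_word_elt[of ?vs X R] sub T es(2) by (simp add: one_pres_group)
    then have "(concat ?vs, []) \<in> pres_rel X R"
      using sub T concat_words_over[of ?vs X] by (simp add: word_elt_eq_iff)
    moreover have "t \<in> set ?vs" using t es(1) by (auto simp: \<rho>_def image_iff)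
    ultimately show ?thesis using sub by blast
  qed
  then obtain V where V: "\<And>t. t \<in> set ts \<Longrightarrow> t \<in> set (V t) \<and> set (V t) \<subseteq> set ts \<and> (concat (V t), []) \<in> pres_rel X R"
    by metis
  have "(concat (concat (map V us)), []) \<in> pres_rel X R" if "set us \<subseteq> set ts" for us
    using that
  proof (induction us)
    case Nil
    show ?case by (simp add: pres_rel.refl)
  next
    case (Cons t us)
    then show ?case using pres_rel_append[of "concat (V t)" "[]" X R "concat (concat (map V us))" "[]"] V[of t] by simp
  qed
  moreover have "set (concat (map V ts)) = set ts" using V by auto
  ultimately show ?thesis unfolding full_identity_def by blast
qed

lemma semigroup_span_words:
  assumes T: "T \<subseteq> words_over X"
  shows "semigroup_span (pres_group X R) (word_elt X R ` T) =
    {word_elt X R (concat ws) | ws. ws \<noteq> [] \<and> set ws \<subseteq> T}" (is "?S = ?W")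
proof
  show "?S \<subseteq> ?W"
  proof
    fix g assume "g \<in> ?S"
    then show "g \<in> ?W"
    proof (induction rule: semigroup_span.induct)
      case (incl a)
      then obtain t where "t \<in> T" "a = word_elt X R t" by blast
      then have "a = word_elt X R (concat [t])" "set [t] \<subseteq> T" by simp_all
      then show ?case by blast
    next
      case (mult a b)
      then obtain v w where vw: "a = word_elt X R (concat v)" "b = word_elt X R (concat w)"
        "v \<noteq> []" "set v \<subseteq> T" "set w \<subseteq> T" by blast
      then have "a \<otimes>\<^bsub>pres_group X R\<^esub> b = word_elt X R (concat (v @ w))"
        using T mult_pres_group[of "concat v" X "concat w" R] by (simp add: concat_words_over subset_trans)
      moreover have "v @ w \<noteq> []" "set (v @ w) \<subseteq> T" using vw by simp_all
      ultimately show ?case by blast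
    qed
  qed
  have "word_elt X R (concat ws) \<in> ?S" if "ws \<noteq> []" "set ws \<subseteq> T" for ws
    using that
  proof (induction ws rule: list_nonempty_induct)
    case (single t)
    then show ?case by (auto intro: semigroup_span.incl)
  next
    case (cons t ws)
    have "word_elt X R t \<otimes>\<^bsub>pres_group X R\<^esub> word_elt X R (concat ws) \<in> ?S"
      by (rule semigroup_span.mult[OF semigroup_span.incl cons.IH]) (use cons.prems in auto)
    moreover have "t \<in> words_over X" "concat ws \<in> words_over X" using cons.prems T by (auto simp: concat_words_over)
    ultimately show ?case by (simp add: mult_pres_group)
  qed
  then show "?W \<subseteq> ?S" by blast
qed

lemma identity_problem_iff:
  assumes "set ss \<subseteq> words_over {..<n}"
  shows "identity_problem (n, rs, ss) \<longleftrightarrow>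
    (\<exists>T \<subseteq> set ss. T \<noteq> {} \<and> full_identity {..<n} (set rs) T)"
proof -
  have "identity_problem (n, rs, ss) \<longleftrightarrow>
    (\<exists>ws. ws \<noteq> [] \<and> set ws \<subseteq> set ss \<and> word_elt {..<n} (set rs) [] = word_elt {..<n} (set rs) (concat ws))"
    unfolding identity_problem_def instance_group.simps instance_semigroup.simps
      semigroup_span_words[OF assms] one_pres_group by blast
  also have "\<dots> \<longleftrightarrow> (\<exists>ws. ws \<noteq> [] \<and> set ws \<subseteq> set ss \<and> (concat ws, []) \<in> pres_rel {..<n} (set rs))"
    using assms by (intro ex_cong1 conj_cong refl)
      (auto simp: word_elt_eq_iff concat_words_over intro: pres_rel.sym)
  also have "\<dots> \<longleftrightarrow> (\<exists>T \<subseteq> set ss. T \<noteq> {} \<and> full_identity {..<n} (set rs) T)"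
    unfolding full_identity_def by (metis set_empty)
  finally show ?thesis .
qed

text \<open>In a subgroup the product of all of \<open>ss\<close> is inverted by some product
  \<open>vs\<close>, and \<open>ss @ vs\<close> uses every word. Conversely, a trivial product
  \<open>a @ t # b\<close> can be rotated, so that \<open>b @ a\<close> represents the inverse of
  \<open>t\<close>.\<close>

lemma subgroup_problem_iff:
  assumes ss: "set ss \<subseteq> words_over {..<n}"
  shows "subgroup_problem (n, rs, ss) \<longleftrightarrow> ss \<noteq> [] \<and> full_identity {..<n} (set rs) (set ss)"
proof -
  let ?X = "{..<n}" and ?R = "set rs"
  let ?G = "pres_group ?X ?R" and ?e = "word_elt ?X ?R"
  interpret group ?G by (rule group_pres_group)
  define S where "S = semigroup_span ?G (?e ` set ss)"
  have S: "S = {?e (concat ws) | ws. ws \<noteq> [] \<and> set ws \<subseteq> set ss}"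
    unfolding S_def by (rule semigroup_span_words[OF ss])
  have Sc: "S \<subseteq> carrier ?G" unfolding S carrier_pres_group using ss by (auto simp: concat_words_over)
  have "subgroup S ?G \<longleftrightarrow> ss \<noteq> [] \<and> full_identity ?X ?R (set ss)"
  proof
    assume sub: "subgroup S ?G"
    obtain us where "us \<noteq> []" "set us \<subseteq> set ss" using subgroup.one_closed[OF sub] unfolding S by blast
    then have "ss \<noteq> []" by auto
    then have "?e (concat ss) \<in> S" unfolding S by blast
    from subgroup.m_inv_closed[OF sub this] obtain vs
      where vs: "inv\<^bsub>?G\<^esub> ?e (concat ss) = ?e (concat vs)" "set vs \<subseteq> set ss" unfolding S by blast
    have w: "concat ss \<in> words_over ?X" "concat vs \<in> words_over ?X" using ss vs(2) by (auto simp: concat_words_over)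
    have "?e (concat ss) \<otimes>\<^bsub>?G\<^esub> ?e (concat vs) = \<one>\<^bsub>?G\<^esub>"
      unfolding vs(1)[symmetric] using w by (intro r_inv) (auto simp: carrier_pres_group)
    then have "(concat (ss @ vs), []) \<in> pres_rel ?X ?R"
      using w by (simp add: mult_pres_group one_pres_group word_elt_eq_iff)
    moreover have "set (ss @ vs) = set ss" using vs(2) by auto
    ultimately show "ss \<noteq> [] \<and> full_identity ?X ?R (set ss)" using \<open>ss \<noteq> []\<close> unfolding full_identity_def by blast
  next
    assume "ss \<noteq> [] \<and> full_identity ?X ?R (set ss)"
    then obtain ws where ws: "ss \<noteq> []" "set ws = set ss" "(concat ws, []) \<in> pres_rel ?X ?R"
      unfolding full_identity_def by blast
    have "ws \<noteq> []" using ws by auto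
    have ew: "?e (concat ws) = \<one>\<^bsub>?G\<^esub>" using ws ss by (simp add: one_pres_group word_elt_eq_iff concat_words_over)
    have S': "?e (concat vs) \<in> S" if "set vs \<subseteq> set ss" for vs
    proof (cases "vs = []")
      case True
      then have "?e (concat vs) = ?e (concat ws)" using ew by (simp add: one_pres_group)
      then show ?thesis unfolding S using ws(2) \<open>ws \<noteq> []\<close> by blast
    next
      case False
      then show ?thesis unfolding S using that by blast
    qed
    have letter: "inv\<^bsub>?G\<^esub> ?e t \<in> S" if t: "t \<in> set ss" for t
    proof -
      obtain a b where ab: "ws = a @ t # b" using t ws(2) by (metis split_list)
      have sub: "set a \<subseteq> set ss" "set b \<subseteq> set ss" using ab ws(2) by auto
      have w: "concat a \<in> words_over ?X" "t \<in> words_over ?X" "concat b \<in> words_over ?X"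
        using sub t ss by (auto simp: concat_words_over)
      have c: "?e (concat a) \<in> carrier ?G" "?e t \<in> carrier ?G" "?e (concat b) \<in> carrier ?G"
        using w by (auto simp: carrier_pres_group)
      have "?e (concat a) \<otimes>\<^bsub>?G\<^esub> (?e t \<otimes>\<^bsub>?G\<^esub> ?e (concat b)) = \<one>\<^bsub>?G\<^esub>"
        using ew w unfolding ab by (simp add: mult_pres_group)
      from inv_comm[OF this c(1) m_closed[OF c(2,3)]]
      have "(?e t \<otimes>\<^bsub>?G\<^esub> ?e (concat b)) \<otimes>\<^bsub>?G\<^esub> ?e (concat a) = \<one>\<^bsub>?G\<^esub>" .
      then have "?e t \<otimes>\<^bsub>?G\<^esub> ?e (concat (b @ a)) = \<one>\<^bsub>?G\<^esub>"
        using w by (simp add: mult_pres_group)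
      moreover have ba: "?e (concat (b @ a)) \<in> carrier ?G" using w by (auto simp: carrier_pres_group)
      ultimately have "?e (concat (b @ a)) \<otimes>\<^bsub>?G\<^esub> ?e t = \<one>\<^bsub>?G\<^esub>" using inv_comm[OF _ c(2)] by blast
      then have "inv\<^bsub>?G\<^esub> ?e t = ?e (concat (b @ a))" using inv_equality[OF _ c(2) ba] by blast
      then show ?thesis using S'[of "b @ a"] sub by simp
    qed
    have mult: "g \<otimes>\<^bsub>?G\<^esub> h \<in> S" if "g \<in> S" "h \<in> S" for g h
      using that unfolding S_def by (rule semigroup_span.mult)
    have inv: "inv\<^bsub>?G\<^esub> g \<in> S" if "g \<in> S" for g
      using that unfolding S_def
    proof (induction rule: semigroup_span.induct)
      case (incl a)
      then show ?case using letter unfolding S_def by blast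
    next
      case (mult a b)
      have "a \<in> carrier ?G" "b \<in> carrier ?G" using mult.hyps Sc unfolding S_def by blast+
      then show ?case using mult.IH by (simp add: inv_mult_group semigroup_span.mult)
    qed
    show "subgroup S ?G"
    proof
      show "\<one>\<^bsub>?G\<^esub> \<in> S" using S'[of "[]"] by (simp add: one_pres_group)
    qed (use Sc mult inv in auto)
  qed
  then show ?thesis unfolding subgroup_problem_def instance_group.simps instance_semigroup.simps S_def .
qed

theorem full_identity_or_table:
  assumes X: "finite X" and R: "R \<subseteq> words_over X" and ts: "set ts \<subseteq> words_over X"
    and nil: "nilpotent_group (pres_group X R)" and no: "\<not> full_identity X R (set ts)"
  shows "\<exists>c. finite {u. c u \<noteq> 0} \<and> relator_balanced X R c \<and> (\<forall>t\<in>set ts. \<exists>k\<ge>0. translates c t k) \<and>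
    (\<exists>t\<in>set ts. \<exists>k>0. translates c t k)"
proof -
  let ?G = "pres_group X R" and ?e = "word_elt X R"
  interpret group ?G by (rule group_pres_group)
  have "\<nexists>es. set es = set (map ?e ts) \<and> list_prod ?G es = \<one>\<^bsub>?G\<^esub>"
    using full_identity_if_elements[OF ts, of _ R] no by auto
  moreover have "set (map ?e ts) \<subseteq> carrier ?G" using ts by (auto simp: carrier_pres_group)
  moreover have gen: "(\<lambda>x. ?e [(x, False)]) ` X \<subseteq> carrier ?G" by (auto simp: carrier_pres_group)
  ultimately obtain d f where f: "pol ?G (carrier ?G) d f"
    "\<forall>s\<in>set (map ?e ts). \<exists>a\<ge>0. shifts (carrier ?G) f s a" "\<exists>s\<in>set (map ?e ts). \<exists>a>0. shifts (carrier ?G) f s a"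
    using positive_polynomial[OF finite_imageI[OF X] _ pres_group_generated nil, of "map ?e ts"] gen by blast
  note c = coefficient_table_complete[OF X R f(1)]
  have tr: "\<exists>k. Q k \<and> translates (\<lambda>u. if u \<in> words_over X then coef (pres_fun X R f) u else 0) t k"
    if "t \<in> set ts" "\<exists>k. Q k \<and> shifts (carrier ?G) f (?e t) k" for t and Q :: "int \<Rightarrow> bool"
    using c(3)[of t] that ts unfolding shifts_def by blast
  have "\<forall>t\<in>set ts. \<exists>k\<ge>0. translates (\<lambda>u. if u \<in> words_over X then coef (pres_fun X R f) u else 0) t k"
    "\<exists>t\<in>set ts. \<exists>k>0. translates (\<lambda>u. if u \<in> words_over X then coef (pres_fun X R f) u else 0) t k"
    using f(2,3) tr[where Q = "\<lambda>k. k \<ge> 0"] tr[where Q = "\<lambda>k. k > 0"] by simp_all blast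
  with c(1,2) show ?thesis
    by (intro exI[of _ "\<lambda>u. if u \<in> words_over X then coef (pres_fun X R f) u else 0"] conjI)
qed

section \<open>The instance encoding and monotonicity of list codes\<close>

lemma encode_instance_eq: "encode_instance i = encode i"
proof -
  have *: "map (\<lambda>(x, b). prod_encode (x, of_bool b)) w = map encode w" for w :: "nat gword"
    by (rule map_cong) (auto simp: encode_prod_def encode_nat_def encode_bool_def pair_nat_def)
  have "encode_word = encode" by (intro ext) (simp only: encode_word_def encode_list_def *)
  then show ?thesis
    by (cases i) (simp add: encode_prod_def encode_list_def encode_nat_def pair_nat_def)
qed

lemma pair_nat_mono: "b \<le> b' \<Longrightarrow> pair_nat a b \<le> pair_nat a b'"
  using triangle_mono[of "a + b" "a + b'"] by (simp add: pair_nat_def prod_encode_def)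

lemma encode_Cons: "encode (x # xs) = Suc (pair_nat (encode x) (encode xs))"
  by (simp add: encode_list_def pair_nat_def)

lemma encode_Cons_ge: "encode xs \<le> encode (x # xs)"
  using le_prod_encode_2[of "encode xs" "encode x"] unfolding encode_Cons by (simp add: pair_nat_def)

lemma encode_suffix: "encode v \<le> encode (u @ v)"
proof (induction u)
  case (Cons x u)
  then show ?case using encode_Cons_ge[of "u @ v" x] by simp
qed simp

lemma encode_prefix: "encode u \<le> encode (u @ v)"
proof (induction u)
  case Nil
  show ?case by (simp add: encode_list_def)
next
  case (Cons x u)
  then show ?case unfolding append_Cons encode_Cons by (simp add: pair_nat_mono)
qed

lemma encode_filter: "encode (filter P xs) \<le> encode xs"
proof (induction xs)
  case (Cons x xs)
  show ?case
  proof (cases "P x")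
    case True
    then show ?thesis using pair_nat_mono[OF Cons] by (simp add: encode_Cons)
  next
    case False
    then show ?thesis using Cons encode_Cons_ge[of xs x] by simp
  qed
qed simp

subsection \<open>Certificates for NO\<close>

definition tab :: "(nat gword \<times> nat) list \<Rightarrow> nat gword \<Rightarrow> nat" where
  "tab P u = sum_list (map (\<lambda>e. if fst e = u then snd e else 0) P)"

lemma computable_tab [comp_intro]:
  assumes "computable P" "computable u" shows "computable (\<lambda>x. tab (P x) (u x))"
  unfolding tab_def by (intro comp_intro computable_comp[OF assms(1)] computable_comp[OF assms(2)])

text \<open>\<open>spread\<close> calls itself twice, whereas computable recursion runs through one
  accumulator; the accumulator therefore lists all subwords chosen so far.\<close>

lemma spread_fold:
  "sum_list (map (\<lambda>a. c (a @ v)) (foldl (\<lambda>acc x. map (\<lambda>a. a @ [x]) acc @ acc) acc w)) =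
    sum_list (map (\<lambda>a. spread c w a v) acc)"
  by (induction w arbitrary: acc) (simp_all add: sum_list_addf comp_def)

lemma computable_spread_tab [comp_intro]:
  assumes "computable P" "computable w" "computable u" "computable v"
  shows "computable (\<lambda>x. spread (tab (P x)) (w x) (u x) (v x))"
proof -
  have "computable (\<lambda>x. sum_list (map (\<lambda>a. tab (P x) (a @ v x))
      (foldl (\<lambda>acc y. map (\<lambda>a. a @ [y]) acc @ acc) [u x] (w x))))"
    by (intro comp_intro assms computable_comp[OF assms(1)] computable_comp[OF assms(4)])
  then show ?thesis by (simp add: spread_fold)
qed

text \<open>The equation \<open>spread c r u v = c (u @ v)\<close> for
  \<open>c = tab P - tab Q\<close>, with negative terms moved to the other side so that both sides
  are natural numbers.\<close>

definition balanced where
  "balanced P Q r u v \<longleftrightarrow> spread (tab P) r u v + tab Q (u @ v) = spread (tab Q) r u v + tab P (u @ v)"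

lemma balanced_iff:
  "balanced P Q r u v \<longleftrightarrow>
    spread (\<lambda>u. int (tab P u) - int (tab Q u)) r u v = int (tab P (u @ v)) - int (tab Q (u @ v))"
  unfolding balanced_def spread_diff by linarith

text \<open>The table represents the integer coefficients \<open>tab P u - tab Q u\<close>. Words with code at least \<open>B\<close>
  are neither keys nor prefixes or suffixes of keys, so the conditions need only be checked below \<open>B\<close>.\<close>

definition table_ok where
  "table_ok n rs ts B P Q \<longleftrightarrow>
     (\<forall>e\<in>set (P @ Q). encode (fst e) < B) \<and>
     (\<forall>i<B. \<forall>j<B. (\<forall>r\<in>set rs. balanced P Q r (decode i) (decode j)) \<and>
        (\<forall>x<n. balanced P Q [(x, True), (x, False)] (decode i) (decode j) \<and>
           balanced P Q [(x, False), (x, True)] (decode i) (decode j))) \<and>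
     (\<forall>t\<in>set ts. (\<forall>i<B. decode i = ([] :: nat gword) \<or> balanced P Q t (decode i) []) \<and>
        spread (tab Q) t [] [] + tab P [] \<le> spread (tab P) t [] [] + tab Q []) \<and>
     (\<exists>t\<in>set ts. spread (tab Q) t [] [] + tab P [] < spread (tab P) t [] [] + tab Q [])"

lemma computable_table_ok:
  "computable (\<lambda>p. table_ok (fst (fst p)) (fst (snd (fst p))) (snd (snd (fst p)))
     (fst (snd p)) (fst (snd (snd p))) (snd (snd (snd p))))"
  unfolding table_ok_def balanced_def by (intro comp_intro)

lemma tab_zero: "(\<And>e. e \<in> set P \<Longrightarrow> fst e \<noteq> u) \<Longrightarrow> tab P u = 0"
  by (induction P) (auto simp: tab_def)

lemma table_ok_sound:
  assumes ok: "table_ok n rs ts B P Q"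
  shows "\<not> full_identity {..<n} (set rs) (set ts)"
proof -
  define c where "c u = int (tab P u) - int (tab Q u)" for u
  have bal: "balanced P Q r u v \<longleftrightarrow> spread c r u v = c (u @ v)" for r u v
    unfolding balanced_iff c_def by simp
  have keys: "\<forall>e\<in>set (P @ Q). encode (fst e) < B"
    and rels: "\<forall>i<B. \<forall>j<B. \<forall>r\<in>set rs. balanced P Q r (decode i) (decode j)"
    and pairs: "\<forall>i<B. \<forall>j<B. \<forall>x<n. balanced P Q [(x, True), (x, False)] (decode i) (decode j) \<and>
        balanced P Q [(x, False), (x, True)] (decode i) (decode j)"
    and trans: "\<forall>t\<in>set ts. \<forall>i<B. decode i = ([] :: nat gword) \<or> balanced P Q t (decode i) []"
    and weak: "\<forall>t\<in>set ts. spread (tab Q) t [] [] + tab P [] \<le> spread (tab P) t [] [] + tab Q []"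
    and strict: "\<exists>t\<in>set ts. spread (tab Q) t [] [] + tab P [] < spread (tab P) t [] [] + tab Q []"
    using ok unfolding table_ok_def by blast+
  have zero: "c w = 0" if w: "encode w \<ge> B" for w
  proof -
    have "fst e \<noteq> w" if "e \<in> set (P @ Q)" for e using keys w that by (metis not_less)
    then show ?thesis using tab_zero[of P w] tab_zero[of Q w] by (simp add: c_def)
  qed
  \<comment> \<open>A word with prefix \<open>u\<close> or suffix \<open>v\<close> has at least the
    code of that part, so all coefficients involved vanish.\<close>
  have out: "spread c r u v = c (u @ v)" if uv: "encode u \<ge> B \<or> encode v \<ge> B" for r u v
  proof -
    have z: "c (u @ w @ v) = 0" for w
      using uv encode_prefix[of u "w @ v"] encode_suffix[of v "u @ w"] by (intro zero) auto
    show ?thesis using spread_zero[of c u v r] z z[of "[]"] by simp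
  qed
  have 1: "spread c r u v = c (u @ v)" if r: "r \<in> set rs" for r u v
  proof (cases "encode u < B \<and> encode v < B")
    case True
    then show ?thesis using rels[rule_format, of "encode u" "encode v" r] r by (simp add: bal)
  qed (use out in \<open>auto simp: not_less\<close>)
  have 2: "spread c [(x, b), (x, \<not> b)] u v = c (u @ v)" if x: "x < n" for x b u v
  proof (cases "encode u < B \<and> encode v < B")
    case True
    then have "spread c [(x, True), (x, False)] u v = c (u @ v) \<and> spread c [(x, False), (x, True)] u v = c (u @ v)"
      using pairs[rule_format, of "encode u" "encode v" x] x unfolding bal by (simp only: decode_encode)
    then show ?thesis by (cases b) simp_all
  next
    case False
    then show ?thesis by (intro out) (simp add: not_less disj_commute linorder_not_less de_Morgan_conj)
  qed
  have rel: "relator_balanced {..<n} (set rs) c"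
    unfolding relator_balanced_def using 1 2 by blast
  have tr: "translates c t (spread c t [] [] - c [])" if t: "t \<in> set ts" for t
    unfolding translates_def
  proof (intro conjI allI impI)
    fix u :: "nat gword" assume u: "u \<noteq> []"
    show "spread c t u [] = c u"
    proof (cases "encode u < B")
      case True
      then have "balanced P Q t u []" using trans[rule_format, OF t, of "encode u"] u by simp
      then show ?thesis unfolding bal by simp
    next
      case False
      then show ?thesis using out[of u "[]" t] by simp
    qed
  qed simp
  have val: "spread c t [] [] - c [] = int (spread (tab P) t [] [] + tab Q []) - int (spread (tab Q) t [] [] + tab P [])" for t
    unfolding c_def spread_diff by simp
  have nonneg: "\<exists>k\<ge>0. translates c t k" if "t \<in> set ts" for t
  proof (intro exI conjI)
    show "spread c t [] [] - c [] \<ge> 0" using weak that unfolding val by force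
    show "translates c t (spread c t [] [] - c [])" by (rule tr[OF that])
  qed
  obtain t0 where t0: "t0 \<in> set ts" "spread (tab Q) t0 [] [] + tab P [] < spread (tab P) t0 [] [] + tab Q []"
    using strict by blast
  then have pos: "spread c t0 [] [] - c [] > 0" unfolding val by linarith
  show ?thesis
    unfolding full_identity_def using coefficient_table_sound[OF rel nonneg t0(1) tr[OF t0(1)] pos] by blast
qed

lemma tab_map:
  assumes "distinct U" shows "tab (map (\<lambda>u. (u, h u)) U) w = (if w \<in> set U then h w else 0)"
  using assms by (induction U) (auto simp: tab_def)

lemma table_ok_complete:
  assumes fin: "finite {u. c u \<noteq> 0}" and rel: "relator_balanced {..<n} (set rs) c"
    and tr: "\<And>t. t \<in> set ts \<Longrightarrow> \<exists>k\<ge>0. translates c t k" "\<exists>t\<in>set ts. \<exists>k>0. translates c t k"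
  shows "\<exists>B P Q. table_ok n rs ts B P Q"
proof -
  obtain U where U: "set U = {u. c u \<noteq> 0}" "distinct U" using finite_distinct_list[OF fin] by blast
  define P where "P = map (\<lambda>u. (u, nat (c u))) U"
  define Q where "Q = map (\<lambda>u. (u, nat (- c u))) U"
  define B where "B = Suc (sum_list (map encode U))"
  have c: "c = (\<lambda>u. int (tab P u) - int (tab Q u))"
    using U by (auto simp: P_def Q_def tab_map fun_eq_iff)
  have bal: "balanced P Q r u v \<longleftrightarrow> spread c r u v = c (u @ v)" for r u v
    unfolding balanced_iff c by simp
  have val: "spread c t [] [] - c [] = int (spread (tab P) t [] [] + tab Q []) - int (spread (tab Q) t [] [] + tab P [])" for t
    unfolding c spread_diff by simp
  have "encode (fst e) < B" if "e \<in> set (P @ Q)" for e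
  proof -
    have "fst e \<in> set U" using that by (auto simp: P_def Q_def)
    then have "encode (fst e) \<le> sum_list (map encode U)" by (intro member_le_sum_list) auto
    then show ?thesis by (simp add: B_def)
  qed
  moreover have "balanced P Q r u v" if "r \<in> set rs" for r u v
    using rel that unfolding relator_balanced_def bal by blast
  moreover have "balanced P Q [(x, True), (x, False)] u v" "balanced P Q [(x, False), (x, True)] u v" if "x < n" for x u v
  proof -
    have "spread c [(x, b), (x, \<not> b)] u v = c (u @ v)" for b
      using rel that unfolding relator_balanced_def by blast
    from this[of True] this[of False]
    show "balanced P Q [(x, True), (x, False)] u v" "balanced P Q [(x, False), (x, True)] u v"
      unfolding bal by simp_all
  qed
  moreover have "u = [] \<or> balanced P Q t u []" if "t \<in> set ts" for t u
    using tr(1)[OF that] unfolding translates_def bal by auto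
  moreover have "spread (tab Q) t [] [] + tab P [] \<le> spread (tab P) t [] [] + tab Q []" if "t \<in> set ts" for t
  proof -
    have "spread c t [] [] - c [] \<ge> 0" using tr(1)[OF that] unfolding translates_def by auto
    then show ?thesis unfolding val by linarith
  qed
  moreover have "\<exists>t\<in>set ts. spread (tab Q) t [] [] + tab P [] < spread (tab P) t [] [] + tab Q []"
  proof -
    obtain t where t: "t \<in> set ts" "\<exists>k>0. translates c t k" using tr(2) by blast
    then have "spread c t [] [] - c [] > 0" unfolding translates_def by auto
    then have "spread (tab Q) t [] [] + tab P [] < spread (tab P) t [] [] + tab Q []" unfolding val by linarith
    then show ?thesis using t(1) by blast
  qed
  ultimately have "table_ok n rs ts B P Q" unfolding table_ok_def by blast
  then show ?thesis by blast
qed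

subsection \<open>Certificates for YES\<close>

definition is_rel :: "nat \<Rightarrow> nat gword list \<Rightarrow> nat gword \<Rightarrow> bool" where
  "is_rel n rs p \<longleftrightarrow> p \<in> set rs \<or> (\<exists>x<n. p = [(x, True), (x, False)] \<or> p = [(x, False), (x, True)])"

text \<open>A move \<open>(ins, u, p, v)\<close> inserts or deletes the relator \<open>p\<close> between \<open>u\<close> and \<open>v\<close>; inapplicable moves do nothing.\<close>

definition rewrite_step where
  "rewrite_step n rs w a =
    (if is_rel n rs (fst (snd (snd a))) then
       if fst a \<and> w = fst (snd a) @ snd (snd (snd a)) then fst (snd a) @ fst (snd (snd a)) @ snd (snd (snd a))
       else if \<not> fst a \<and> w = fst (snd a) @ fst (snd (snd a)) @ snd (snd (snd a)) then fst (snd a) @ snd (snd (snd a))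
       else w
     else w)"

lemma computable_rewrite:
  "computable (\<lambda>p. foldl (rewrite_step (fst (fst p)) (fst (snd (fst p)))) [] (snd (snd p)) = concat (fst (snd p)))"
  unfolding rewrite_step_def is_rel_def by (intro comp_intro)

lemma is_rel_pres_rel:
  assumes "is_rel n rs p" "set rs \<subseteq> words_over {..<n}" "u \<in> words_over {..<n}" "v \<in> words_over {..<n}"
  shows "(u @ p @ v, u @ v) \<in> pres_rel {..<n} (set rs)"
  using assms pres_rel.relator[of u "{..<n}" v p "set rs"]
    pres_rel.cancel[of u "{..<n}" v _ True "set rs"] pres_rel.cancel[of u "{..<n}" v _ False "set rs"]
  unfolding is_rel_def by auto

lemma rewrite_step_pres_rel:
  assumes rs: "set rs \<subseteq> words_over {..<n}" and w: "w \<in> words_over {..<n}"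
  shows "(w, rewrite_step n rs w a) \<in> pres_rel {..<n} (set rs)"
proof -
  obtain i u p v where a: "a = (i, u, p, v)" by (metis prod.exhaust)
  have refl: "(w, w) \<in> pres_rel {..<n} (set rs)" using w by (rule pres_rel.refl)
  show ?thesis
  proof (cases "is_rel n rs p")
    case True
    show ?thesis
    proof (cases "i \<and> w = u @ v")
      case ins: True
      then have "rewrite_step n rs w a = u @ p @ v" using True by (simp add: rewrite_step_def a)
      then show ?thesis using is_rel_pres_rel[OF True rs, of u v] w ins by (auto intro: pres_rel.sym)
    next
      case nins: False
      show ?thesis
      proof (cases "\<not> i \<and> w = u @ p @ v")
        case del: True
        then have "rewrite_step n rs w a = u @ v" using True by (simp add: rewrite_step_def a)
        then show ?thesis using is_rel_pres_rel[OF True rs, of u v] w del by auto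
      next
        case False
        then have "rewrite_step n rs w a = w" using nins by (auto simp: rewrite_step_def a)
        then show ?thesis using refl by simp
      qed
    qed
  qed (use refl in \<open>simp add: rewrite_step_def a\<close>)
qed

lemma rewrite_pres_rel:
  assumes rs: "set rs \<subseteq> words_over {..<n}"
  shows "w \<in> words_over {..<n} \<Longrightarrow> (w, foldl (rewrite_step n rs) w d) \<in> pres_rel {..<n} (set rs)"
proof (induction d arbitrary: w)
  case Nil
  then show ?case by (simp add: pres_rel.refl)
next
  case (Cons a d)
  note 1 = rewrite_step_pres_rel[OF rs Cons.prems, of a]
  have "rewrite_step n rs w a \<in> words_over {..<n}" using pres_rel_words[OF 1] by blast
  from pres_rel.trans[OF 1 Cons.IH[OF this]] show ?case by simp
qed

text \<open>Every move has an inverse move, so both directions are carried through the induction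
  together; this settles the symmetry rule.\<close>

lemma pres_rel_rewrite:
  assumes "(v, w) \<in> pres_rel {..<n} (set rs)"
  shows "(\<exists>d. foldl (rewrite_step n rs) v d = w) \<and> (\<exists>d. foldl (rewrite_step n rs) w d = v)"
  using assms
proof (induction rule: pres_rel.induct)
  case (refl w)
  have "foldl (rewrite_step n rs) w [] = w" by simp
  then show ?case by blast
next
  case (trans u v w)
  then obtain d d' e e' where "foldl (rewrite_step n rs) u d = v" "foldl (rewrite_step n rs) v e = w"
    "foldl (rewrite_step n rs) v d' = u" "foldl (rewrite_step n rs) w e' = v" by blast
  then have "foldl (rewrite_step n rs) u (d @ e) = w" "foldl (rewrite_step n rs) w (e' @ d') = u" by simp_all
  then show ?case by blast
next
  case (cancel u v x b)
  have r: "is_rel n rs [(x, b), (x, \<not> b)]" using cancel by (cases b) (auto simp: is_rel_def)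
  have "foldl (rewrite_step n rs) (u @ v) [(True, u, [(x, b), (x, \<not> b)], v)] = u @ [(x, b), (x, \<not> b)] @ v"
    "foldl (rewrite_step n rs) (u @ [(x, b), (x, \<not> b)] @ v) [(False, u, [(x, b), (x, \<not> b)], v)] = u @ v"
    using r by (simp_all add: rewrite_step_def)
  then show ?case by blast
next
  case (relator u v r)
  have r: "is_rel n rs r" using relator by (simp add: is_rel_def)
  have "foldl (rewrite_step n rs) (u @ v) [(True, u, r, v)] = u @ r @ v"
    "foldl (rewrite_step n rs) (u @ r @ v) [(False, u, r, v)] = u @ v"
    using r by (simp_all add: rewrite_step_def)
  then show ?case by blast
qed blast

lemma rewrite_iff:
  assumes "set rs \<subseteq> words_over {..<n}"
  shows "(\<exists>d. foldl (rewrite_step n rs) [] d = w) \<longleftrightarrow> (w, []) \<in> pres_rel {..<n} (set rs)"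
  using rewrite_pres_rel[OF assms, of "[]"] pres_rel_rewrite[of w "[]" n rs] pres_rel.sym by fastforce

subsection \<open>Decidability\<close>

definition yes_identity :: "problem_instance \<Rightarrow> bool" where
  "yes_identity i \<longleftrightarrow> (\<exists>z. fst z \<noteq> [] \<and> set (fst z) \<subseteq> set (snd (snd i)) \<and>
     foldl (rewrite_step (fst i) (fst (snd i))) [] (snd z) = concat (fst z))"

definition yes_subgroup :: "problem_instance \<Rightarrow> bool" where
  "yes_subgroup i \<longleftrightarrow> (\<exists>z. fst z \<noteq> [] \<and> set (fst z) \<subseteq> set (snd (snd i)) \<and> set (snd (snd i)) \<subseteq> set (fst z) \<and>
     foldl (rewrite_step (fst i) (fst (snd i))) [] (snd z) = concat (fst z))"

definition no_full :: "problem_instance \<Rightarrow> bool" where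
  "no_full i \<longleftrightarrow> (\<exists>z. table_ok (fst i) (fst (snd i)) (snd (snd i)) (fst z) (fst (snd z)) (snd (snd z)))"

text \<open>Every subset of the given words is the set of a sublist, whose code is at most that of
  the whole list by \<open>encode_filter\<close>. A bounded quantifier over codes therefore reaches
  all subsets and preserves semidecidability.\<close>

definition no_identity :: "problem_instance \<Rightarrow> bool" where
  "no_identity i \<longleftrightarrow> (\<forall>k < Suc (encode (snd (snd i))).
     (decode k :: nat gword list) \<noteq> [] \<and> set (decode k :: nat gword list) \<subseteq> set (snd (snd i)) \<longrightarrow>
       no_full (fst i, fst (snd i), decode k))"

text \<open>The empty list is treated apart: it is full by way of the empty product, yet the empty
  semigroup is not a subgroup. The disjunct stands under the quantifier to give the form that
  \<open>semidecidableI\<close> expects.\<close>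

definition no_subgroup :: "problem_instance \<Rightarrow> bool" where
  "no_subgroup i \<longleftrightarrow> (\<exists>z. snd (snd i) = [] \<or>
     table_ok (fst i) (fst (snd i)) (snd (snd i)) (fst z) (fst (snd z)) (snd (snd z)))"

lemma semidecidable_yes: "semidecidable yes_identity" "semidecidable yes_subgroup"
  by (rule semidecidableI[OF _ yes_identity_def], intro comp_intro computable_rewrite)
    (rule semidecidableI[OF _ yes_subgroup_def], intro comp_intro computable_rewrite)

lemma semidecidable_no_subgroup: "semidecidable no_subgroup"
  by (rule semidecidableI[OF _ no_subgroup_def], intro comp_intro computable_table_ok)

lemma semidecidable_no_identity: "semidecidable no_identity"
proof -
  have "semidecidable (\<lambda>p :: problem_instance \<times> nat. no_full (fst (fst p), fst (snd (fst p)), decode (snd p)))"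
  proof (rule semidecidableI)
    show "computable (\<lambda>p :: (problem_instance \<times> nat) \<times> (nat \<times> (nat gword \<times> nat) list \<times> (nat gword \<times> nat) list).
       table_ok (fst (fst (fst p))) (fst (snd (fst (fst p)))) (decode (snd (fst p)))
         (fst (snd p)) (fst (snd (snd p))) (snd (snd (snd p))))"
      unfolding table_ok_def balanced_def by (intro comp_intro)
  qed (simp add: no_full_def)
  then show ?thesis unfolding no_identity_def
    by (rule semidecidable_all_less) (intro comp_intro)+
qed

theorem mainTheorem2:
  shows "decidable_on encode_instance nilpotent_instances identity_problem \<and>
         decidable_on encode_instance nilpotent_instances subgroup_problem"
proof -
  have full: "full_identity {..<n} (set rs) (set ts) \<longleftrightarrow> \<not> no_full (n, rs, ts)"
    if "(n, rs, ss) \<in> nilpotent_instances" "set ts \<subseteq> set ss" for n rs ss ts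
  proof
    show "full_identity {..<n} (set rs) (set ts) \<Longrightarrow> \<not> no_full (n, rs, ts)"
      using table_ok_sound unfolding no_full_def by auto
    assume no: "\<not> no_full (n, rs, ts)"
    show "full_identity {..<n} (set rs) (set ts)"
    proof (rule ccontr)
      assume n: "\<not> full_identity {..<n} (set rs) (set ts)"
      have "\<exists>c. finite {u. c u \<noteq> 0} \<and> relator_balanced {..<n} (set rs) c \<and>
        (\<forall>t\<in>set ts. \<exists>k\<ge>0. translates c t k) \<and> (\<exists>t\<in>set ts. \<exists>k>0. translates c t k)"
        using that n by (intro full_identity_or_table) (auto simp: nilpotent_instances_def)
      then obtain c where "finite {u. c u \<noteq> 0}" "relator_balanced {..<n} (set rs) c"
        "\<forall>t\<in>set ts. \<exists>k\<ge>0. translates c t k" "\<exists>t\<in>set ts. \<exists>k>0. translates c t k" by blast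
      then have "\<exists>B P Q. table_ok n rs ts B P Q" by (intro table_ok_complete[of c]) blast+
      then show False using no unfolding no_full_def by auto
    qed
  qed
  have "decidable_on (\<lambda>i. encode i) nilpotent_instances identity_problem"
  proof (rule decidable_onI[OF semidecidable_yes(1) semidecidable_no_identity])
    fix i assume i: "i \<in> nilpotent_instances"
    obtain n rs ss where e: "i = (n, rs, ss)" by (metis prod.exhaust)
    have w: "set rs \<subseteq> words_over {..<n}" "set ss \<subseteq> words_over {..<n}"
      using i by (auto simp: e nilpotent_instances_def)
    have yes: "identity_problem i \<longleftrightarrow> yes_identity i"
    proof -
      have "yes_identity i \<longleftrightarrow> (\<exists>ws. ws \<noteq> [] \<and> set ws \<subseteq> set ss \<and> (concat ws, []) \<in> pres_rel {..<n} (set rs))"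
        unfolding yes_identity_def e rewrite_iff[OF w(1), symmetric] by auto
      also have "\<dots> \<longleftrightarrow> identity_problem i"
        unfolding e identity_problem_iff[OF w(2)] full_identity_def by (metis set_empty)
      finally show ?thesis by blast
    qed
    have no: "no_identity i \<longleftrightarrow> \<not> identity_problem i"
    proof -
      have "identity_problem i \<longleftrightarrow> (\<exists>ts. ts \<noteq> [] \<and> encode ts < Suc (encode ss) \<and> set ts \<subseteq> set ss \<and> \<not> no_full (n, rs, ts))"
        unfolding e identity_problem_iff[OF w(2)]
      proof
        assume "\<exists>T \<subseteq> set ss. T \<noteq> {} \<and> full_identity {..<n} (set rs) T"
        then obtain T where T: "T \<subseteq> set ss" "T \<noteq> {}" "full_identity {..<n} (set rs) T" by blast
        define ts where "ts = filter (\<lambda>t. t \<in> T) ss"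
        have ts: "set ts = T" using T(1) by (auto simp: ts_def)
        have "encode ts < Suc (encode ss)" unfolding ts_def using encode_filter[of "\<lambda>t. t \<in> T" ss] by simp
        moreover have "ts \<noteq> []" using ts T(2) by auto
        moreover have "\<not> no_full (n, rs, ts)" using full[of n rs ss ts] i T e ts by blast
        ultimately show "\<exists>ts. ts \<noteq> [] \<and> encode ts < Suc (encode ss) \<and> set ts \<subseteq> set ss \<and> \<not> no_full (n, rs, ts)"
          using ts T(1) by blast
      next
        assume "\<exists>ts. ts \<noteq> [] \<and> encode ts < Suc (encode ss) \<and> set ts \<subseteq> set ss \<and> \<not> no_full (n, rs, ts)"
        then obtain ts where "ts \<noteq> []" "set ts \<subseteq> set ss" "full_identity {..<n} (set rs) (set ts)"
          using full[of n rs ss] i e by blast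
        then show "\<exists>T \<subseteq> set ss. T \<noteq> {} \<and> full_identity {..<n} (set rs) T" by (metis set_empty)
      qed
      also have "\<dots> \<longleftrightarrow> \<not> no_identity i"
      proof
        assume "\<exists>ts. ts \<noteq> [] \<and> encode ts < Suc (encode ss) \<and> set ts \<subseteq> set ss \<and> \<not> no_full (n, rs, ts)"
        then obtain ts where "ts \<noteq> []" "encode ts < Suc (encode ss)" "set ts \<subseteq> set ss" "\<not> no_full (n, rs, ts)" by blast
        then show "\<not> no_identity i" unfolding no_identity_def e
          by (intro notI) (drule spec[of _ "encode ts"], simp)
      next
        assume "\<not> no_identity i"
        then obtain k where k: "decode k \<noteq> ([] :: nat gword list)" "k < Suc (encode ss)"
          "set (decode k :: nat gword list) \<subseteq> set ss" "\<not> no_full (n, rs, decode k)"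
          unfolding no_identity_def e by auto
        \<comment> \<open>\<open>k\<close> need not be the canonical code of the list it decodes to,
          so the list is replaced by the sublist of \<open>ss\<close> with the same set; fullness
          depends on the set only.\<close>
        define T where "T = set (decode k :: nat gword list)"
        define ts where "ts = filter (\<lambda>t. t \<in> T) ss"
        have ts: "set ts = T" using k(3) by (auto simp: ts_def T_def)
        have "\<not> no_full (n, rs, ts)"
          using full[of n rs ss ts] full[of n rs ss "decode k"] i k(3,4) ts e unfolding T_def by simp
        moreover have "encode ts < Suc (encode ss)" unfolding ts_def using encode_filter[of "\<lambda>t. t \<in> T" ss] by simp
        moreover have "ts \<noteq> []" using ts k(1) unfolding T_def by auto
        ultimately show "\<exists>ts. ts \<noteq> [] \<and> encode ts < Suc (encode ss) \<and> set ts \<subseteq> set ss \<and> \<not> no_full (n, rs, ts)"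
          using ts k(3) unfolding T_def by blast
      qed
      finally show ?thesis by blast
    qed
    show "identity_problem i \<Longrightarrow> yes_identity i \<and> \<not> no_identity i"
      "\<not> identity_problem i \<Longrightarrow> no_identity i \<and> \<not> yes_identity i"
      using yes no by blast+
  qed
  moreover have "decidable_on (\<lambda>i. encode i) nilpotent_instances subgroup_problem"
  proof (rule decidable_onI[OF semidecidable_yes(2) semidecidable_no_subgroup])
    fix i assume i: "i \<in> nilpotent_instances"
    obtain n rs ss where e: "i = (n, rs, ss)" by (metis prod.exhaust)
    have w: "set rs \<subseteq> words_over {..<n}" "set ss \<subseteq> words_over {..<n}"
      using i by (auto simp: e nilpotent_instances_def)
    have "yes_subgroup i \<longleftrightarrow> (\<exists>ws. ws \<noteq> [] \<and> set ws = set ss \<and> (concat ws, []) \<in> pres_rel {..<n} (set rs))"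
      unfolding yes_subgroup_def e rewrite_iff[OF w(1), symmetric] by auto
    also have "\<dots> \<longleftrightarrow> subgroup_problem i"
      unfolding e subgroup_problem_iff[OF w(2)] full_identity_def by (metis set_empty)
    finally have yes: "subgroup_problem i \<longleftrightarrow> yes_subgroup i" by blast
    have no: "no_subgroup i \<longleftrightarrow> \<not> subgroup_problem i"
      using full[of n rs ss ss] i
      unfolding e no_subgroup_def subgroup_problem_iff[OF w(2)] no_full_def by auto
    show "subgroup_problem i \<Longrightarrow> yes_subgroup i \<and> \<not> no_subgroup i"
      "\<not> subgroup_problem i \<Longrightarrow> no_subgroup i \<and> \<not> yes_subgroup i"
      using yes no by blast+
  qed
  moreover have "(\<lambda>i. encode i) = encode_instance" by (simp add: fun_eq_iff encode_instance_eq)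
  ultimately show ?thesis by simp
qed

end
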